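(* Fix constants $\alpha\in(0,1)$ and $\rho\in(0,1]$. There is a function $\delta(n)\to0$ (as $n\to\infty$), depending only on $\alpha,\rho$, such that for all sufficiently large $n$ the following holds with $m=\alpha n^2$. Consider properties $\vec{\mathcal{U}}\subseteq\vec{\mathcal{P}}_{n,m}$ and $\mathcal{T}\subseteq\mathcal{L}_n$ such that $\vec{\mathcal{U}}$ is $(\rho,m)$-inherited from $\mathcal{T}$. Let $\vec{\mathbf{R}}\sim\mathrm{TRP}(n,m)$ be obtained by $m$ steps of the triangle removal process, and let $\mathbf{L}\in\mathcal{L}_n$ be a uniformly random $n\times n$ Latin square. Then \[ \Pr[\mathbf{L}\in\mathcal{T}]\le\exp\left(\frac{n\log^2 n}{1-\alpha-\delta(n)}\right)\Pr[\vec{\mathbf{R}}\in\vec{\mathcal{U}}]. \]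
   Context: Convention: floor and ceiling signs are omitted, so $\alpha n^2$ is treated as an integer (e.g. read $\lfloor\alpha n^2\rfloor$). $\log$ is natural. An $n\times n$ Latin square is an $n\times n$ array filled with symbols $1,\dots,n$, each appearing exactly once in each row and column. It is identified with the tripartite 3-uniform hypergraph with parts (rows, columns, symbols), each of size $n$, whose hyperedges are the triples $(r,c,s)$ such that symbol $s$ is in row $r$, column $c$; thus every pair of vertices in different parts lies in exactly one hyperedge. $\mathcal{L}_n$ is the set of all $n\times n$ Latin squares. An $n\times n$ partial Latin square is such a tripartite hypergraph in which every pair of vertices in different parts lies in at most one hyperedge; an ordered partial Latin square is a partial Latin square together with an ordering of its hyperedges. $\vec{\mathcal{P}}_{n,m}$ is the set of $n\times n$ ordered partial Latin squares with $m$ hyperedges. $\vec{\mathcal{U}}$ is $(\rho,m)$-inherited from $\mathcal{T}$ if for every $L\in\mathcal{T}$, taking $\vec{\mathbf{P}}_m(L)$ to be a uniformly random subset of $m$ hyperedges of $L$ equipped with a uniformly random order, we have $\Pr[\vec{\mathbf{P}}_m(L)\in\vec{\mathcal{U}}]\ge\rho$. $\mathrm{TRP}(n,m)$ (triangle removal process) is the distribution on $\vec{\mathcal{P}}_{n,m}\cup\{\perp\}$ obtained as follows: start with the complete tripartite graph $K_{n,n,n}$ (parts: rows, columns, symbols); at each step choose a uniformly random triangle among all triangles in the current graph and remove it (delete its three edges). After $m$ steps, the sequence of removed triangles is an ordered partial Latin square, which is the outcome; if at some point there are no triangles left before $m$ steps are completed, the outcome is $\perp$ (which belongs to no property). *)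

theory Defs
  imports "HOL-Probability.Probability" "HOL-Combinatorics.Multiset_Permutations"
begin

datatype vertex = Row nat | Col nat | Sym nat

type_synonym hyperedge = "nat \<times> nat \<times> nat"  \<comment> \<open>row, column, symbol\<close>

text \<open>The pairs of vertices of a hyperedge. Equivalently, the three edges of the triangle on
  the vertices \<open>Row r\<close>, \<open>Col c\<close>, \<open>Sym s\<close>.\<close>

fun pairs :: "hyperedge \<Rightarrow> vertex set set" where
  "pairs (r, c, s) = {{Row r, Col c}, {Row r, Sym s}, {Col c, Sym s}}"

definition all_triples :: "nat \<Rightarrow> hyperedge set" where
  "all_triples n = {1..n} \<times> {1..n} \<times> {1..n}"

text \<open>The edges of the complete tripartite graph with parts \<open>Row ` {1..n}\<close>, \<open>Col ` {1..n}\<close>,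
  \<open>Sym ` {1..n}\<close>, that is, all pairs of vertices in different parts.\<close>

definition complete_tripartite :: "nat \<Rightarrow> vertex set set" where
  "complete_tripartite n =
     {{Row r, Col c} | r c. r \<in> {1..n} \<and> c \<in> {1..n}} \<union>
     {{Row r, Sym s} | r s. r \<in> {1..n} \<and> s \<in> {1..n}} \<union>
     {{Col c, Sym s} | c s. c \<in> {1..n} \<and> s \<in> {1..n}}"

text \<open>\<open>A r c\<close> is the symbol in row \<open>r\<close> and column \<open>c\<close>; values of \<open>A\<close> outside the range
  \<open>{1..n}\<close> are irrelevant. Latin squares are then identified with their hypergraphs.\<close>

definition latin_array :: "nat \<Rightarrow> (nat \<Rightarrow> nat \<Rightarrow> nat) \<Rightarrow> bool" where
  "latin_array n A \<longleftrightarrow>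
     (\<forall>r\<in>{1..n}. \<forall>c\<in>{1..n}. A r c \<in> {1..n}) \<and>
     (\<forall>r\<in>{1..n}. \<forall>s\<in>{1..n}. \<exists>!c. c \<in> {1..n} \<and> A r c = s) \<and>
     (\<forall>c\<in>{1..n}. \<forall>s\<in>{1..n}. \<exists>!r. r \<in> {1..n} \<and> A r c = s)"

definition array_hypergraph :: "nat \<Rightarrow> (nat \<Rightarrow> nat \<Rightarrow> nat) \<Rightarrow> hyperedge set" where
  "array_hypergraph n A = {(r, c, A r c) | r c. r \<in> {1..n} \<and> c \<in> {1..n}}"

definition latin_squares :: "nat \<Rightarrow> hyperedge set set" where
  "latin_squares n = {array_hypergraph n A | A. latin_array n A}"

definition partial_latin_square :: "nat \<Rightarrow> hyperedge set \<Rightarrow> bool" where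
  "partial_latin_square n H \<longleftrightarrow>
     H \<subseteq> all_triples n \<and> (\<forall>e\<in>complete_tripartite n. \<exists>\<^sub>\<le>\<^sub>1 t. t \<in> H \<and> e \<in> pairs t)"

definition ordered_pls :: "nat \<Rightarrow> nat \<Rightarrow> hyperedge list set" where
  "ordered_pls n m = {ts. partial_latin_square n (set ts) \<and> distinct ts \<and> length ts = m}"

text \<open>Meaningful only when \<open>L\<close> is finite and \<open>m \<le> card L\<close>, so that \<open>pmf_of_set\<close> is applied
  to nonempty finite sets.\<close>

definition random_ordered_subset :: "nat \<Rightarrow> hyperedge set \<Rightarrow> hyperedge list pmf" where
  "random_ordered_subset m L =
     bind_pmf (pmf_of_set {S. S \<subseteq> L \<and> card S = m}) (\<lambda>S. pmf_of_set (permutations_of_set S))"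

definition inherited :: "real \<Rightarrow> nat \<Rightarrow> hyperedge list set \<Rightarrow> hyperedge set set \<Rightarrow> bool" where
  "inherited \<rho> m U T \<longleftrightarrow> (\<forall>L\<in>T. measure_pmf.prob (random_ordered_subset m L) U \<ge> \<rho>)"

definition triangles :: "vertex set set \<Rightarrow> hyperedge set" where
  "triangles G = {t. pairs t \<subseteq> G}"

text \<open>\<open>trp_from m G\<close> is the sequence of triangles removed in \<open>m\<close> steps started from the graph
  with edge set \<open>G\<close>, where \<open>None\<close> is the outcome of a process that runs out of triangles.\<close>

fun trp_from :: "nat \<Rightarrow> vertex set set \<Rightarrow> hyperedge list option pmf" where
  "trp_from 0 G = return_pmf (Some [])"
| "trp_from (Suc m) G =
     (if triangles G = {} then return_pmf None
      else bind_pmf (pmf_of_set (triangles G))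
             (\<lambda>t. map_pmf (map_option (Cons t)) (trp_from m (G - pairs t))))"

definition TRP :: "nat \<Rightarrow> nat \<Rightarrow> hyperedge list option pmf" where
  "TRP n m = trp_from m (complete_tripartite n)"

lemma triangles_complete_tripartite: "triangles (complete_tripartite n) = all_triples n"
proof -
  have "{Row a, Col b} \<in> complete_tripartite n \<longleftrightarrow> a \<in> {1..n} \<and> b \<in> {1..n}"
    "{Row a, Sym b} \<in> complete_tripartite n \<longleftrightarrow> a \<in> {1..n} \<and> b \<in> {1..n}"
    "{Col a, Sym b} \<in> complete_tripartite n \<longleftrightarrow> a \<in> {1..n} \<and> b \<in> {1..n}" for a b
    by (simp_all add: complete_tripartite_def doubleton_eq_iff)
  hence "pairs t \<subseteq> complete_tripartite n \<longleftrightarrow> t \<in> all_triples n" for t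
    by (cases t) (auto simp: all_triples_def)
  thus ?thesis
    by (auto simp: triangles_def)
qed

lemma finite_all_triples: "finite (all_triples n)"
  by (simp add: all_triples_def)

lemma latin_square_subset: "L \<in> latin_squares n \<Longrightarrow> L \<subseteq> all_triples n"
  by (auto simp: latin_squares_def array_hypergraph_def all_triples_def latin_array_def)

lemma finite_latin_square: "L \<in> latin_squares n \<Longrightarrow> finite L"
  using latin_square_subset finite_all_triples by (meson finite_subset)

lemma finite_latin_squares: "finite (latin_squares n)"
  by (rule finite_subset[of _ "Pow (all_triples n)"])
     (auto simp: finite_all_triples dest: latin_square_subset)

lemma card_latin_square:
  assumes "L \<in> latin_squares n"
  shows "card L = n\<^sup>2"
proof -
  obtain A where "L = array_hypergraph n A"
    using assms by (auto simp: latin_squares_def)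
  hence "L = (\<lambda>(r, c). (r, c, A r c)) ` ({1..n} \<times> {1..n})"
    by (auto simp: array_hypergraph_def)
  moreover have "inj_on (\<lambda>(r, c). (r, c, A r c)) ({1..n} \<times> {1..n})"
    by (auto simp: inj_on_def)
  ultimately show ?thesis
    by (simp add: card_image power2_eq_square)
qed

lemma ball_complete_tripartite:
  "(\<forall>e\<in>complete_tripartite n. P e) \<longleftrightarrow>
     (\<forall>a\<in>{1..n}. \<forall>b\<in>{1..n}. P {Row a, Col b} \<and> P {Row a, Sym b} \<and> P {Col a, Sym b})"
  unfolding complete_tripartite_def by blast

lemma mem_pairs_iff:
  "{Row a, Col b} \<in> pairs (r, c, s) \<longleftrightarrow> a = r \<and> b = c"
  "{Row a, Sym b} \<in> pairs (r, c, s) \<longleftrightarrow> a = r \<and> b = s"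
  "{Col a, Sym b} \<in> pairs (r, c, s) \<longleftrightarrow> a = c \<and> b = s"
  by (auto simp: doubleton_eq_iff)

lemma ex1_pairs_iff:
  "(\<exists>!t. t \<in> L \<and> {Row a, Col b} \<in> pairs t) \<longleftrightarrow> (\<exists>!s. (a, b, s) \<in> L)"
  "(\<exists>!t. t \<in> L \<and> {Row a, Sym b} \<in> pairs t) \<longleftrightarrow> (\<exists>!c. (a, c, b) \<in> L)"
  "(\<exists>!t. t \<in> L \<and> {Col a, Sym b} \<in> pairs t) \<longleftrightarrow> (\<exists>!r. (r, a, b) \<in> L)"
  unfolding Ex1_def split_paired_All split_paired_Ex mem_pairs_iff by blast+

lemma latin_squares_iff:
  "L \<in> latin_squares n \<longleftrightarrow>
     L \<subseteq> all_triples n \<and> (\<forall>e\<in>complete_tripartite n. \<exists>!t. t \<in> L \<and> e \<in> pairs t)"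
proof
  assume L: "L \<in> latin_squares n"
  then obtain A where A: "L = array_hypergraph n A" "latin_array n A"
    by (auto simp: latin_squares_def)
  have mem: "(r, c, s) \<in> L \<longleftrightarrow> r \<in> {1..n} \<and> c \<in> {1..n} \<and> s = A r c" for r c s
    by (auto simp: A array_hypergraph_def)
  have "(\<exists>!t. t \<in> L \<and> {Row a, Col b} \<in> pairs t) \<and> (\<exists>!t. t \<in> L \<and> {Row a, Sym b} \<in> pairs t) \<and>
        (\<exists>!t. t \<in> L \<and> {Col a, Sym b} \<in> pairs t)" if ab: "a \<in> {1..n}" "b \<in> {1..n}" for a b
  proof -
    have 1: "(\<lambda>s. (a, b, s) \<in> L) = (\<lambda>s. s = A a b)"
      "(\<lambda>c. (a, c, b) \<in> L) = (\<lambda>c. c \<in> {1..n} \<and> A a c = b)"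
      "(\<lambda>r. (r, a, b) \<in> L) = (\<lambda>r. r \<in> {1..n} \<and> A r a = b)"
      unfolding mem using ab by (simp_all only: simp_thms eq_commute)
    have "\<exists>!c. c \<in> {1..n} \<and> A a c = b" "\<exists>!r. r \<in> {1..n} \<and> A r a = b"
      using A(2) ab unfolding latin_array_def by metis+
    thus ?thesis
      by (simp only: ex1_pairs_iff 1 ex1_eq simp_thms)
  qed
  thus "L \<subseteq> all_triples n \<and> (\<forall>e\<in>complete_tripartite n. \<exists>!t. t \<in> L \<and> e \<in> pairs t)"
    using latin_square_subset[OF L] unfolding ball_complete_tripartite by blast
next
  assume *: "L \<subseteq> all_triples n \<and> (\<forall>e\<in>complete_tripartite n. \<exists>!t. t \<in> L \<and> e \<in> pairs t)"
  hence sub: "\<And>r c s. (r, c, s) \<in> L \<Longrightarrow> r \<in> {1..n} \<and> c \<in> {1..n} \<and> s \<in> {1..n}"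
    by (auto simp: all_triples_def)
  have rc: "\<exists>!s. (r, c, s) \<in> L" if "r \<in> {1..n}" "c \<in> {1..n}" for r c
    using * that by (simp only: ball_complete_tripartite ex1_pairs_iff)
  have rs: "\<exists>!c. (r, c, s) \<in> L" if "r \<in> {1..n}" "s \<in> {1..n}" for r s
    using * that by (simp only: ball_complete_tripartite ex1_pairs_iff)
  have cs: "\<exists>!r. (r, c, s) \<in> L" if "c \<in> {1..n}" "s \<in> {1..n}" for c s
    using * that by (simp only: ball_complete_tripartite ex1_pairs_iff)
  define A where "A r c = (THE s. (r, c, s) \<in> L)" for r c
  have A: "(r, c, s) \<in> L \<longleftrightarrow> A r c = s" if "r \<in> {1..n}" "c \<in> {1..n}" for r c s
    unfolding A_def using rc[OF that] by (metis theI')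
  have "L = array_hypergraph n A"
  proof (intro set_eqI iffI)
    fix t assume "t \<in> L"
    moreover obtain r c s where "t = (r, c, s)"
      by (cases t)
    ultimately show "t \<in> array_hypergraph n A"
      using sub[of r c s] A[of r c s] by (simp add: array_hypergraph_def)
  next
    fix t assume "t \<in> array_hypergraph n A"
    then obtain r c where "t = (r, c, A r c)" "r \<in> {1..n}" "c \<in> {1..n}"
      by (auto simp: array_hypergraph_def)
    thus "t \<in> L"
      using A[of r c "A r c"] by simp
  qed
  moreover have "latin_array n A"
    unfolding latin_array_def
  proof (intro conjI ballI)
    fix r c assume "r \<in> {1..n}" "c \<in> {1..n}"
    thus "A r c \<in> {1..n}" using A[of r c "A r c"] sub[of r c "A r c"] by simp
  next
    fix r s assume *: "r \<in> {1..n}" "s \<in> {1..n}"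
    show "\<exists>!c. c \<in> {1..n} \<and> A r c = s"
    proof -
      have "(\<lambda>c. c \<in> {1..n} \<and> A r c = s) = (\<lambda>c. (r, c, s) \<in> L)"
        using A[OF *(1)] sub by (intro ext) metis
      thus ?thesis
        using rs[OF *] by simp
    qed
  next
    fix c s assume *: "c \<in> {1..n}" "s \<in> {1..n}"
    show "\<exists>!r. r \<in> {1..n} \<and> A r c = s"
    proof -
      have "(\<lambda>r. r \<in> {1..n} \<and> A r c = s) = (\<lambda>r. (r, c, s) \<in> L)"
        using A[OF _ *(1)] sub by (intro ext) metis
      thus ?thesis
        using cs[OF *] by simp
    qed
  qed
  ultimately show "L \<in> latin_squares n"
    unfolding latin_squares_def by blast
qed

lemma latin_squares_nonempty: "latin_squares n \<noteq> {}"
proof -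
  define A where "A r c = (r + c) mod n + 1" for r c :: nat
  have ex1: "\<exists>!c. c \<in> {1..n} \<and> A r c = s" if "s \<in> {1..n}" for r s
  proof -
    have inj: "inj_on (A r) {1..n}"
    proof (rule inj_onI)
      fix x y assume xy: "x \<in> {1..n}" "y \<in> {1..n}" "A r x = A r y"
      have "(r + x) mod n = (r + y) mod n"
        using xy(3) by (simp add: A_def)
      hence "int ((r + x) mod n) = int ((r + y) mod n)"
        by (rule arg_cong)
      hence "(int r + int x) mod int n = (int r + int y) mod int n"
        by (simp only: of_nat_mod of_nat_add)
      hence "int n dvd int x - int y"
        by (simp add: mod_eq_dvd_iff)
      moreover have "\<bar>int x - int y\<bar> < int n"
        using xy by auto
      ultimately show "x = y"
        using zdvd_imp_le[of "int n" "\<bar>int x - int y\<bar>"] by force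
    qed
    moreover have "A r ` {1..n} \<subseteq> {1..n}"
      by (auto simp: A_def Suc_le_eq)
    ultimately have "A r ` {1..n} = {1..n}"
      by (simp add: endo_inj_surj)
    hence "s \<in> A r ` {1..n}"
      using that by simp
    then obtain c where c: "c \<in> {1..n}" "A r c = s"
      by blast
    show ?thesis
    proof (rule ex1I[of _ c])
      show "c \<in> {1..n} \<and> A r c = s"
        using c by simp
      show "c' = c" if "c' \<in> {1..n} \<and> A r c' = s" for c'
        using inj_onD[OF inj, of c' c] c that by simp
    qed
  qed
  have comm: "A r c = A c r" for r c
    by (simp add: A_def add.commute)
  have "latin_array n A"
    unfolding latin_array_def
  proof (intro conjI ballI)
    show "A r c \<in> {1..n}" if "r \<in> {1..n}" for r c
      using that by (simp add: A_def Suc_le_eq)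
    show "\<exists>!c. c \<in> {1..n} \<and> A r c = s" if "s \<in> {1..n}" for r s
      by (rule ex1[OF that])
    show "\<exists>!r. r \<in> {1..n} \<and> A r c = s" if "s \<in> {1..n}" for c s
      using ex1[OF that, of c] by (simp only: comm[of _ c])
  qed
  thus ?thesis
    by (auto simp: latin_squares_def)
qed

end

theory Submission
  imports Defs "HOL-Complex_Analysis.Complex_Analysis"
    "HOL-Computational_Algebra.Fundamental_Theorem_Algebra"
    "HOL-Combinatorics.Permutations"
begin

text \<open>For \<open>L \<in> T\<close> and a random ordered \<open>m\<close>-subset \<open>P\<close> of \<open>L\<close>, the removal process produces \<open>P\<close> with
  probability \<open>\<Prod>i<m. 1 / T\<^sub>i\<close>, where \<open>T\<^sub>i\<close> is the number of triangles left after the first \<open>i\<close> steps.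
  Complete \<open>P\<close> to a Latin square greedily, cell by cell, with the rows and the columns in the orders
  \<open>\<sigma>\<close> and \<open>\<theta>\<close>; this produces \<open>L\<close> with probability \<open>\<Prod> 1 / N\<close> over the empty cells, where \<open>N\<close> is the number of
  symbols available at that moment. These probabilities sum to at most 1 over all \<open>L\<close> containing \<open>P\<close>, so
  \<open>\<Prod>i<m. 1 / T\<^sub>i\<close> is at least the sum over \<open>L\<close> of the average of the combined weight over \<open>\<sigma>\<close> and
  \<open>\<theta>\<close>. By convexity of \<open>exp\<close> it then suffices to bound the conditional expectation of the
  logarithm of the combined weight, given that \<open>P\<close> lies in \<open>U\<close>. As \<open>U\<close> has conditional probability
  at least \<open>\<rho>\<close>, the variance bound for \<open>T\<^sub>i\<close> makes this conditioning cost only \<open>O(n)\<close> altogether.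
  In the mean, \<open>T\<^sub>i\<close> is about \<open>n\<^sup>3 x\<^sup>3\<close> with \<open>x = 1 - i / n\<^sup>2\<close>, and \<open>N\<close> is about \<open>1 + n x\<^sup>2 u v\<close> with \<open>u\<close> and \<open>v\<close> the
  fractions of rows and columns still to come; summing \<open>1 / (n x\<^sup>2 u v)\<close> over all cells gives the main error term
  \<open>n log\<^sup>2 n / (1 - \<alpha>)\<close>. Everything else cancels against the lower bound \<open>(n / e\<^sup>2)\<close> to the power \<open>n\<^sup>2\<close> for the number of
  Latin squares, which follows from a lower bound for permanents (Gurvits' capacity argument).\<close>

section \<open>Perfect matchings in regular bipartite graphs\<close>

text \<open>Nothing is known about how many Latin squares complete a given \<open>P\<close>; Kraft's
  inequality bounds the weighted sum over them without counting them. For a fixed order of the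
  cells, the number of available symbols would depend on \<open>L\<close> in an uncontrolled way.
  The two random orders repair this: every cell is equally often at position \<open>(a, b)\<close>,
  and an open symbol other than the entry of \<open>L\<close> stays available with an explicit
  probability. Hence only the total number of open triples of \<open>P\<close> matters, and its mean
  and variance come from the randomness of \<open>P\<close> alone, for each single \<open>L\<close>;
  no regularity of individual cells is needed. Tangent lines make the exponent linear in the counts,
  so that these moments suffice. The constant 1 in the typical value of \<open>N\<close> is the
  entry of \<open>L\<close> itself. It is negligible except near the end of the completion, where
  \<open>u * v\<close> is small; this is why the loss is a product of two harmonic sums, that is, a
  squared logarithm. The remaining errors are \<open>O(n * ln n)\<close> and are absorbed by
  \<delta>, which therefore decays like \<open>1 / ln n\<close>.\<close>

lemma poly_pderiv_prod_linear:
  fixes r :: "'i \<Rightarrow> 'a::field"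
  assumes "finite I" and "\<And>i. i \<in> I \<Longrightarrow> t \<noteq> r i"
  shows "poly (pderiv (\<Prod>i\<in>I. [:-r i, 1:])) t =
    poly (\<Prod>i\<in>I. [:-r i, 1:]) t * (\<Sum>i\<in>I. 1 / (t - r i))"
  using assms
proof (induction rule: finite_induct)
  case (insert x I)
  define p where "p = (\<Prod>i\<in>I. [:-r i, 1:])"
  define s where "s = (\<Sum>i\<in>I. 1 / (t - r i))"
  define l where "l = [:-r x, 1:]"
  have t: "t - r x \<noteq> 0" using insert.prems by simp
  have l: "poly l t = t - r x" "pderiv l = 1" by (simp_all add: l_def pderiv_pCons)
  have "poly (pderiv p) t = poly p t * s"
    unfolding p_def s_def using insert by blast
  hence "poly (pderiv (l * p)) t = poly p t + (t - r x) * (poly p t * s)"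
    by (simp only: pderiv_mult l poly_add poly_mult) (simp add: algebra_simps)
  also have "\<dots> = poly (l * p) t * (1 / (t - r x) + s)"
    using t by (simp only: l poly_mult) (simp add: field_simps)
  finally have "poly (pderiv (l * p)) t = poly (l * p) t * (1 / (t - r x) + s)" .
  thus ?case using insert.hyps by (simp only: prod.insert sum.insert p_def s_def l_def not_False_eq_True)
qed simp

text \<open>Gauss-Lucas argument: for \<open>r\<close> in the closed left and \<open>t\<close> in
  the open right half plane, \<open>1 / (t - r)\<close> has nonnegative real part, so
  \<open>q' / q + \<epsilon>\<close> has positive real part. The hypothesis on the roots also
  excludes \<open>q = 0\<close>.\<close>

lemma poly_pderiv_plus_nonzero:
  fixes q :: "complex poly"
  assumes roots: "\<And>r. poly q r = 0 \<Longrightarrow> Re r \<le> 0" and "Re t > 0" and "\<epsilon> > 0"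
  shows "poly (pderiv q) t + of_real \<epsilon> * poly q t \<noteq> 0"
proof -
  obtain r where q: "smult (lead_coeff q) (\<Prod>i<degree q. [:-r i, 1:]) = q"
    using complex_poly_decompose' by blast
  define c where "c = lead_coeff q"
  define I where "I = {..<degree q}"
  have q: "q = smult c (\<Prod>i\<in>I. [:-r i, 1:])" using q by (simp add: c_def I_def)
  have r: "Re (r i) \<le> 0" if "i \<in> I" for i
    using that roots by (subst (asm) q) (auto simp: poly_prod I_def)
  have t: "t \<noteq> r i" if "i \<in> I" for i using r[OF that] assms by auto
  have "poly q t \<noteq> 0" using roots[of t] assms by force
  moreover have "poly (pderiv q) t = poly q t * (\<Sum>i\<in>I. 1 / (t - r i))"
  proof -
    have "finite I" by (simp add: I_def)
    thus ?thesis
      by (subst (1 2) q) (simp add: pderiv_smult poly_pderiv_prod_linear[OF _ t])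
  qed
  moreover have "Re ((\<Sum>i\<in>I. 1 / (t - r i)) + of_real \<epsilon>) > 0"
  proof -
    have "Re (1 / (t - r i)) \<ge> 0" if "i \<in> I" for i
      using r[OF that] assms by (simp add: Re_divide)
    hence "(\<Sum>i\<in>I. Re (1 / (t - r i))) \<ge> 0" by (intro sum_nonneg)
    thus ?thesis using assms by simp
  qed
  ultimately show ?thesis
    by (metis (no_types, lifting) distrib_left mult.commute mult_eq_0_iff less_irrefl zero_complex.simps(1))
qed

lemma poly_eq_sum_bounded_degree:
  fixes p :: "'a::comm_semiring_1 poly"
  assumes "degree p \<le> d"
  shows "poly p t = (\<Sum>j\<le>d. coeff p j * t ^ j)"
  unfolding poly_altdef
  by (rule sum.mono_neutral_left) (use assms in \<open>auto simp: coeff_eq_0\<close>)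

lemma poly_pderiv_eq_sum:
  fixes p :: "'a::{comm_semiring_1,semiring_no_zero_divisors} poly"
  assumes "degree p \<le> d"
  shows "poly (pderiv p) t = (\<Sum>j\<le>d. coeff p j * (of_nat j * t ^ (j - 1)))"
proof (cases d)
  case 0
  then obtain c where "p = [:c:]" using assms by (auto elim: degree_eq_zeroE)
  hence "pderiv p = 0" by (simp add: pderiv_pCons)
  thus ?thesis using 0 by simp
next
  case (Suc e)
  have "degree (pderiv p) \<le> e" 
    by (rule degree_le) (use assms Suc in \<open>auto simp: coeff_pderiv coeff_eq_0\<close>)
  hence "poly (pderiv p) t = (\<Sum>j\<le>e. coeff p (Suc j) * (of_nat (Suc j) * t ^ j))"
    by (subst poly_eq_sum_bounded_degree[of _ e]) (simp_all add: coeff_pderiv mult_ac)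
  thus ?thesis unfolding Suc by (simp only: sum.atMost_Suc_shift) simp
qed

lemma uniform_limit_sum:
  fixes f :: "'i \<Rightarrow> 'a \<Rightarrow> 'b \<Rightarrow> 'c::real_normed_vector"
  assumes "finite I" and "\<And>i. i \<in> I \<Longrightarrow> uniform_limit K (f i) (g i) F"
  shows "uniform_limit K (\<lambda>k z. \<Sum>i\<in>I. f i k z) (\<lambda>z. \<Sum>i\<in>I. g i z) F"
  using assms
  by (induction rule: finite_induct) (simp_all add: uniform_limit_add uniform_limit_const)

text \<open>The combination \<open>q' + \<epsilon> q\<close> at the point \<open>\<epsilon>\<close> cannot vanish because the logarithmic derivative of
  \<open>q\<close> has nonnegative real part there; as \<open>\<epsilon>\<close> tends to 0 it converges to the linear
  coefficient, and Hurwitz's theorem applies.\<close>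

lemma linear_coeff_nonzero:
  fixes q :: "complex \<Rightarrow> complex poly"
  assumes S: "open S" "connected S"
    and hol: "\<And>j. (\<lambda>z. coeff (q z) j) holomorphic_on S"
    and deg: "\<And>z. degree (q z) \<le> d"
    and roots: "\<And>z r. z \<in> S \<Longrightarrow> poly (q z) r = 0 \<Longrightarrow> Re r \<le> 0"
    and z: "z1 \<in> S" "coeff (q z1) 1 \<noteq> 0" "z0 \<in> S"
  shows "coeff (q z0) 1 \<noteq> 0"
proof (cases "(\<lambda>z. coeff (q z) 1) constant_on S")
  case True
  thus ?thesis using z by (auto simp: constant_on_def)
next
  case False
  define \<epsilon> where "\<epsilon> k = 1 / real (Suc k)" for k
  have \<epsilon>: "\<epsilon> k > 0" for k by (simp add: \<epsilon>_def)
  \<comment> \<open>\<open>w k j\<close> is the value of "derivative plus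
    \<open>\<epsilon> k\<close> times itself" for the monomial of degree \<open>j\<close> at the
    point \<open>\<epsilon> k\<close>. So \<open>F k\<close> is a combination of at most
    \<open>d + 1\<close> holomorphic coefficients, and the limit can be taken termwise.\<close>
  define w where "w k j = of_nat j * complex_of_real (\<epsilon> k) ^ (j - 1) + of_real (\<epsilon> k) * of_real (\<epsilon> k) ^ j" for k j
  define F where "F k z = (\<Sum>j\<le>d. coeff (q z) j * w k j)" for k z
  have F: "F k z = poly (pderiv (q z)) (of_real (\<epsilon> k)) + of_real (\<epsilon> k) * poly (q z) (of_real (\<epsilon> k))" for k z
    unfolding poly_pderiv_eq_sum[OF deg] poly_eq_sum_bounded_degree[OF deg]
    by (simp add: F_def w_def sum.distrib sum_distrib_left algebra_simps)
  have w: "(\<lambda>k. w k j) \<longlonglongrightarrow> (if j = 1 then 1 else 0)" for j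
  proof -
    have e0: "(\<lambda>k. complex_of_real (\<epsilon> k)) \<longlonglongrightarrow> of_real 0"
      unfolding \<epsilon>_def by (intro tendsto_of_real LIMSEQ_Suc[OF lim_1_over_n])
    have "(\<lambda>k. w k j) \<longlonglongrightarrow> of_nat j * complex_of_real 0 ^ (j - 1) + of_real 0 * of_real 0 ^ j"
      unfolding w_def by (intro tendsto_intros e0)
    also have "of_nat j * complex_of_real 0 ^ (j - 1) + of_real 0 * of_real 0 ^ j = (if j = 1 then 1 else 0)"
      by (cases "j = 0 \<or> j = 1") (auto simp: power_0_left)
    finally show ?thesis .
  qed
  have lim: "(\<Sum>j\<le>d. coeff (q z) j * (if j = 1 then 1 else 0)) = coeff (q z) 1" for z
  proof (cases "d = 0")
    case True
    thus ?thesis using deg[of z] by (simp add: coeff_eq_0)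
  next
    case False
    thus ?thesis by (simp add: if_distrib[of "(*) _"] cong: if_cong)
  qed
  show ?thesis
  proof (rule Hurwitz_no_zeros[OF S, of F "\<lambda>z. coeff (q z) 1"])
    show "F k holomorphic_on S" for k
      unfolding F_def by (intro holomorphic_intros hol)
    show "uniform_limit K F (\<lambda>z. coeff (q z) 1) sequentially" if "compact K" "K \<subseteq> S" for K
    proof -
      have "uniform_limit K (\<lambda>k z. coeff (q z) j * w k j) (\<lambda>z. coeff (q z) j * (if j = 1 then 1 else 0)) sequentially" for j
      proof (rule uniform_lim_mult)
        show "bounded ((\<lambda>z. coeff (q z) j) ` K)"
          by (intro compact_imp_bounded compact_continuous_image that
                holomorphic_on_imp_continuous_on holomorphic_on_subset[OF hol])
        show "uniform_limit K (\<lambda>k z. w k j) (\<lambda>z. if j = 1 then 1 else 0) sequentially"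
          using w[of j] by (auto simp: uniform_limit_iff tendsto_iff)
        show "bounded ((\<lambda>z::complex. if j = 1 then 1 else 0 :: complex) ` K)"
          by (rule finite_imp_bounded) (rule finite_subset[of _ "{0, 1}"], auto)
      qed (rule uniform_limit_const)
      hence "uniform_limit K (\<lambda>k z. \<Sum>j\<le>d. coeff (q z) j * w k j)
          (\<lambda>z. \<Sum>j\<le>d. coeff (q z) j * (if j = 1 then 1 else 0)) sequentially"
        by (intro uniform_limit_sum) auto
      thus ?thesis unfolding F_def[abs_def] lim .
    qed
    show "F k z \<noteq> 0" if "z \<in> S" for k z
      unfolding F using roots[OF that] \<epsilon> by (intro poly_pderiv_plus_nonzero) auto
  qed (use z False hol in auto)
qed

text \<open>A polynomial with nonpositive real roots satisfies \<open>f t \<le> f 0 * exp (t * f' 0 / f 0)\<close>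
  for \<open>t \<ge> 0\<close>; the bound comes from \<open>t = f 0 / f' 0\<close>.\<close>

lemma norm_linear_coeff_ge:
  fixes q :: "complex poly"
  assumes roots: "\<And>r. poly q r = 0 \<Longrightarrow> r \<in> \<real>\<^sub>\<le>\<^sub>0" and "\<kappa> > 0"
    and ge: "\<And>t. t > 0 \<Longrightarrow> norm (poly q (of_real t)) \<ge> \<kappa> * t"
  shows "norm (coeff q 1) \<ge> \<kappa> / exp 1"
proof (cases "poly q 0 = 0")
  \<comment> \<open>Here \<open>q\<close> is \<open>t\<close> times \<open>p\<close>: dividing the
    growth hypothesis by \<open>t\<close> and letting \<open>t\<close> tend to 0 gives \<kappa>,
    even without the loss of \<open>e\<close>.\<close>
  case True
  then obtain p where p: "q = [:0, 1:] * p" by (auto simp: poly_eq_0_iff_dvd elim: dvdE)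
  have "norm (poly p (of_real t)) \<ge> \<kappa>" if "t > 0" for t
    using ge[OF that] that by (simp add: p norm_mult mult.commute)
  moreover have "((\<lambda>t. norm (poly p (of_real t))) \<longlongrightarrow> norm (poly p (of_real 0))) (at_right 0)"
    by (intro tendsto_intros isCont_tendsto_compose[where g="poly p"]) auto
  ultimately have "\<kappa> \<le> norm (poly p (of_real 0))"
    by (intro tendsto_lowerbound[where F="at_right (0::real)"])
      (auto simp: eventually_at_right_field intro: exI[of _ 1])
  also have "poly p (of_real 0) = coeff q 1" by (simp add: p poly_0_coeff_0)
  finally have "\<kappa> \<le> norm (coeff q 1)" .
  moreover have "\<kappa> / exp 1 \<le> \<kappa>" using \<open>\<kappa> > 0\<close> by (simp add: field_simps)
  ultimately show ?thesis by linarith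
next
  case False
  obtain r where q: "smult (lead_coeff q) (\<Prod>i<degree q. [:-r i, 1:]) = q"
    using complex_poly_decompose' by blast
  define c where "c = lead_coeff q"
  define I where "I = {..<degree q}"
  have q: "q = smult c (\<Prod>i\<in>I. [:-r i, 1:])" using q by (simp add: c_def I_def)
  have r0: "r i \<noteq> 0" if "i \<in> I" for i
    using that False by (subst (asm) q) (auto simp: poly_prod I_def)
  have r: "r i \<in> \<real>\<^sub>\<le>\<^sub>0" if "i \<in> I" for i
    using that roots by (subst (asm) q) (auto simp: poly_prod I_def)
  have "\<exists>s. \<forall>i\<in>I. s i > 0 \<and> r i = - of_real (s i)"
    by (rule bchoice) (metis r r0 nonpos_Reals_cases neg_0_equal_iff_equal 
       neg_less_0_iff_less of_real_0 of_real_minus add.inverse_inverse order_le_imp_less_or_eq)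
  then obtain s where s: "\<And>i. i \<in> I \<Longrightarrow> s i > 0" "\<And>i. i \<in> I \<Longrightarrow> r i = - of_real (s i)" by blast
  \<comment> \<open>The logarithmic derivative \<open>q' / q\<close> at 0.\<close>
  define S where "S = (\<Sum>i\<in>I. 1 / s i)"
  have "S \<ge> 0" unfolding S_def by (intro sum_nonneg) (use s in \<open>simp add: less_imp_le\<close>)
  define f0 where "f0 = norm (poly q 0)"
  have f0: "f0 > 0" using False by (simp add: f0_def)
  have f0': "f0 = norm c * (\<Prod>i\<in>I. s i)"
    unfolding f0_def by (subst q) (simp add: poly_prod norm_mult prod_norm s less_imp_le flip: prod_norm)
  have up: "norm (poly q (of_real t)) \<le> f0 * exp (t * S)" if "t \<ge> 0" for t
  proof -
    have "norm (poly q (of_real t)) = norm c * (\<Prod>i\<in>I. s i + t)"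
      by (subst q) (use that s in \<open>auto simp: poly_prod norm_mult add_nonneg_nonneg less_imp_le
        simp flip: prod_norm of_real_add intro!: prod.cong\<close>)
    also have "(\<Prod>i\<in>I. s i + t) = (\<Prod>i\<in>I. s i) * (\<Prod>i\<in>I. 1 + t / s i)"
    proof -
      have "s i + t = s i * (1 + t / s i)" if "i \<in> I" for i
        using s(1)[OF that] by (simp add: field_simps)
      thus ?thesis by (simp add: prod.distrib)
    qed
    also have "norm c * \<dots> = f0 * (\<Prod>i\<in>I. 1 + t / s i)" by (simp add: f0')
    also have "(\<Prod>i\<in>I. 1 + t / s i) \<le> (\<Prod>i\<in>I. exp (t / s i))"
      by (intro prod_mono) (use s that in \<open>auto simp: less_imp_le add_nonneg_nonneg\<close>)
    also have "\<dots> = exp (t * S)" by (simp add: exp_sum I_def S_def sum_distrib_left)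
    finally show ?thesis using f0 by (simp add: mult_left_mono)
  qed
  have S: "norm (coeff q 1) = f0 * S"
  proof -
    have "coeff q 1 = poly (pderiv q) 0" by (simp add: poly_0_coeff_0 coeff_pderiv)
    also have "\<dots> = poly q 0 * (\<Sum>i\<in>I. 1 / (0 - r i))"
    proof -
      have "finite I" by (simp add: I_def)
      moreover have "0 \<noteq> r i" if "i \<in> I" for i using r0[OF that] by simp
      ultimately show ?thesis
        by (subst (1 2) q) (simp add: pderiv_smult poly_pderiv_prod_linear)
    qed
    also have "(\<Sum>i\<in>I. 1 / (0 - r i)) = of_real S" by (simp add: S_def s)
    finally show ?thesis using \<open>S \<ge> 0\<close> by (simp add: f0_def norm_mult)
  qed
  show ?thesis
  proof (cases "S = 0")
    case True
    \<comment> \<open>Without roots \<open>q\<close> is constant, and this value of \<open>t\<close>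
      contradicts the linear growth.\<close>
    have "norm (poly q (of_real (2 * f0 / \<kappa>))) \<le> f0" using up[of "2 * f0 / \<kappa>"] f0 \<open>\<kappa> > 0\<close> True by simp
    moreover have "norm (poly q (of_real (2 * f0 / \<kappa>))) \<ge> 2 * f0"
      using ge[of "2 * f0 / \<kappa>"] f0 \<open>\<kappa> > 0\<close> by simp
    ultimately show ?thesis using f0 by linarith
  next
    case False
    hence "S > 0" using \<open>S \<ge> 0\<close> by simp
    hence "\<kappa> * (1 / S) \<le> f0 * exp 1"
      using up[of "1 / S"] ge[of "1 / S"] by simp
    thus ?thesis using \<open>S > 0\<close> by (simp add: S[simplified] field_simps)
  qed
qed

section \<open>Coefficients of a product of linear forms, and Gurvits' capacity bound\<close>

definition choice_fns :: "'r set \<Rightarrow> ('r \<Rightarrow> nat set) \<Rightarrow> nat \<Rightarrow> nat \<Rightarrow> ('r \<Rightarrow> nat) set" where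
  "choice_fns R N n l = {\<sigma> \<in> Pi\<^sub>E R N. \<forall>j\<in>{l<..n}. card {i\<in>R. \<sigma> i = j} = 1}"

text \<open>The coefficient of \<open>x\<^sub>l\<^sub>+\<^sub>1 \<cdots> x\<^sub>n\<close> in the product over \<open>i \<in> R\<close> of the linear forms
  \<open>\<Sum>j\<in>N i. x\<^sub>j\<close>, as a polynomial in \<open>x\<^sub>1, \<dots>, x\<^sub>l\<close>. For \<open>l = 0\<close> it is the permanent.\<close>

definition choice_poly ::
    "'r set \<Rightarrow> ('r \<Rightarrow> nat set) \<Rightarrow> nat \<Rightarrow> nat \<Rightarrow> (nat \<Rightarrow> 'a::comm_semiring_1) \<Rightarrow> 'a" where
  "choice_poly R N n l x =
     (\<Sum>\<sigma>\<in>choice_fns R N n l. \<Prod>i\<in>R. if \<sigma> i \<le> l then x (\<sigma> i) else 1)"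

text \<open>\<open>choice_poly\<close> for \<open>Suc l\<close> with the variable of index
  \<open>Suc l\<close> as the indeterminate. Passing from \<open>Suc l\<close> to \<open>l\<close>
  is then the extraction of the linear coefficient, since the index \<open>Suc l\<close> has to be
  used exactly once.\<close>

definition choice_upoly ::
    "'r set \<Rightarrow> ('r \<Rightarrow> nat set) \<Rightarrow> nat \<Rightarrow> nat \<Rightarrow> (nat \<Rightarrow> 'a::comm_semiring_1) \<Rightarrow> 'a poly" where
  "choice_upoly R N n l x =
     (\<Sum>\<sigma>\<in>choice_fns R N n (Suc l).
        monom (\<Prod>i\<in>R. if \<sigma> i \<le> l then x (\<sigma> i) else 1) (card {i\<in>R. \<sigma> i = Suc l}))"

context
  fixes R :: "'r set" and N :: "'r \<Rightarrow> nat set" and n :: nat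
  assumes finR: "finite R" and cardR: "card R = n" and N: "\<And>i. i \<in> R \<Longrightarrow> N i \<subseteq> {1..n}"
begin

lemma finite_choice_fns: "finite (choice_fns R N n l)"
proof -
  have "finite (Pi\<^sub>E R N)"
    by (intro finite_PiE finR) (use N finite_subset in blast)
  thus ?thesis by (simp add: choice_fns_def)
qed

lemma poly_choice_upoly:
  fixes x :: "nat \<Rightarrow> 'a::comm_semiring_1"
  shows "poly (choice_upoly R N n l x) t = choice_poly R N n (Suc l) (x(Suc l := t))"
proof -
  have "(\<Prod>i\<in>R. if \<sigma> i \<le> l then x (\<sigma> i) else 1) * t ^ card {i\<in>R. \<sigma> i = Suc l} =
      (\<Prod>i\<in>R. if \<sigma> i \<le> Suc l then (x(Suc l := t)) (\<sigma> i) else 1)" for \<sigma>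
  proof -
    have "t ^ card {i\<in>R. \<sigma> i = Suc l} = (\<Prod>i\<in>R. if \<sigma> i = Suc l then t else 1)"
      using finR by (simp add: prod.If_cases Int_def)
    thus ?thesis by (simp only: prod.distrib[symmetric]) (intro prod.cong; auto)
  qed
  thus ?thesis
    by (simp add: choice_upoly_def choice_poly_def poly_sum poly_monom)
qed

lemma coeff_choice_upoly:
  "coeff (choice_upoly R N n l x) j = (\<Sum>\<sigma>\<in>choice_fns R N n (Suc l).
     if card {i\<in>R. \<sigma> i = Suc l} = j then \<Prod>i\<in>R. if \<sigma> i \<le> l then x (\<sigma> i) else 1 else 0)"
  by (simp add: choice_upoly_def coeff_sum)

lemma linear_coeff_choice_upoly:
  assumes "l < n"
  shows "coeff (choice_upoly R N n l x) 1 = choice_poly R N n l x"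
proof -
  have "{l<..n} = insert (Suc l) {Suc l<..n}" using assms by auto
  hence eq: "choice_fns R N n l = {\<sigma> \<in> choice_fns R N n (Suc l). card {i\<in>R. \<sigma> i = Suc l} = 1}"
    unfolding choice_fns_def by auto
  show ?thesis unfolding coeff_choice_upoly choice_poly_def eq
    by (rule sum.inter_filter[symmetric]) (rule finite_choice_fns)
qed

lemma degree_choice_upoly: "degree (choice_upoly R N n l x) \<le> n"
proof (rule degree_le, intro allI impI)
  fix j assume "n < j"
  moreover have "card {i\<in>R. \<sigma> i = Suc l} \<le> n" for \<sigma> :: "'r \<Rightarrow> nat"
    unfolding cardR[symmetric] by (rule card_mono) (use finR in auto)
  ultimately have "card {i\<in>R. \<sigma> i = Suc l} \<noteq> j" for \<sigma> :: "'r \<Rightarrow> nat"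
    by (meson leD)
  thus "coeff (choice_upoly R N n l x) j = 0" unfolding coeff_choice_upoly by simp
qed

text \<open>Exactly \<open>n - l\<close> of the \<open>n\<close> factors take one of the variables
  with index above \<open>l\<close>, which are set to 1; the other \<open>l\<close> factors carry
  the degree.\<close>

lemma choice_poly_homogeneous:
  assumes "l \<le> n"
  shows "choice_poly R N n l (\<lambda>j. c * x j) = c ^ l * choice_poly R N n l x"
proof -
  have "(\<Prod>i\<in>R. if \<sigma> i \<le> l then c * x (\<sigma> i) else 1) =
      c ^ l * (\<Prod>i\<in>R. if \<sigma> i \<le> l then x (\<sigma> i) else 1)" if \<sigma>: "\<sigma> \<in> choice_fns R N n l" for \<sigma>
  proof -
    have "{i\<in>R. \<not> \<sigma> i \<le> l} = (\<Union>j\<in>{l<..n}. {i\<in>R. \<sigma> i = j})"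
      using \<sigma> N by (fastforce simp: choice_fns_def PiE_iff)
    also have "card \<dots> = (\<Sum>j\<in>{l<..n}. card {i\<in>R. \<sigma> i = j})"
      by (intro card_UN_disjoint) (use finR in auto)
    also have "\<dots> = n - l" using \<sigma> by (simp add: choice_fns_def)
    finally have "card {i\<in>R. \<not> \<sigma> i \<le> l} = n - l" .
    moreover have "card R = card {i\<in>R. \<sigma> i \<le> l} + card {i\<in>R. \<not> \<sigma> i \<le> l}"
      by (subst card_Un_disjoint[symmetric]) (use finR in \<open>auto intro: arg_cong[where f=card]\<close>)
    ultimately have "card {i\<in>R. \<sigma> i \<le> l} = l" using cardR assms by simp
    hence "c ^ l = (\<Prod>i\<in>R. if \<sigma> i \<le> l then c else 1)"
      using finR by (simp add: prod.If_cases Int_def)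
    thus ?thesis by (simp only: prod.distrib[symmetric]) (intro prod.cong; auto)
  qed
  thus ?thesis by (simp add: choice_poly_def sum_distrib_left)
qed

lemma choice_poly_of_real:
  "choice_poly R N n l (\<lambda>j. of_real (y j)) = (of_real (choice_poly R N n l y) :: complex)"
  unfolding choice_poly_def of_real_sum of_real_prod by (intro sum.cong prod.cong) auto

lemma choice_poly_full: "choice_poly R N n n x = (\<Prod>i\<in>R. \<Sum>j\<in>N i. x j)"
proof -
  have fin: "finite (N i)" if "i \<in> R" for i using N[OF that] finite_subset by blast
  have "(\<Prod>i\<in>R. \<Sum>j\<in>N i. x j) = (\<Sum>\<sigma>\<in>Pi\<^sub>E R N. \<Prod>i\<in>R. x (\<sigma> i))"
    by (rule prod_sum_PiE[OF finR fin])
  also have "\<dots> = choice_poly R N n n x"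
    unfolding choice_poly_def
  proof (rule sum.cong)
    show "Pi\<^sub>E R N = choice_fns R N n n" by (simp add: choice_fns_def)
    fix \<sigma> assume \<sigma>: "\<sigma> \<in> choice_fns R N n n"
    have "\<sigma> i \<le> n" if "i \<in> R" for i
      using \<sigma> N[OF that] that by (auto simp: choice_fns_def PiE_iff)
    thus "(\<Prod>i\<in>R. x (\<sigma> i)) = (\<Prod>i\<in>R. if \<sigma> i \<le> n then x (\<sigma> i) else 1)"
      by (intro prod.cong) auto
  qed
  finally show ?thesis ..
qed

lemma choice_poly_cong:
  assumes "\<And>j. j \<le> l \<Longrightarrow> x j = y j"
  shows "choice_poly R N n l x = choice_poly R N n l y"
  unfolding choice_poly_def using assms by (intro sum.cong prod.cong) auto

lemma choice_poly_nonneg: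
  fixes y :: "nat \<Rightarrow> real"
  assumes "\<And>j. y j \<ge> 0"
  shows "choice_poly R N n l y \<ge> 0"
  unfolding choice_poly_def using assms by (intro sum_nonneg prod_nonneg) auto

text \<open>Half-plane stability as in the theory of stable polynomials, with the right half plane
  in place of the upper one.\<close>

definition choice_stable :: "nat \<Rightarrow> bool" where
  "choice_stable l \<longleftrightarrow> (\<forall>x :: nat \<Rightarrow> complex. (\<forall>j. Re (x j) > 0) \<longrightarrow> choice_poly R N n l x \<noteq> 0)"

text \<open>The point \<open>x\<close> is joined to the all-ones point by the complex line
  \<open>1 + z * (x - 1)\<close>. Where all variables stay in the right half plane, stability for
  \<open>Suc l\<close> confines the roots of \<open>q z\<close> to the left half plane, and
  \<open>linear_coeff_nonzero\<close> carries nonvanishing from \<open>z = 0\<close> to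
  \<open>z = 1\<close>.\<close>

lemma choice_stable_step:
  assumes "l < n" and st: "choice_stable (Suc l)" and pos: "choice_poly R N n l (\<lambda>j. 1::real) > 0"
  shows "choice_stable l"
  unfolding choice_stable_def
proof (intro allI impI)
  fix x :: "nat \<Rightarrow> complex"
  assume x: "\<forall>j. Re (x j) > 0"
  \<comment> \<open>Only coordinates up to \<open>n\<close> are moved, so that \<open>S\<close> is a
    finite intersection and hence open.\<close>
  define p where "p z j = (if j \<le> n then 1 + z * (x j - 1) else 1)" for z j
  define S where "S = (\<Inter>j\<in>{..n}. {z. Re (1 + z * (x j - 1)) > 0})"
  define q where "q z = choice_upoly R N n l (p z)" for z
  have p: "Re (p z j) > 0" if "z \<in> S" for z j
    using that by (auto simp: S_def p_def)
  have "coeff (q 1) 1 \<noteq> 0"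
  proof (rule linear_coeff_nonzero[of S q n 0])
    show "open S" unfolding S_def by (intro open_INT ballI open_Collect_less continuous_intros) auto
    have "convex S" unfolding S_def
    proof (intro convex_INT)
      fix j
      have "{z. Re (1 + z * (x j - 1)) > 0} = (\<lambda>z. z * (x j - 1)) -` {z. Re z > -1}" by auto
      also have "convex \<dots>"
        by (intro convex_linear_vimage convex_halfspace_Re_gt bounded_linear.linear bounded_linear_mult_left)
      finally show "convex {z. Re (1 + z * (x j - 1)) > 0}" .
    qed
    thus "connected S" by (rule convex_connected)
    show "(\<lambda>z. coeff (q z) j) holomorphic_on S" for j
      unfolding q_def coeff_choice_upoly
    proof (intro holomorphic_intros)
      fix \<sigma>
      have "(\<lambda>z. if \<sigma> i \<le> l then p z (\<sigma> i) else 1) holomorphic_on S" for i :: 'r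
        unfolding p_def by (cases "\<sigma> i \<le> l"; cases "\<sigma> i \<le> n") (auto intro!: holomorphic_intros)
      thus "(\<lambda>z. if card {i\<in>R. \<sigma> i = Suc l} = j then \<Prod>i\<in>R. if \<sigma> i \<le> l then p z (\<sigma> i) else 1 else 0)
          holomorphic_on S"
        by (cases "card {i\<in>R. \<sigma> i = Suc l} = j") (auto intro!: holomorphic_intros)
    qed
    show "degree (q z) \<le> n" for z unfolding q_def by (rule degree_choice_upoly)
    show "Re r \<le> 0" if "z \<in> S" "poly (q z) r = 0" for z r
    proof (rule ccontr)
      assume "\<not> Re r \<le> 0"
      hence "\<forall>j. Re (((p z)(Suc l := r)) j) > 0" using p that by simp
      thus False using st that by (auto simp: choice_stable_def q_def poly_choice_upoly)
    qed
    show "0 \<in> S" "1 \<in> S" using x by (auto simp: S_def)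
    have "choice_poly R N n l (p 0) = of_real (choice_poly R N n l (\<lambda>j. 1::real))"
      unfolding choice_poly_of_real[symmetric] by (rule choice_poly_cong) (simp add: p_def)
    thus "coeff (q 0) 1 \<noteq> 0"
      unfolding q_def linear_coeff_choice_upoly[OF \<open>l < n\<close>] using pos by simp
  qed
  moreover have "choice_poly R N n l (p 1) = choice_poly R N n l x"
    by (rule choice_poly_cong) (use \<open>l < n\<close> in \<open>simp add: p_def\<close>)
  ultimately show "choice_poly R N n l x \<noteq> 0"
    unfolding q_def linear_coeff_choice_upoly[OF \<open>l < n\<close>] by simp
qed

text \<open>A root \<open>r\<close> outside the nonpositive axis would contradict stability after multiplying all
  variables by \<open>1 / csqrt r\<close>, which moves the positive variables and \<open>r\<close> to the right half plane.\<close>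

lemma choice_poly_capacity_step:
  fixes y :: "nat \<Rightarrow> real"
  assumes "l < n" and st: "choice_stable (Suc l)" and y: "\<And>j. y j > 0" and "\<kappa> > 0"
    and ge: "\<And>t. t > 0 \<Longrightarrow> choice_poly R N n (Suc l) (y(Suc l := t)) \<ge> \<kappa> * t"
  shows "choice_poly R N n l y \<ge> \<kappa> / exp 1"
proof -
  define q where "q = choice_upoly R N n l (\<lambda>j. complex_of_real (y j))"
  have q: "poly q t = choice_poly R N n (Suc l) ((\<lambda>j. of_real (y j))(Suc l := t))" for t
    by (simp add: q_def poly_choice_upoly)
  have "norm (coeff q 1) \<ge> \<kappa> / exp 1"
  proof (rule norm_linear_coeff_ge)
    show "r \<in> \<real>\<^sub>\<le>\<^sub>0" if r: "poly q r = 0" for r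
    proof (rule ccontr)
      assume neg: "r \<notin> \<real>\<^sub>\<le>\<^sub>0"
      define w where "w = csqrt r"
      have ww: "w * w = r" by (simp add: w_def flip: power2_eq_square)
      have "Re w \<noteq> 0"
      proof
        assume "Re w = 0"
        hence "r = of_real (- (Im w * Im w))" by (simp add: ww[symmetric] complex_eq_iff)
        moreover have "- (Im w * Im w) \<le> 0" by simp
        ultimately show False using neg by (metis nonpos_Reals_of_real_iff)
      qed
      hence w: "Re w > 0" using csqrt_principal[of r] by (auto simp: w_def)
      define x where "x j = 1 / w * ((\<lambda>j. of_real (y j))(Suc l := r)) j" for j
      have "1 / w * r = w" using w by (auto simp: ww[symmetric])
      hence "Re (x j) > 0" for j
        using w y[of j] by (cases "j = Suc l") (auto simp: x_def Re_divide intro!: divide_pos_pos add_pos_nonneg)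
      hence "choice_poly R N n (Suc l) x \<noteq> 0" using st by (simp add: choice_stable_def)
      moreover have "choice_poly R N n (Suc l) x = 0"
        unfolding x_def using r \<open>l < n\<close> by (subst choice_poly_homogeneous) (simp_all add: q)
      ultimately show False by simp
    qed
    fix t :: real assume t: "t > 0"
    have "poly q (of_real t) = of_real (choice_poly R N n (Suc l) (y(Suc l := t)))"
      unfolding q choice_poly_of_real[symmetric] by (rule choice_poly_cong) simp
    thus "norm (poly q (of_real t)) \<ge> \<kappa> * t" using ge[OF t] by simp
  qed fact
  also have "coeff q 1 = of_real (choice_poly R N n l y)"
    by (simp only: q_def linear_coeff_choice_upoly[OF \<open>l < n\<close>] choice_poly_of_real)
  also have "norm \<dots> = choice_poly R N n l y"
    using choice_poly_nonneg[of y l] y by (simp add: less_imp_le)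
  finally show ?thesis .
qed

lemma bij_betw_iff_card_fibres:
  fixes f :: "'r \<Rightarrow> nat"
  assumes "f ` R \<subseteq> {1..n}"
  shows "bij_betw f R {1..n} \<longleftrightarrow> (\<forall>j\<in>{0<..n}. card {i\<in>R. f i = j} = 1)"
proof
  assume bij: "bij_betw f R {1..n}"
  show "\<forall>j\<in>{0<..n}. card {i\<in>R. f i = j} = 1"
  proof
    fix j assume "j \<in> {0<..n}"
    hence "j \<in> f ` R" using bij by (auto simp: bij_betw_def)
    then obtain i where i: "i \<in> R" "f i = j" by blast
    hence "{i\<in>R. f i = j} = {i}" using bij by (auto simp: bij_betw_def inj_on_def)
    thus "card {i\<in>R. f i = j} = 1" by simp
  qed
next
  assume *: "\<forall>j\<in>{0<..n}. card {i\<in>R. f i = j} = 1"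
  have "{1..n} \<subseteq> f ` R"
  proof
    fix j assume "j \<in> {1..n}"
    hence "card {i\<in>R. f i = j} \<noteq> 0" using * by auto
    hence "{i\<in>R. f i = j} \<noteq> {}" by (metis card.empty)
    thus "j \<in> f ` R" by auto
  qed
  hence im: "f ` R = {1..n}" using assms by simp
  hence "inj_on f R" by (intro eq_card_imp_inj_on finR) (simp add: cardR)
  thus "bij_betw f R {1..n}" using im by (simp add: bij_betw_def)
qed

text \<open>AM-GM in each row, combined with the column degrees, bounds the full product below by
  \<open>k^n\<close> times the product of the variables (capacity at least \<open>k^n\<close>). Each
  of the \<open>n\<close> passages to a linear coefficient then loses a factor
  \<open>e\<close>.\<close>

lemma card_perfect_matchings_ge:
  assumes rowdeg: "\<And>i. i \<in> R \<Longrightarrow> card (N i) = k"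
    and coldeg: "\<And>j. j \<in> {1..n} \<Longrightarrow> card {i\<in>R. j \<in> N i} = k" and "k > 0"
  shows "(real k / exp 1) ^ n \<le> real (card {\<sigma> \<in> Pi\<^sub>E R N. bij_betw \<sigma> R {1..n}})"
proof -
  have fin: "finite (N i)" if "i \<in> R" for i using N[OF that] finite_subset by blast
  have ne: "N i \<noteq> {}" if "i \<in> R" for i using rowdeg[OF that] \<open>k > 0\<close> by auto
  have full: "real k ^ n * (\<Prod>j=1..n. y j) \<le> choice_poly R N n n y"
    if y: "\<And>j. y j > 0" for y :: "nat \<Rightarrow> real"
  proof -
    have amgm: "real k ^ k * (\<Prod>j\<in>N i. y j) \<le> (\<Sum>j\<in>N i. y j) ^ k" if i: "i \<in> R" for i
    proof -
      have "(\<Prod>j\<in>N i. y j) powr (1 / k) \<le> (\<Sum>j\<in>N i. y j) / k"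
        using arith_geom_mean[OF fin[OF i] ne[OF i], of y] y rowdeg[OF i]
        by (simp add: less_imp_le sum_divide_distrib)
      hence "((\<Prod>j\<in>N i. y j) powr (1 / k)) ^ k \<le> ((\<Sum>j\<in>N i. y j) / k) ^ k"
        by (intro power_mono) auto
      also have "((\<Prod>j\<in>N i. y j) powr (1 / k)) ^ k = (\<Prod>j\<in>N i. y j)"
        using y \<open>k > 0\<close> by (simp add: powr_powr prod_pos prod_nonneg less_imp_le flip: powr_realpow')
      finally show ?thesis using \<open>k > 0\<close> by (simp add: power_divide field_simps)
    qed
    \<comment> \<open>In the \<open>k\<close>-th power of the claim, each \<open>y j\<close> can be
      distributed over the \<open>k\<close> rows adjacent to column \<open>j\<close>.\<close>
    have "(real k ^ n * (\<Prod>j=1..n. y j)) ^ k = (\<Prod>i\<in>R. real k ^ k) * (\<Prod>j=1..n. \<Prod>i\<in>{i\<in>R. j \<in> N i}. y j)"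
    proof -
      have "(\<Prod>j=1..n. \<Prod>i\<in>{i\<in>R. j \<in> N i}. y j) = (\<Prod>j=1..n. y j) ^ k"
        unfolding prod_power_distrib by (rule prod.cong) (simp_all add: coldeg)
      moreover have "(\<Prod>i\<in>R. real k ^ k) = (real k ^ n) ^ k"
        by (simp add: cardR mult.commute flip: power_mult)
      ultimately show ?thesis by (simp add: power_mult_distrib)
    qed
    also have "(\<Prod>j=1..n. \<Prod>i\<in>{i\<in>R. j \<in> N i}. y j) = (\<Prod>i\<in>R. \<Prod>j\<in>{j\<in>{1..n}. j \<in> N i}. y j)"
      by (rule prod.swap_restrict) (use finR in auto)
    also have "\<dots> = (\<Prod>i\<in>R. \<Prod>j\<in>N i. y j)"
      by (intro prod.cong) (use N in blast)+
    also have "(\<Prod>i\<in>R. real k ^ k) * \<dots> = (\<Prod>i\<in>R. real k ^ k * (\<Prod>j\<in>N i. y j))"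
      by (simp add: prod.distrib)
    also have "\<dots> \<le> (\<Prod>i\<in>R. (\<Sum>j\<in>N i. y j) ^ k)"
      by (intro prod_mono conjI amgm mult_nonneg_nonneg prod_nonneg) (use y in \<open>auto simp: less_imp_le\<close>)
    also have "\<dots> = (choice_poly R N n n y) ^ k"
      by (simp add: choice_poly_full prod_power_distrib)
    finally have "(real k ^ n * (\<Prod>j=1..n. y j)) ^ k \<le> (choice_poly R N n n y) ^ k" .
    moreover have "choice_poly R N n n y \<ge> 0"
      by (rule choice_poly_nonneg) (use y in \<open>simp add: less_imp_le\<close>)
    moreover have "(\<Prod>j=1..n. y j) \<ge> 0" using y by (intro prod_nonneg) (simp add: less_imp_le)
    ultimately show ?thesis using \<open>k > 0\<close> by (subst (asm) power_mono_iff) auto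
  qed
  \<comment> \<open>Stability and the lower bound must go down together: the bound for
    \<open>l\<close> uses stability for \<open>Suc l\<close>, and stability for \<open>l\<close>
    uses positivity at the all-ones point, which is an instance of the bound for
    \<open>l\<close>.\<close>
  have main: "choice_stable l \<and> (\<forall>y :: nat \<Rightarrow> real. (\<forall>j. y j > 0) \<longrightarrow>
      real k ^ n / exp 1 ^ (n - l) * (\<Prod>j=1..l. y j) \<le> choice_poly R N n l y)" if "l \<le> n" for l
    using that
  proof (induction l rule: inc_induct)
    case base
    have "choice_poly R N n n x \<noteq> 0" if x: "\<forall>j. Re (x j) > 0" for x :: "nat \<Rightarrow> complex"
    proof -
      have "(\<Sum>j\<in>N i. x j) \<noteq> 0" if "i \<in> R" for i
      proof
        assume "(\<Sum>j\<in>N i. x j) = 0"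
        hence "(\<Sum>j\<in>N i. Re (x j)) = 0" by (metis Re_sum zero_complex.simps(1))
        moreover have "(\<Sum>j\<in>N i. Re (x j)) > 0" using x fin[OF that] ne[OF that] by (intro sum_pos) auto
        ultimately show False by simp
      qed
      thus ?thesis using finR by (simp add: choice_poly_full)
    qed
    thus ?case using full by (simp add: choice_stable_def)
  next
    case (step l)
    have lower: "real k ^ n / exp 1 ^ (n - l) * (\<Prod>j=1..l. y j) \<le> choice_poly R N n l y"
      if y: "\<forall>j. y j > 0" for y :: "nat \<Rightarrow> real"
    proof -
      define \<kappa> where "\<kappa> = real k ^ n / exp 1 ^ (n - Suc l) * (\<Prod>j=1..l. y j)"
      have "\<kappa> > 0" using y \<open>k > 0\<close> by (simp add: \<kappa>_def prod_pos)
      have "choice_poly R N n l y \<ge> \<kappa> / exp 1"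
      proof (rule choice_poly_capacity_step)
        show "choice_poly R N n (Suc l) (y(Suc l := t)) \<ge> \<kappa> * t" if "t > 0" for t
        proof -
          have "(\<Prod>j=1..l. (y(Suc l := t)) j) = (\<Prod>j=1..l. y j)" by (rule prod.cong) auto
          hence "(\<Prod>j=1..Suc l. (y(Suc l := t)) j) = (\<Prod>j=1..l. y j) * t" by simp
          moreover have "\<forall>j. (y(Suc l := t)) j > 0" using y that by simp
          hence "real k ^ n / exp 1 ^ (n - Suc l) * (\<Prod>j=1..Suc l. (y(Suc l := t)) j)
              \<le> choice_poly R N n (Suc l) (y(Suc l := t))"
            using step.IH by blast
          ultimately show ?thesis by (simp only: \<kappa>_def mult.assoc)
        qed
      qed (use step y \<open>\<kappa> > 0\<close> in auto)
      also have "\<kappa> / exp 1 = real k ^ n / exp 1 ^ (n - l) * (\<Prod>j=1..l. y j)"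
      proof -
        have "n - l = Suc (n - Suc l)" using step by simp
        thus ?thesis by (simp add: \<kappa>_def)
      qed
      finally show ?thesis .
    qed
    have "choice_stable l"
    proof (rule choice_stable_step)
      have "0 < real k ^ n / exp 1 ^ (n - l) * (\<Prod>j=1..l. 1::real)" using \<open>k > 0\<close> by simp
      also have "\<dots> \<le> choice_poly R N n l (\<lambda>j. 1)" using lower[of "\<lambda>_. 1"] by simp
      finally show "choice_poly R N n l (\<lambda>j. 1::real) > 0" .
    qed (use step in auto)
    thus ?case using lower by blast
  qed
  have "(real k / exp 1) ^ n = real k ^ n / exp 1 ^ (n - 0) * (\<Prod>j=1..0::nat. 1 :: real)" by (simp add: power_divide)
  also have "\<dots> \<le> choice_poly R N n 0 (\<lambda>_. 1 :: real)" using main[of 0] by (simp only: le0 simp_thms zero_less_one)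
  also have "\<dots> = real (card (choice_fns R N n 0))" by (simp add: choice_poly_def)
  also have "choice_fns R N n 0 = {\<sigma> \<in> Pi\<^sub>E R N. bij_betw \<sigma> R {1..n}}"
  proof -
    have "\<sigma> ` R \<subseteq> {1..n}" if "\<sigma> \<in> Pi\<^sub>E R N" for \<sigma> using that N by (fastforce simp: PiE_iff)
    thus ?thesis unfolding choice_fns_def by (intro Collect_cong conj_cong) (simp_all only: bij_betw_iff_card_fibres)
  qed
  finally show ?thesis .
qed

end

section \<open>The number of Latin squares\<close>

definition latin_rectangles :: "nat \<Rightarrow> nat \<Rightarrow> (nat \<Rightarrow> nat \<Rightarrow> nat) set" where
  "latin_rectangles n k = {A \<in> {1..k} \<rightarrow>\<^sub>E ({1..n} \<rightarrow>\<^sub>E {1..n}).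
     (\<forall>r\<in>{1..k}. bij_betw (A r) {1..n} {1..n}) \<and>
     (\<forall>c\<in>{1..n}. inj_on (\<lambda>r. A r c) {1..k})}"

lemma finite_latin_rectangles: "finite (latin_rectangles n k)"
proof -
  have "finite ({1..k} \<rightarrow>\<^sub>E ({1..n} \<rightarrow>\<^sub>E {1..n}))" by (rule finite_PiE, simp, rule finite_PiE) auto
  thus ?thesis by (simp add: latin_rectangles_def)
qed

text \<open>Columns and the symbols still missing in them form a regular bipartite graph of degree
  \<open>n - k\<close>: each of the \<open>k\<close> rows has the symbol \<open>s\<close> in one
  column \<open>h r\<close>, and these columns are distinct because no column repeats a
  symbol.\<close>

lemma card_latin_rectangle_extensions:
  assumes A: "A \<in> latin_rectangles n k" and "k < n"
  shows "(real (n - k) / exp 1) ^ n \<le>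
    real (card {g \<in> Pi\<^sub>E {1..n} (\<lambda>c. {1..n} - (\<lambda>r. A r c) ` {1..k}). bij_betw g {1..n} {1..n}})"
proof (rule card_perfect_matchings_ge)
  have inj: "inj_on (\<lambda>r. A r c) {1..k}" if "c \<in> {1..n}" for c
    using A that by (simp add: latin_rectangles_def)
  have bij: "bij_betw (A r) {1..n} {1..n}" if "r \<in> {1..k}" for r
    using A that by (simp add: latin_rectangles_def)
  have sub: "(\<lambda>r. A r c) ` {1..k} \<subseteq> {1..n}" if "c \<in> {1..n}" for c
    using bij_betw_imp_surj_on[OF bij] that by blast
  show "card ({1..n} - (\<lambda>r. A r c) ` {1..k}) = n - k" if "c \<in> {1..n}" for c
    using card_Diff_subset[OF _ sub[OF that]] card_image[OF inj[OF that]] by simp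
  show "card {c \<in> {1..n}. s \<in> {1..n} - (\<lambda>r. A r c) ` {1..k}} = n - k" if s: "s \<in> {1..n}" for s
  proof -
    define h where "h r = inv_into {1..n} (A r) s" for r
    have h: "h r \<in> {1..n}" "A r (h r) = s" if "r \<in> {1..k}" for r
      proof -
        have "s \<in> A r ` {1..n}" using bij[OF that] s by (simp only: bij_betw_def)
        thus "h r \<in> {1..n}" "A r (h r) = s" unfolding h_def
          by (rule inv_into_into, rule f_inv_into_f)
      qed
    have uniq: "c = h r" if "r \<in> {1..k}" "c \<in> {1..n}" "A r c = s" for r c
      using bij[OF that(1)] h[OF that(1)] that by (metis bij_betw_def inj_onD)
    have "inj_on h {1..k}"
    proof (rule inj_onI)
      fix r r' assume r: "r \<in> {1..k}" "r' \<in> {1..k}" "h r = h r'"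
      hence "A r (h r) = A r' (h r)" using h by metis
      thus "r = r'" by (rule inj_onD[OF inj[OF h(1)[OF r(1)]]]) (use r in blast)+
    qed
    hence "card (h ` {1..k}) = k" by (simp add: card_image)
    moreover have "{c \<in> {1..n}. s \<in> {1..n} - (\<lambda>r. A r c) ` {1..k}} = {1..n} - h ` {1..k}"
    proof -
      have "s \<in> (\<lambda>r. A r c) ` {1..k} \<longleftrightarrow> c \<in> h ` {1..k}" if "c \<in> {1..n}" for c
      proof
        show "c \<in> h ` {1..k}" if "s \<in> (\<lambda>r. A r c) ` {1..k}"
          using that uniq[OF _ \<open>c \<in> {1..n}\<close>] by blast
        show "s \<in> (\<lambda>r. A r c) ` {1..k}" if hc: "c \<in> h ` {1..k}"
        proof -
          obtain r where r: "r \<in> {1..k}" "c = h r" using hc by blast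
          show ?thesis by (rule image_eqI[OF _ r(1)]) (simp only: r(2) h(2)[OF r(1)])
        qed
      qed
      thus ?thesis using s by blast
    qed
    moreover have "h ` {1..k} \<subseteq> {1..n}" using h by blast
    ultimately show ?thesis by (simp add: card_Diff_subset)
  qed
qed (use assms in auto)

lemma card_latin_rectangles_Suc:
  assumes "k < n"
  shows "real (card (latin_rectangles n k)) * (real (n - k) / exp 1) ^ n
    \<le> real (card (latin_rectangles n (Suc k)))"
proof -
  define M where "M A = {g \<in> Pi\<^sub>E {1..n} (\<lambda>c. {1..n} - (\<lambda>r. A r c) ` {1..k}). bij_betw g {1..n} {1..n}}"
    for A :: "nat \<Rightarrow> nat \<Rightarrow> nat"
  have finM: "finite (M A)" for A
  proof -
    have "finite (Pi\<^sub>E {1..n} (\<lambda>c. {1..n} - (\<lambda>r. A r c) ` {1..k}))" by (rule finite_PiE) auto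
    thus ?thesis by (simp add: M_def)
  qed
  define \<Phi> where "\<Phi> = (\<lambda>(A :: nat \<Rightarrow> nat \<Rightarrow> nat, g). A(Suc k := g))"
  have "inj_on \<Phi> (Sigma (latin_rectangles n k) M)"
  proof (rule inj_onI, clarify)
    fix A g A' g'
    assume *: "A \<in> latin_rectangles n k" "A' \<in> latin_rectangles n k" "\<Phi> (A, g) = \<Phi> (A', g')"
    have eq: "A(Suc k := g) = A'(Suc k := g')" using * by (simp add: \<Phi>_def)
    have "A r = A' r" for r
    proof (cases "r \<in> {1..k}")
      case True
      thus ?thesis using fun_cong[OF eq, of r] by simp
    next
      case False
      have "A \<in> extensional {1..k}" "A' \<in> extensional {1..k}"
        using * by (simp_all add: latin_rectangles_def PiE_def)
      thus ?thesis using False by (simp add: extensional_def)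
    qed
    thus "A = A' \<and> g = g'" using fun_cong[OF eq, of "Suc k"] by auto
  qed
  moreover have "\<Phi> ` Sigma (latin_rectangles n k) M \<subseteq> latin_rectangles n (Suc k)"
  proof clarify
    fix A g assume A: "A \<in> latin_rectangles n k" and g: "g \<in> M A"
    have gb: "bij_betw g {1..n} {1..n}" "g \<in> Pi\<^sub>E {1..n} (\<lambda>c. {1..n} - (\<lambda>r. A r c) ` {1..k})"
      using g by (simp_all add: M_def)
    have g_ne: "g c \<noteq> A r c" if "c \<in> {1..n}" "r \<in> {1..k}" for c r
      using PiE_mem[OF gb(2) that(1)] that(2) by blast
    have g_PiE: "g \<in> {1..n} \<rightarrow>\<^sub>E {1..n}" by (rule subsetD[OF PiE_mono gb(2)]) auto
    have ivl: "{1..Suc k} = insert (Suc k) {1..k}" by auto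
    have "inj_on (\<lambda>r. (A(Suc k := g)) r c) {1..Suc k}" if c: "c \<in> {1..n}" for c
    proof -
      have "inj_on (\<lambda>r. A r c) {1..k}" using A c by (simp add: latin_rectangles_def)
      moreover have "inj_on (\<lambda>r. (A(Suc k := g)) r c) {1..k} \<longleftrightarrow> inj_on (\<lambda>r. A r c) {1..k}"
        by (rule inj_on_cong) auto
      ultimately have "inj_on (\<lambda>r. (A(Suc k := g)) r c) {1..k}" by blast
      thus ?thesis unfolding ivl using g_ne[OF c] by (subst inj_on_insert) (auto simp: image_iff)
    qed
    moreover have "A(Suc k := g) \<in> {1..Suc k} \<rightarrow>\<^sub>E ({1..n} \<rightarrow>\<^sub>E {1..n})"
      unfolding ivl by (rule PiE_fun_upd, rule g_PiE) (use A in \<open>simp add: latin_rectangles_def\<close>)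
    moreover have "\<forall>r\<in>{1..Suc k}. bij_betw ((A(Suc k := g)) r) {1..n} {1..n}"
      using A gb(1) by (auto simp: latin_rectangles_def)
    ultimately show "\<Phi> (A, g) \<in> latin_rectangles n (Suc k)"
      by (simp add: \<Phi>_def latin_rectangles_def)
  qed
  ultimately have "card (Sigma (latin_rectangles n k) M) \<le> card (latin_rectangles n (Suc k))"
    by (intro card_inj_on_le finite_latin_rectangles)
  moreover have "card (Sigma (latin_rectangles n k) M) = (\<Sum>A\<in>latin_rectangles n k. card (M A))"
    by (rule card_SigmaI) (use finM finite_latin_rectangles in auto)
  moreover have "(\<Sum>A\<in>latin_rectangles n k. (real (n - k) / exp 1) ^ n)
      \<le> (\<Sum>A\<in>latin_rectangles n k. real (card (M A)))"
    unfolding M_def by (intro sum_mono card_latin_rectangle_extensions assms)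
  ultimately show ?thesis by (simp flip: of_nat_sum)
qed

lemma card_latin_rectangles_ge:
  "k \<le> n \<Longrightarrow> (\<Prod>i<k. (real (n - i) / exp 1) ^ n) \<le> real (card (latin_rectangles n k))"
proof (induction k)
  case 0
  have "latin_rectangles n 0 = {\<lambda>_. undefined}" by (auto simp: latin_rectangles_def)
  thus ?case by simp
next
  case (Suc k)
  have "(\<Prod>i<Suc k. (real (n - i) / exp 1) ^ n)
      \<le> real (card (latin_rectangles n k)) * (real (n - k) / exp 1) ^ n"
    using Suc by (simp add: mult_right_mono)
  also have "\<dots> \<le> real (card (latin_rectangles n (Suc k)))"
    by (rule card_latin_rectangles_Suc) (use Suc in simp)
  finally show ?case .
qed

lemma latin_array_of_rectangle:
  assumes A: "A \<in> latin_rectangles n n"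
  shows "latin_array n A"
proof -
  have bij: "bij_betw (A r) {1..n} {1..n}" if "r \<in> {1..n}" for r
    using A that by (simp add: latin_rectangles_def)
  have bij': "bij_betw (\<lambda>r. A r c) {1..n} {1..n}" if c: "c \<in> {1..n}" for c
  proof -
    have "inj_on (\<lambda>r. A r c) {1..n}" using A c by (simp add: latin_rectangles_def)
    moreover have "(\<lambda>r. A r c) ` {1..n} \<subseteq> {1..n}" using bij_betw_imp_surj_on[OF bij] c by blast
    ultimately show ?thesis by (simp add: bij_betw_def endo_inj_surj)
  qed
  have ex1: "\<exists>!x. x \<in> {1..n} \<and> f x = y" if "bij_betw f {1..n} {1..n}" "y \<in> {1..n}" for f :: "nat \<Rightarrow> nat" and y
  proof -
    have "y \<in> f ` {1..n}" using that by (simp only: bij_betw_def)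
    then obtain x where "x \<in> {1..n}" "f x = y" by blast
    thus ?thesis using that(1) by (intro ex1I[of _ x]) (auto simp: bij_betw_def dest: inj_onD)
  qed
  show ?thesis unfolding latin_array_def
  proof (intro conjI ballI)
    show "A r c \<in> {1..n}" if "r \<in> {1..n}" "c \<in> {1..n}" for r c
      using bij_betw_imp_surj_on[OF bij[OF that(1)]] that(2) by blast
  qed (use ex1[OF bij] ex1[OF bij'] in auto)
qed

lemma card_latin_squares_ge: "(fact n / exp 1 ^ n) ^ n \<le> real (card (latin_squares n))"
proof -
  have "(fact n / exp 1 ^ n :: real) ^ n = (\<Prod>i<n. (real (n - i) / exp 1) ^ n)"
    by (simp add: fact_prod_rev power_divide prod_dividef atLeast0LessThan flip: prod_power_distrib)
  also have "\<dots> \<le> real (card (latin_rectangles n n))" by (rule card_latin_rectangles_ge) simp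
  also have "card (latin_rectangles n n) \<le> card (latin_squares n)"
  proof (rule card_inj_on_le[where f="array_hypergraph n"])
    show "array_hypergraph n ` latin_rectangles n n \<subseteq> latin_squares n"
      using latin_array_of_rectangle by (auto simp: latin_squares_def)
    show "inj_on (array_hypergraph n) (latin_rectangles n n)"
    proof (rule inj_onI)
      fix A B assume AB: "A \<in> latin_rectangles n n" "B \<in> latin_rectangles n n"
        "array_hypergraph n A = array_hypergraph n B"
      have "A r c = B r c" if "r \<in> {1..n}" "c \<in> {1..n}" for r c
      proof -
        have "(r, c, A r c) \<in> array_hypergraph n B"
          using AB(3) that unfolding array_hypergraph_def by blast
        thus ?thesis by (simp add: array_hypergraph_def)
      qed
      note eq = this
      have A: "A \<in> {1..n} \<rightarrow>\<^sub>E ({1..n} \<rightarrow>\<^sub>E {1..n})" and B: "B \<in> {1..n} \<rightarrow>\<^sub>E ({1..n} \<rightarrow>\<^sub>E {1..n})"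
        using AB by (simp_all add: latin_rectangles_def)
      show "A = B"
      proof (rule PiE_ext[OF A B])
        fix r assume r: "r \<in> {1..n}"
        show "A r = B r" by (rule PiE_ext[OF PiE_mem[OF A r] PiE_mem[OF B r]]) (rule eq[OF r])
      qed
    qed
  qed (rule finite_latin_squares)
  finally show ?thesis by simp
qed

section \<open>The triangle removal process\<close>

definition open_triples :: "nat \<Rightarrow> hyperedge set \<Rightarrow> hyperedge set" where
  "open_triples n H = {t \<in> all_triples n. \<forall>e\<in>H. pairs t \<inter> pairs e = {}}"

lemma finite_open_triples: "finite (open_triples n H)"
  using finite_all_triples by (simp add: open_triples_def)

lemma triangles_remaining:
  "triangles (complete_tripartite n - \<Union>(pairs ` H)) = open_triples n H"
  using triangles_complete_tripartite[of n]
  unfolding triangles_def open_triples_def by blast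

text \<open>The outcome \<open>ts\<close> prescribes every choice, so in each step a single branch
  contributes. The set \<open>H\<close> of triples removed beforehand makes the induction
  possible.\<close>

lemma pmf_trp_from:
  assumes "\<And>i. i < length ts \<Longrightarrow> ts ! i \<in> open_triples n (H \<union> set (take i ts))"
  shows "pmf (trp_from (length ts) (complete_tripartite n - \<Union>(pairs ` H))) (Some ts) =
    (\<Prod>i<length ts. 1 / real (card (open_triples n (H \<union> set (take i ts)))))"
  using assms
proof (induction ts arbitrary: H)
  case Nil
  show ?case by simp
next
  case (Cons t ts)
  define A where "A = open_triples n H"
  have t: "t \<in> A" using Cons.prems[of 0] by (simp add: A_def)
  define M where "M t' = trp_from (length ts) (complete_tripartite n - \<Union>(pairs ` H) - pairs t')" for t'
  have M: "pmf (map_pmf (map_option (Cons t')) (M t')) (Some (t # ts)) =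
      (if t' = t then pmf (M t) (Some ts) else 0)" for t'
  proof (cases "t' = t")
    case True
    have "inj (map_option (Cons t))" by (intro option.inj_map) simp
    hence "pmf (map_pmf (map_option (Cons t)) (M t)) (map_option (Cons t) (Some ts)) = pmf (M t) (Some ts)"
      by (rule pmf_map_inj')
    thus ?thesis using True by simp
  next
    case False
    hence "Some (t # ts) \<noteq> map_option (Cons t') x" for x by (cases x) auto
    hence "Some (t # ts) \<notin> map_option (Cons t') ` set_pmf (M t')" by blast
    thus ?thesis using False by (simp add: pmf_map_outside)
  qed
  have "pmf (trp_from (length (t # ts)) (complete_tripartite n - \<Union>(pairs ` H))) (Some (t # ts)) =
      (\<Sum>t'\<in>A. pmf (map_pmf (map_option (Cons t')) (M t')) (Some (t # ts))) / real (card A)"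
    using t finite_open_triples[of n H]
    by (auto simp: triangles_remaining A_def M_def pmf_bind_pmf_of_set)
  also have "\<dots> = pmf (M t) (Some ts) / real (card A)"
    unfolding M using t finite_open_triples by (simp add: A_def)
  also have "M t = trp_from (length ts) (complete_tripartite n - \<Union>(pairs ` insert t H))"
    unfolding M_def by (rule arg_cong[where f="trp_from (length ts)"]) auto
  also have "pmf \<dots> (Some ts) = (\<Prod>i<length ts. 1 / real (card (open_triples n (insert t H \<union> set (take i ts)))))"
    by (rule Cons.IH) (use Cons.prems[of "Suc i" for i] in simp)
  finally show ?case
    by (simp only: length_Cons prod.lessThan_Suc_shift) (simp add: A_def)
qed

lemma latin_square_pairs_disjoint:
  assumes "L \<in> latin_squares n" "e \<in> L" "t \<in> L" "e \<noteq> t"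
  shows "pairs t \<inter> pairs e = {}"
proof (rule ccontr)
  assume "pairs t \<inter> pairs e \<noteq> {}"
  then obtain x where x: "x \<in> pairs t" "x \<in> pairs e" by blast
  have "t \<in> triangles (complete_tripartite n)"
    unfolding triangles_complete_tripartite using assms latin_square_subset by blast
  hence "x \<in> complete_tripartite n" using x by (auto simp: triangles_def)
  hence "\<exists>!t. t \<in> L \<and> x \<in> pairs t" using assms by (simp add: latin_squares_iff)
  thus False using assms x by blast
qed

lemma latin_square_open:
  assumes "L \<in> latin_squares n" "t \<in> L" "H \<subseteq> L" "t \<notin> H"
  shows "t \<in> open_triples n H"
  using assms latin_square_pairs_disjoint[of L n] latin_square_subset[of L n]
  unfolding open_triples_def by blast

definition ordered_subsets :: "nat \<Rightarrow> 'a set \<Rightarrow> 'a list set" where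
  "ordered_subsets m L = {ts. length ts = m \<and> distinct ts \<and> set ts \<subseteq> L}"

lemma finite_ordered_subsets: "finite L \<Longrightarrow> finite (ordered_subsets m L)"
  by (rule finite_subset[OF _ finite_lists_length_eq[of L m]]) (auto simp: ordered_subsets_def)

lemma nth_in_open_triples:
  assumes L: "L \<in> latin_squares n" and P: "P \<in> ordered_subsets m L" and i: "i < m"
  shows "P ! i \<in> open_triples n (set (take i P))"
proof -
  have m: "length P = m" "distinct P" "set P \<subseteq> L" using P by (auto simp: ordered_subsets_def)
  have "distinct (take i P @ [P ! i])" using m i by (simp flip: take_Suc_conv_app_nth)
  moreover have "set (take i P) \<subseteq> L" using m(3) set_take_subset[of i P] by blast
  moreover have "P ! i \<in> L" using m i by auto
  ultimately show ?thesis using latin_square_open[OF L] by simp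
qed

lemma pmf_TRP_latin:
  assumes L: "L \<in> latin_squares n" and ts: "ts \<in> ordered_subsets m L"
  shows "pmf (TRP n m) (Some ts) = (\<Prod>i<m. 1 / real (card (open_triples n (set (take i ts)))))"
proof -
  have m: "length ts = m" using ts by (simp add: ordered_subsets_def)
  have "ts ! i \<in> open_triples n ({} \<union> set (take i ts))" if "i < length ts" for i
    using nth_in_open_triples[OF L ts] that m by simp
  from pmf_trp_from[OF this] show ?thesis by (simp add: TRP_def m)
qed

section \<open>Greedy completions\<close>

text \<open>Kraft's inequality for sequential choices: the data \<open>f\<close> is revealed one coordinate at a
  time, in the order of \<open>rk\<close>, and \<open>A f j\<close> is the set of values that are possible
  for coordinate \<open>j\<close> given the earlier ones.\<close>

lemma sequential_choice_kraft:
  fixes rk :: "'j \<Rightarrow> nat" and val :: "'f \<Rightarrow> 'j \<Rightarrow> 'b" and A :: "'f \<Rightarrow> 'j \<Rightarrow> 'b set"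
  assumes "finite J" "inj_on rk J" "finite F"
    and fin: "\<And>f j. f \<in> F \<Longrightarrow> j \<in> J \<Longrightarrow> finite (A f j)"
    and mem: "\<And>f j. f \<in> F \<Longrightarrow> j \<in> J \<Longrightarrow> val f j \<in> A f j"
    and dep: "\<And>f f' j. f \<in> F \<Longrightarrow> f' \<in> F \<Longrightarrow> j \<in> J \<Longrightarrow>
      (\<And>j'. j' \<in> J \<Longrightarrow> rk j' < rk j \<Longrightarrow> val f j' = val f' j') \<Longrightarrow> A f j = A f' j"
    and sep: "\<And>f f'. f \<in> F \<Longrightarrow> f' \<in> F \<Longrightarrow> (\<And>j. j \<in> J \<Longrightarrow> val f j = val f' j) \<Longrightarrow> f = f'"
  shows "(\<Sum>f\<in>F. \<Prod>j\<in>J. 1 / real (card (A f j))) \<le> 1"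
  using assms
proof (induction J arbitrary: F rule: finite_ranking_induct[where f=rk])
  case empty
  have "card F \<le> 1"
    unfolding One_nat_def card_le_Suc0_iff_eq[OF empty.prems(2)]
    by (intro ballI empty.prems(6)) auto
  thus ?case by simp
next
  case (insert x J)
  show ?case
  proof (cases "x \<in> J")
    case True
    show ?thesis
      using insert.prems unfolding insert_absorb[OF True] by (rule insert.IH)
  next
    case False
    have lt: "rk j < rk x" if "j \<in> J" for j
    proof -
      have "rk j \<noteq> rk x"
        using inj_onD[OF insert.prems(1), of j x] that False by blast
      thus ?thesis using insert.hyps(2)[OF that] by simp
    qed
    \<comment> \<open>One representative for each class of data agreeing on \<open>J\<close>,
      selected through the values on \<open>J\<close> only, so that equivalent data share it. The
      induction hypothesis is applied to the representatives; \<open>x\<close> has the largest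
      rank.\<close>
    define rep where "rep f = (SOME g. g \<in> F \<and> (\<forall>j\<in>J. val g j = val f j))" for f
    have rep: "rep f \<in> F" "\<And>j. j \<in> J \<Longrightarrow> val (rep f) j = val f j" if "f \<in> F" for f
      using someI[of "\<lambda>g. g \<in> F \<and> (\<forall>j\<in>J. val g j = val f j)" f] that by (auto simp: rep_def)
    have rep_eq: "rep f = rep f'" if "\<And>j. j \<in> J \<Longrightarrow> val f j = val f' j" for f f'
      using that by (simp add: rep_def)
    define G where "G = rep ` F"
    have G: "G \<subseteq> F" using rep by (auto simp: G_def)
    have finG: "finite G" using insert.prems(2) by (simp add: G_def)
    have rk_J: "rk j' < rk j \<Longrightarrow> j \<in> J \<Longrightarrow> j' \<in> insert x J \<Longrightarrow> j' \<in> J" for j j'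
      using lt[of j] by auto
    have A_rep: "A f j = A (rep f) j" if "f \<in> F" "j \<in> insert x J" for f j
    proof (rule insert.prems(5)[OF that(1) rep(1)[OF that(1)] that(2)])
      fix j' assume "j' \<in> insert x J" "rk j' < rk j"
      hence "j' \<in> J" using that(2) rk_J by blast
      thus "val f j' = val (rep f) j'" using rep(2)[OF that(1)] by simp
    qed
    have IH: "(\<Sum>g\<in>G. \<Prod>j\<in>J. 1 / real (card (A g j))) \<le> 1"
    proof (rule insert.IH)
      show "inj_on rk J" using insert.prems(1) by (rule inj_on_subset) auto
      show "finite G" by fact
      show "finite (A f j)" if "f \<in> G" "j \<in> J" for f j using that G insert.prems(3) by blast
      show "val f j \<in> A f j" if "f \<in> G" "j \<in> J" for f j using that G insert.prems(4) by blast
      show "A f j = A f' j" if "f \<in> G" "f' \<in> G" "j \<in> J"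
        and *: "\<And>j'. j' \<in> J \<Longrightarrow> rk j' < rk j \<Longrightarrow> val f j' = val f' j'" for f f' j
      proof (rule insert.prems(5))
        show "f \<in> F" "f' \<in> F" "j \<in> insert x J" using that G by auto
        show "val f j' = val f' j'" if "j' \<in> insert x J" "rk j' < rk j" for j'
          using * rk_J[OF that(2) \<open>j \<in> J\<close> that(1)] that by blast
      qed
      show "f = f'" if "f \<in> G" "f' \<in> G" and *: "\<And>j. j \<in> J \<Longrightarrow> val f j = val f' j" for f f'
      proof -
        obtain h where h: "h \<in> F" "f = rep h" using \<open>f \<in> G\<close> unfolding G_def by (elim imageE)
        obtain h' where h': "h' \<in> F" "f' = rep h'" using \<open>f' \<in> G\<close> unfolding G_def by (elim imageE)
        have "val h j = val h' j" if "j \<in> J" for j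
          using *[OF that] rep(2)[OF h(1) that] rep(2)[OF h'(1) that] h h' by simp
        thus ?thesis using h h' rep_eq by blast
      qed
    qed
    have "(\<Sum>f\<in>F. \<Prod>j\<in>insert x J. 1 / real (card (A f j))) =
        (\<Sum>g\<in>G. \<Sum>f | f \<in> F \<and> rep f = g. \<Prod>j\<in>insert x J. 1 / real (card (A f j)))"
      unfolding G_def by (rule sum.image_gen) (rule insert.prems)
    also have "\<dots> \<le> (\<Sum>g\<in>G. \<Prod>j\<in>J. 1 / real (card (A g j)))"
    proof (rule sum_mono)
      fix g assume g: "g \<in> G"
      define C where "C = {f \<in> F. rep f = g}"
      have gF: "g \<in> F" using g G by blast
      \<comment> \<open>Members of a class can differ only in their value at \<open>x\<close>, and
        this value lies in the common set \<open>A g x\<close>.\<close>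
      have "card C \<le> card (A g x)"
      proof (rule card_inj_on_le)
        show "inj_on (\<lambda>f. val f x) C"
        proof (rule inj_onI)
          fix f f' assume f: "f \<in> C" "f' \<in> C" "val f x = val f' x"
          show "f = f'"
          proof (rule insert.prems(6))
            show "f \<in> F" "f' \<in> F" using f by (auto simp: C_def)
            show "val f j = val f' j" if "j \<in> insert x J" for j
              using f that rep(2)[of f j] rep(2)[of f' j] by (auto simp: C_def)
          qed
        qed
        show "(\<lambda>f. val f x) ` C \<subseteq> A g x"
          using insert.prems(4) A_rep by (fastforce simp: C_def)
        show "finite (A g x)" using insert.prems(3) gF by blast
      qed
      hence c: "real (card C) / real (card (A g x)) \<le> 1"
        by (metis divide_le_eq_1 of_nat_0_le_iff of_nat_le_iff div_by_0 zero_le_one order_le_less)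
      have "(\<Sum>f\<in>C. \<Prod>j\<in>insert x J. 1 / real (card (A f j))) = (\<Sum>f\<in>C. \<Prod>j\<in>insert x J. 1 / real (card (A g j)))"
        by (intro sum.cong prod.cong refl) (use A_rep in \<open>auto simp: C_def\<close>)
      also have "\<dots> = (real (card C) / real (card (A g x))) * (\<Prod>j\<in>J. 1 / real (card (A g j)))"
        using insert.hyps False by simp
      also have "\<dots> \<le> 1 * (\<Prod>j\<in>J. 1 / real (card (A g j)))"
        using c by (intro mult_right_mono prod_nonneg) auto
      finally show "(\<Sum>f | f \<in> F \<and> rep f = g. \<Prod>j\<in>insert x J. 1 / real (card (A f j)))
          \<le> (\<Prod>j\<in>J. 1 / real (card (A g j)))"
        by (simp add: C_def)
    qed
    also note IH
    finally show ?thesis .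
  qed
qed

section \<open>Permutations with prescribed values\<close>

lemma card_permutes_value_eq:
  assumes "finite S" and "r \<in> S" "r' \<in> S" and Q: "\<And>p. Q (Transposition.transpose r r' \<circ> p) \<longleftrightarrow> Q p"
  shows "card {p. p permutes S \<and> Q p \<and> p a = r} = card {p. p permutes S \<and> Q p \<and> p a = r'}"
\<comment> \<open>Composition with the transposition exchanges the values \<open>r\<close> and
  \<open>r'\<close>; \<open>Q\<close> stands for conditions on other values that are invariant under
  it.\<close>
proof (rule bij_betw_same_card[of "\<lambda>p. Transposition.transpose r r' \<circ> p"])
  have t: "Transposition.transpose r r' permutes S" using assms by (intro permutes_swap_id)
  show "bij_betw (\<lambda>p. Transposition.transpose r r' \<circ> p) {p. p permutes S \<and> Q p \<and> p a = r}
      {p. p permutes S \<and> Q p \<and> p a = r'}"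
    by (rule bij_betwI[where g="\<lambda>p. Transposition.transpose r r' \<circ> p"])
      (auto simp: Q permutes_compose t transpose_apply_first transpose_apply_second simp flip: comp_assoc)
qed

lemma card_permutes_value:
  assumes "finite S" "a \<in> S" "r \<in> S"
  shows "card {p. p permutes S \<and> p a = r} = fact (card S - 1)"
proof -
  have "(\<Sum>r'\<in>S. card {p. p permutes S \<and> p a = r'}) = (\<Sum>r'\<in>S. card {p. p permutes S \<and> p a = r})"
    using card_permutes_value_eq[OF assms(1) _ assms(3), where Q="\<lambda>_. True"] by (intro sum.cong) auto
  moreover have "(\<Sum>r'\<in>S. card {p. p permutes S \<and> p a = r'}) = card (\<Union>r'\<in>S. {p. p permutes S \<and> p a = r'})"
    using assms(1) finite_permutations[OF assms(1)] by (intro card_UN_disjoint[symmetric]) auto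
  moreover have "(\<Union>r'\<in>S. {p. p permutes S \<and> p a = r'}) = {p. p permutes S}"
    using assms(2) by (auto simp: permutes_in_image)
  moreover have "card {p. p permutes S} = card S * fact (card S - 1)"
    using assms card_permutations[OF refl assms(1)] by (cases "card S") auto
  ultimately have "card S * card {p. p permutes S \<and> p a = r} = card S * fact (card S - 1)"
    by (simp only: sum_constant of_nat_id)
  moreover have "card S \<noteq> 0" using assms by auto
  ultimately show ?thesis by simp
qed

lemma card_permutes_two_values:
  assumes "finite S" "a \<in> S" "a' \<in> S" "a \<noteq> a'" "r \<in> S" "r' \<in> S" "r \<noteq> r'"
  shows "card {p. p permutes S \<and> p a = r \<and> p a' = r'} = fact (card S - 2)"
proof -
  let ?C = "\<lambda>x. {p. p permutes S \<and> p a = r \<and> p a' = x}"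
  have "card S \<ge> card {r, r'}" using assms by (intro card_mono) auto
  hence S2: "card S \<ge> 2" using assms by simp
  have "card (?C x) = card (?C r')" if "x \<in> S - {r}" for x
  proof (rule card_permutes_value_eq[OF assms(1)])
    show "(Transposition.transpose x r' \<circ> p) a = r \<longleftrightarrow> p a = r" for p
      using that assms(7) by (auto simp: Transposition.transpose_def)
  qed (use that assms in auto)
  hence "(\<Sum>x\<in>S - {r}. card (?C x)) = (\<Sum>x\<in>S - {r}. card (?C r'))" by (rule sum.cong[OF refl])
  moreover have "card (S - {r}) = card S - 1" using assms by simp
  moreover have "(\<Sum>x\<in>S - {r}. card (?C x)) = card (\<Union>x\<in>S - {r}. ?C x)"
    using assms(1) finite_permutations[OF assms(1)] by (intro card_UN_disjoint[symmetric]) auto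
  moreover have "(\<Union>x\<in>S - {r}. ?C x) = {p. p permutes S \<and> p a = r}"
  proof -
    have "p a' \<in> S" "p a' \<noteq> p a" if "p permutes S" for p
      using that assms by (auto simp: permutes_in_image dest: permutes_inj injD)
    thus ?thesis by auto
  qed
  moreover have "card {p. p permutes S \<and> p a = r} = (card S - 1) * fact (card S - 2)"
  proof -
    have "card S - 1 = Suc (card S - 2)" using S2 by simp
    thus ?thesis using card_permutes_value[OF assms(1,2,5)] by (simp only: fact_Suc of_nat_id)
  qed
  ultimately have "(card S - 1) * card (?C r') = (card S - 1) * fact (card S - 2)"
    by (simp only: sum_constant of_nat_id)
  thus ?thesis using S2 by simp
qed

text \<open>Given \<open>p a = r\<close>, the position of \<open>r'\<close> is uniform among the
  other \<open>n - 1\<close>. Division by \<open>fact (n - 1)\<close> gives the probability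
  \<open>(n - a) / (n - 1)\<close> that enters \<open>later_frac\<close>.\<close>

lemma card_permutes_later:
  assumes "a \<in> {1..n}" "r \<in> {1..n}" "r' \<in> {1..n}" "r \<noteq> r'"
  shows "card {p. p permutes {1..n} \<and> p a = r \<and> r' \<in> p ` {a<..n}} = (n - a) * fact (n - 2)"
proof -
  have "{p. p permutes {1..n} \<and> p a = r \<and> r' \<in> p ` {a<..n}} =
      (\<Union>a'\<in>{a<..n}. {p. p permutes {1..n} \<and> p a = r \<and> p a' = r'})" by auto
  also have "card \<dots> = (\<Sum>a'\<in>{a<..n}. card {p. p permutes {1..n} \<and> p a = r \<and> p a' = r'})"
  proof (intro card_UN_disjoint ballI impI)
    show "finite {p. p permutes {1..n} \<and> p a = r \<and> p a' = r'}" for a'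
      by (rule finite_subset[OF _ finite_permutations[of "{1..n}"]]) auto
    show "{p. p permutes {1..n} \<and> p a = r \<and> p x = r'} \<inter> {p. p permutes {1..n} \<and> p a = r \<and> p y = r'} = {}"
      if "x \<noteq> y" for x y
      using that permutes_inj by (auto dest: injD)
  qed simp
  also have "\<dots> = (\<Sum>a'\<in>{a<..n}. fact (n - 2))"
    using assms by (intro sum.cong refl) (subst card_permutes_two_values, auto)
  finally show ?thesis by simp
qed

section \<open>Completing a partial Latin square cell by cell\<close>

lemma latin_square_ex1:
  assumes "L \<in> latin_squares n" "x \<in> {1..n}" "y \<in> {1..n}"
  shows "\<exists>!s. (x, y, s) \<in> L" "\<exists>!c. (x, c, y) \<in> L" "\<exists>!r. (r, x, y) \<in> L"
  using assms by (simp_all only: latin_squares_iff ball_complete_tripartite ex1_pairs_iff)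

lemma latin_square_mem_range:
  assumes "L \<in> latin_squares n" "(r, c, s) \<in> L"
  shows "r \<in> {1..n}" "c \<in> {1..n}" "s \<in> {1..n}"
  using assms latin_square_subset unfolding all_triples_def by blast+

definition filled :: "hyperedge set \<Rightarrow> nat \<Rightarrow> nat \<Rightarrow> bool" where
  "filled P r c \<longleftrightarrow> (\<exists>s. (r, c, s) \<in> P)"

text \<open>The cells are filled in the order \<open>(\<sigma> 1, \<theta> 1), (\<sigma> 1, \<theta> 2), \<dots>, (\<sigma> 2, \<theta> 1), \<dots>\<close>\<close>

definition earlier_entries ::
    "nat \<Rightarrow> hyperedge set \<Rightarrow> (nat \<Rightarrow> nat) \<Rightarrow> (nat \<Rightarrow> nat) \<Rightarrow> nat \<Rightarrow> nat \<Rightarrow> hyperedge set" where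
  "earlier_entries n L \<sigma> \<theta> a b = {(\<sigma> a', \<theta> b', s) | a' b' s.
     a' \<in> {1..n} \<and> b' \<in> {1..n} \<and> (a' < a \<or> a' = a \<and> b' < b) \<and> (\<sigma> a', \<theta> b', s) \<in> L}"

text \<open>\<open>L\<close> enters only through its entries at earlier positions, which makes these
  sets admissible in \<open>sequential_choice_kraft\<close>.\<close>

definition choices ::
    "nat \<Rightarrow> hyperedge set \<Rightarrow> hyperedge set \<Rightarrow> (nat \<Rightarrow> nat) \<Rightarrow> (nat \<Rightarrow> nat) \<Rightarrow> nat \<Rightarrow> nat \<Rightarrow> nat set" where
  "choices n P L \<sigma> \<theta> a b =
     {s. (\<sigma> a, \<theta> b, s) \<in> open_triples n (P \<union> earlier_entries n L \<sigma> \<theta> a b)}"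

lemma open_triples_range:
  assumes "(r, c, s) \<in> open_triples n H"
  shows "r \<in> {1..n}" "c \<in> {1..n}" "s \<in> {1..n}"
  using assms by (auto simp: open_triples_def all_triples_def)

lemma finite_choices: "finite (choices n P L \<sigma> \<theta> a b)"
  by (rule finite_subset[of _ "{1..n}"]) (auto simp: choices_def dest: open_triples_range)

lemma latin_entry_in_choices:
  assumes L: "L \<in> latin_squares n" and P: "P \<subseteq> L" and \<sigma>: "\<sigma> permutes {1..n}" and \<theta>: "\<theta> permutes {1..n}"
    and "a \<in> {1..n}" "b \<in> {1..n}" "\<not> filled P (\<sigma> a) (\<theta> b)" "(\<sigma> a, \<theta> b, s) \<in> L"
  shows "s \<in> choices n P L \<sigma> \<theta> a b"
proof -
  have "(\<sigma> a, \<theta> b, s) \<notin> earlier_entries n L \<sigma> \<theta> a b"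
  proof
    assume "(\<sigma> a, \<theta> b, s) \<in> earlier_entries n L \<sigma> \<theta> a b"
    then obtain a' b' where *: "a' < a \<or> a' = a \<and> b' < b" "\<sigma> a' = \<sigma> a" "\<theta> b' = \<theta> b"
      unfolding earlier_entries_def mem_Collect_eq prod.inject by metis
    have "a' = a" "b' = b"
      using injD[OF permutes_inj[OF \<sigma>] *(2)] injD[OF permutes_inj[OF \<theta>] *(3)] .
    thus False using *(1) by simp
  qed
  moreover have "earlier_entries n L \<sigma> \<theta> a b \<subseteq> L" by (auto simp: earlier_entries_def)
  ultimately show ?thesis unfolding choices_def
    using latin_square_open[OF L \<open>(\<sigma> a, \<theta> b, s) \<in> L\<close>, of "P \<union> earlier_entries n L \<sigma> \<theta> a b"] assms
    by (auto simp: filled_def)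
qed

text \<open>All cells serve as coordinates. A filled cell has the entry of \<open>P\<close> as its
  only possible value and hence the factor 1.\<close>

lemma completion_kraft:
  assumes F: "F \<subseteq> {L \<in> latin_squares n. P \<subseteq> L}" and \<sigma>: "\<sigma> permutes {1..n}" and \<theta>: "\<theta> permutes {1..n}"
  shows "(\<Sum>L\<in>F. \<Prod>(a, b)\<in>{1..n} \<times> {1..n}.
    if filled P (\<sigma> a) (\<theta> b) then 1 else 1 / real (card (choices n P L \<sigma> \<theta> a b))) \<le> 1"
proof -
  define J where "J = {1..n} \<times> {1..n}"
  define val where "val L j = (case j of (a, b) \<Rightarrow> THE s. (\<sigma> a, \<theta> b, s) \<in> L)" for L :: "hyperedge set" and j
  define A where "A L j = (case j of (a, b) \<Rightarrow> if filled P (\<sigma> a) (\<theta> b) then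
      {s. (\<sigma> a, \<theta> b, s) \<in> P} else choices n P L \<sigma> \<theta> a b)" for L j
  \<comment> \<open>Lexicographic rank: the base \<open>n + 1\<close> exceeds every
    \<open>b\<close>.\<close>
  define rk where "rk j = (case j of (a, b) \<Rightarrow> a * (n + 1) + b)" for j
  have rk_less: "rk (a', b') < rk (a, b) \<longleftrightarrow> a' < a \<or> a' = a \<and> b' < b"
    if "b \<in> {1..n}" "b' \<in> {1..n}" for a a' b b'
  proof -
    have "a' * (n + 1) + b' < a * (n + 1) + b" if "a' < a" "b' \<le> n" for a a' b b' :: nat
    proof -
      have "(a' + 1) * (n + 1) \<le> a * (n + 1)" using that by (intro mult_right_mono) auto
      thus ?thesis using that by simp
    qed
    from this[of a' a b' b] this[of a a' b b'] show ?thesis using that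
      by (cases a a' rule: linorder_cases) (auto simp: rk_def)
  qed
  have in1: "\<sigma> a \<in> {1..n}" "\<theta> a \<in> {1..n}" if "a \<in> {1..n}" for a
    using that \<sigma> \<theta> by (simp_all only: permutes_in_image)
  have val_iff: "(\<sigma> a, \<theta> b, s) \<in> L \<longleftrightarrow> s = val L (a, b)" if "L \<in> F" "a \<in> {1..n}" "b \<in> {1..n}" for L a b s
  proof -
    have "\<exists>!s. (\<sigma> a, \<theta> b, s) \<in> L" using F that in1 by (intro latin_square_ex1) auto
    thus ?thesis unfolding val_def prod.case by (metis (mono_tags, lifting) theI')
  qed
  have P_val: "s = val L (a, b)" if "L \<in> F" "a \<in> {1..n}" "b \<in> {1..n}" "(\<sigma> a, \<theta> b, s) \<in> P" for L a b s
    by (rule iffD1[OF val_iff[OF that(1-3)]]) (use F that in blast)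
  have A_card: "1 / real (card (A L (a, b))) = (if filled P (\<sigma> a) (\<theta> b) then 1
      else 1 / real (card (choices n P L \<sigma> \<theta> a b)))" if "L \<in> F" "a \<in> {1..n}" "b \<in> {1..n}" for L a b
  proof (cases "filled P (\<sigma> a) (\<theta> b)")
    case True
    then obtain s where s: "(\<sigma> a, \<theta> b, s) \<in> P" by (auto simp: filled_def)
    have "{s. (\<sigma> a, \<theta> b, s) \<in> P} = {s}"
    proof (intro equalityI subsetI)
      fix x assume "x \<in> {s. (\<sigma> a, \<theta> b, s) \<in> P}"
      hence "x = val L (a, b)" "s = val L (a, b)" using P_val[OF that] s by blast+
      thus "x \<in> {s}" by simp
    qed (use s in simp)
    thus ?thesis using True by (simp add: A_def)
  qed (simp add: A_def)
  have "(\<Sum>L\<in>F. \<Prod>j\<in>J. 1 / real (card (A L j))) \<le> 1"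
  proof (rule sequential_choice_kraft[where rk=rk and val=val])
    show "finite J" by (simp add: J_def)
    show "inj_on rk J"
    proof (rule inj_onI)
      fix j j' assume j: "j \<in> J" "j' \<in> J" "rk j = rk j'"
      obtain a b a' b' where jj: "j = (a, b)" "j' = (a', b')" by (cases j, cases j')
      show "j = j'" using j(1,2) rk_less[of b b' a' a] rk_less[of b' b a a'] j(3)
        unfolding jj J_def by (cases a a' rule: linorder_cases; cases b b' rule: linorder_cases) auto
    qed
    show "finite F" by (rule finite_subset[OF F]) (simp add: finite_latin_squares)
    fix L j assume L: "L \<in> F" "j \<in> J"
    obtain a b where j: "j = (a, b)" "a \<in> {1..n}" "b \<in> {1..n}" using L by (auto simp: J_def)
    have LS: "L \<in> latin_squares n" "P \<subseteq> L" using F L by auto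
    have in_L: "(\<sigma> a, \<theta> b, val L (a, b)) \<in> L" using val_iff[OF L(1) j(2,3)] by simp
    show "finite (A L j)"
    proof -
      have "{s. (\<sigma> a, \<theta> b, s) \<in> P} \<subseteq> {val L (a, b)}" by (intro subsetI) (use P_val[OF L(1) j(2,3)] in blast)
      hence "finite {s. (\<sigma> a, \<theta> b, s) \<in> P}" using finite_subset by blast
      thus ?thesis by (simp add: A_def j finite_choices)
    qed
    show "val L j \<in> A L j"
    proof (cases "filled P (\<sigma> a) (\<theta> b)")
      case True
      then obtain s where s: "(\<sigma> a, \<theta> b, s) \<in> P" by (auto simp: filled_def)
      hence "s = val L (a, b)" by (rule P_val[OF L(1) j(2,3)])
      thus ?thesis using s True by (simp add: A_def j)
    next
      case False
      thus ?thesis using latin_entry_in_choices[OF LS \<sigma> \<theta> j(2,3) False in_L]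
        by (simp add: A_def j)
    qed
  next
    fix L L' j assume L: "L \<in> F" "L' \<in> F" "j \<in> J"
      and eq: "\<And>j'. j' \<in> J \<Longrightarrow> rk j' < rk j \<Longrightarrow> val L j' = val L' j'"
    obtain a b where j: "j = (a, b)" "a \<in> {1..n}" "b \<in> {1..n}" using L by (auto simp: J_def)
    have entries: "(\<sigma> a', \<theta> b', s) \<in> L \<longleftrightarrow> (\<sigma> a', \<theta> b', s) \<in> L'"
      if "a' \<in> {1..n}" "b' \<in> {1..n}" "a' < a \<or> a' = a \<and> b' < b" for a' b' s
    proof -
      have "val L (a', b') = val L' (a', b')"
      proof (rule eq)
        show "(a', b') \<in> J" using that by (simp add: J_def)
        show "rk (a', b') < rk j" using rk_less[OF j(3) that(2), of a' a] that(3) by (simp only: j(1))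
      qed
      thus ?thesis using val_iff[OF L(1) that(1,2)] val_iff[OF L(2) that(1,2)] by simp
    qed
    have "earlier_entries n L \<sigma> \<theta> a b = earlier_entries n L' \<sigma> \<theta> a b"
      unfolding earlier_entries_def
      by (intro Collect_cong ex_cong1 conj_cong refl) (rule entries, assumption+)
    thus "A L j = A L' j" by (simp add: A_def j choices_def)
  next
    fix L L' assume L: "L \<in> F" "L' \<in> F" and eq: "\<And>j. j \<in> J \<Longrightarrow> val L j = val L' j"
    have "(r, c, s) \<in> L \<longleftrightarrow> (r, c, s) \<in> L'" if "r \<in> {1..n}" "c \<in> {1..n}" for r c s
    proof -
      have "r \<in> \<sigma> ` {1..n}" "c \<in> \<theta> ` {1..n}"
        using that by (simp_all only: permutes_image[OF \<sigma>] permutes_image[OF \<theta>])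
      then obtain a b where ab: "a \<in> {1..n}" "b \<in> {1..n}" "\<sigma> a = r" "\<theta> b = c" by blast
      have "val L (a, b) = val L' (a, b)" by (rule eq) (use ab in \<open>simp add: J_def\<close>)
      thus ?thesis using val_iff[OF L(1) ab(1,2), of s] val_iff[OF L(2) ab(1,2), of s] ab by simp
    qed
    moreover have "r \<in> {1..n}" "c \<in> {1..n}" if "(r, c, s) \<in> L \<or> (r, c, s) \<in> L'" for r c s
    proof -
      have "L \<in> latin_squares n" "L' \<in> latin_squares n" using L F by auto
      thus "r \<in> {1..n}" "c \<in> {1..n}" using that latin_square_mem_range by blast+
    qed
    ultimately have "t \<in> L \<longleftrightarrow> t \<in> L'" for t by (cases t) blast
    thus "L = L'" by blast
  qed
  also have "(\<Sum>L\<in>F. \<Prod>j\<in>J. 1 / real (card (A L j))) = (\<Sum>L\<in>F. \<Prod>(a, b)\<in>{1..n} \<times> {1..n}.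
    if filled P (\<sigma> a) (\<theta> b) then 1 else 1 / real (card (choices n P L \<sigma> \<theta> a b)))"
    unfolding J_def by (intro sum.cong prod.cong refl) (use A_card in auto)
  finally show ?thesis .
qed

lemma open_triples_antimono: "H \<subseteq> H' \<Longrightarrow> open_triples n H' \<subseteq> open_triples n H"
  by (auto simp: open_triples_def)

text \<open>A symbol \<open>s\<close> that is open at \<open>(r, c)\<close> and is not the entry of \<open>L\<close> there is still available exactly when
  both the row where \<open>L\<close> has \<open>s\<close> in column \<open>c\<close> and the column where \<open>L\<close> has \<open>s\<close> in row \<open>r\<close> come later.\<close>

lemma sum_card_choices_le:
  assumes L: "L \<in> latin_squares n" "P \<subseteq> L" and n: "n \<ge> 2"
    and ab: "a \<in> {1..n}" "b \<in> {1..n}" and rc: "r \<in> {1..n}" "c \<in> {1..n}" "\<not> filled P r c"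
  defines "d \<equiv> card {s. (r, c, s) \<in> open_triples n P}"
  shows "(\<Sum>\<sigma> | \<sigma> permutes {1..n} \<and> \<sigma> a = r. \<Sum>\<theta> | \<theta> permutes {1..n} \<and> \<theta> b = c.
      real (card (choices n P L \<sigma> \<theta> a b))) \<le>
    (fact (n - 1))\<^sup>2 * (1 + (real d - 1) * (real (n - a) * real (n - b) / (real (n - 1))\<^sup>2))"
proof -
  define D where "D = {s. (r, c, s) \<in> open_triples n P}"
  have finD: "finite D"
    by (rule finite_subset[of _ "{1..n}"]) (auto simp: D_def dest: open_triples_range)
  obtain s0 where s0: "(r, c, s0) \<in> L" "\<And>s. (r, c, s) \<in> L \<Longrightarrow> s = s0"
    using latin_square_ex1(1)[OF L(1) rc(1,2)] by blast
  have s0D: "s0 \<in> D"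
    using latin_square_open[OF L(1) s0(1) L(2)] rc(3) by (auto simp: D_def filled_def)
  define \<rho> where "\<rho> s = (THE x. (x, c, s) \<in> L)" for s
  define \<gamma> where "\<gamma> s = (THE y. (r, y, s) \<in> L)" for s
  have D_range: "s \<in> {1..n}" if "s \<in> D" for s
    using that open_triples_range(3) by (simp only: D_def mem_Collect_eq)
  have \<rho>: "(\<rho> s, c, s) \<in> L" if "s \<in> D" for s
    unfolding \<rho>_def by (rule theI'[OF latin_square_ex1(3)[OF L(1) rc(2) D_range[OF that]]])
  have \<gamma>: "(r, \<gamma> s, s) \<in> L" if "s \<in> D" for s
    unfolding \<gamma>_def by (rule theI'[OF latin_square_ex1(2)[OF L(1) rc(1) D_range[OF that]]])
  have \<rho>_range: "\<rho> s \<in> {1..n}" if "s \<in> D" for s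
    by (rule latin_square_mem_range[OF L(1) \<rho>[OF that]])
  have \<gamma>_range: "\<gamma> s \<in> {1..n}" if "s \<in> D" for s
    by (rule latin_square_mem_range[OF L(1) \<gamma>[OF that]])
  \<comment> \<open>By uniqueness of the entry \<open>s0\<close>, the triples of \<open>L\<close>
    that can block \<open>s\<close> lie in another row and in another column, as the count of
    permutations with two prescribed values requires.\<close>
  have ne: "\<rho> s \<noteq> r" "\<gamma> s \<noteq> c" if "s \<in> D" "s \<noteq> s0" for s
    using \<rho>[OF that(1)] \<gamma>[OF that(1)] s0(2)[of s] that(2) by auto
  define f where "f \<sigma> s = (of_bool (\<rho> s \<in> \<sigma> ` {a<..n}) :: real)" for \<sigma> s
  define g where "g \<theta> s = (of_bool (\<gamma> s \<in> \<theta> ` {b<..n}) :: real)" for \<theta> s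
  define \<Sigma>1 where "\<Sigma>1 = {\<sigma>. \<sigma> permutes {1..n} \<and> \<sigma> a = r}"
  define \<Sigma>2 where "\<Sigma>2 = {\<theta>. \<theta> permutes {1..n} \<and> \<theta> b = c}"
  have fin\<Sigma>: "finite \<Sigma>1" "finite \<Sigma>2"
    using finite_permutations[of "{1..n}"] unfolding \<Sigma>1_def \<Sigma>2_def by simp_all
  \<comment> \<open>The 1 stands for \<open>s0\<close>, which is never blocked; this is also why
    \<open>d - 1\<close> appears in the result.\<close>
  have bound: "real (card (choices n P L \<sigma> \<theta> a b)) \<le> 1 + (\<Sum>s\<in>D - {s0}. f \<sigma> s * g \<theta> s)"
    if \<sigma>: "\<sigma> \<in> \<Sigma>1" and \<theta>: "\<theta> \<in> \<Sigma>2" for \<sigma> \<theta>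
  proof -
    have perm: "\<sigma> ` {1..n} = {1..n}" "\<theta> ` {1..n} = {1..n}" and val: "\<sigma> a = r" "\<theta> b = c"
      using \<sigma> \<theta> by (auto simp only: \<Sigma>1_def \<Sigma>2_def mem_Collect_eq permutes_image)
    define C where "C = {s \<in> D - {s0}. \<rho> s \<in> \<sigma> ` {a<..n} \<and> \<gamma> s \<in> \<theta> ` {b<..n}}"
    have "choices n P L \<sigma> \<theta> a b \<subseteq> insert s0 C"
    proof (intro subsetI)
      fix s assume s: "s \<in> choices n P L \<sigma> \<theta> a b"
      hence op: "(r, c, s) \<in> open_triples n (P \<union> earlier_entries n L \<sigma> \<theta> a b)"
        by (simp add: choices_def val)
      hence sD: "s \<in> D" unfolding D_def using open_triples_antimono[of P] by blast
      show "s \<in> insert s0 C"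
      proof (cases "s = s0")
        case False
        have disj: "pairs (r, c, s) \<inter> pairs e = {}" if "e \<in> earlier_entries n L \<sigma> \<theta> a b" for e
          using op that unfolding open_triples_def by blast
        have "\<rho> s \<in> \<sigma> ` {a<..n}"
        proof (rule ccontr)
          assume late: "\<rho> s \<notin> \<sigma> ` {a<..n}"
          have "\<rho> s \<in> \<sigma> ` {1..n}" using \<rho>_range[OF sD] perm by simp
          then obtain a' where a': "a' \<in> {1..n}" "\<sigma> a' = \<rho> s" by (elim imageE) simp
          have "a' \<noteq> a" using a' val ne(1)[OF sD False] by auto
          moreover have "\<not> a < a'"
          proof
            assume "a < a'"
            hence "\<sigma> a' \<in> \<sigma> ` {a<..n}" using a'(1) by (intro imageI) simp
            thus False using late a'(2) by simp
          qed
          ultimately have "a' < a" by simp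
          hence "(\<sigma> a', \<theta> b, s) \<in> earlier_entries n L \<sigma> \<theta> a b"
            using a'(1) ab \<rho>[OF sD] unfolding earlier_entries_def mem_Collect_eq
            by (intro exI[of _ a'] exI[of _ b] exI[of _ s]) (simp add: a'(2) val)
          from disj[OF this] show False by (simp add: a' val)
        qed
        moreover have "\<gamma> s \<in> \<theta> ` {b<..n}"
        proof (rule ccontr)
          assume late: "\<gamma> s \<notin> \<theta> ` {b<..n}"
          have "\<gamma> s \<in> \<theta> ` {1..n}" using \<gamma>_range[OF sD] perm by simp
          then obtain b' where b': "b' \<in> {1..n}" "\<theta> b' = \<gamma> s" by (elim imageE) simp
          have "b' \<noteq> b" using b' val ne(2)[OF sD False] by auto
          moreover have "\<not> b < b'"
          proof
            assume "b < b'"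
            hence "\<theta> b' \<in> \<theta> ` {b<..n}" using b'(1) by (intro imageI) simp
            thus False using late b'(2) by simp
          qed
          ultimately have "b' < b" by simp
          hence "(\<sigma> a, \<theta> b', s) \<in> earlier_entries n L \<sigma> \<theta> a b"
            using b'(1) ab \<gamma>[OF sD] unfolding earlier_entries_def mem_Collect_eq
            by (intro exI[of _ a] exI[of _ b'] exI[of _ s]) (simp add: b'(2) val)
          from disj[OF this] show False by (simp add: b' val)
        qed
        ultimately show ?thesis using sD False by (simp add: C_def)
      qed simp
    qed
    moreover have "finite C" using finD by (simp add: C_def)
    ultimately have "card (choices n P L \<sigma> \<theta> a b) \<le> card (insert s0 C)"
      by (intro card_mono) auto
    also have "\<dots> = Suc (card C)" using \<open>finite C\<close> by (simp add: C_def)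
    finally have "card (choices n P L \<sigma> \<theta> a b) \<le> Suc (card C)" .
    moreover have "real (card C) = (\<Sum>s\<in>D - {s0}. f \<sigma> s * g \<theta> s)"
      using finD by (simp add: C_def f_def g_def Int_def flip: of_bool_conj)
    ultimately show ?thesis by linarith
  qed
  have card_D: "real (card (D - {s0})) = real d - 1"
  proof -
    have "card D > 0" using s0D finD by (auto simp: card_gt_0_iff)
    thus ?thesis using s0D finD by (simp add: d_def D_def[symmetric] of_nat_diff Suc_leI)
  qed
  have sum_f: "(\<Sum>\<sigma>\<in>\<Sigma>1. f \<sigma> s) = real (n - a) * fact (n - 2)" if "s \<in> D - {s0}" for s
  proof -
    have "(\<Sum>\<sigma>\<in>\<Sigma>1. f \<sigma> s) = real (card {\<sigma>. \<sigma> permutes {1..n} \<and> \<sigma> a = r \<and> \<rho> s \<in> \<sigma> ` {a<..n}})"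
      using fin\<Sigma> by (simp add: f_def \<Sigma>1_def Int_def conj_assoc)
    also have "card {\<sigma>. \<sigma> permutes {1..n} \<and> \<sigma> a = r \<and> \<rho> s \<in> \<sigma> ` {a<..n}} = (n - a) * fact (n - 2)"
      using that ne[of s] \<rho>_range[of s] by (intro card_permutes_later ab rc) auto
    finally show ?thesis by simp
  qed
  have sum_g: "(\<Sum>\<theta>\<in>\<Sigma>2. g \<theta> s) = real (n - b) * fact (n - 2)" if "s \<in> D - {s0}" for s
  proof -
    have "(\<Sum>\<theta>\<in>\<Sigma>2. g \<theta> s) = real (card {\<theta>. \<theta> permutes {1..n} \<and> \<theta> b = c \<and> \<gamma> s \<in> \<theta> ` {b<..n}})"
      using fin\<Sigma> by (simp add: g_def \<Sigma>2_def Int_def conj_assoc)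
    also have "card {\<theta>. \<theta> permutes {1..n} \<and> \<theta> b = c \<and> \<gamma> s \<in> \<theta> ` {b<..n}} = (n - b) * fact (n - 2)"
      using that ne[of s] \<gamma>_range[of s] by (intro card_permutes_later ab rc) auto
    finally show ?thesis by simp
  qed
  have card\<Sigma>: "card \<Sigma>1 = fact (n - 1)" "card \<Sigma>2 = fact (n - 1)"
    using card_permutes_value[of "{1..n}"] ab rc by (simp_all add: \<Sigma>1_def \<Sigma>2_def)
  have "(\<Sum>\<sigma>\<in>\<Sigma>1. \<Sum>\<theta>\<in>\<Sigma>2. real (card (choices n P L \<sigma> \<theta> a b))) \<le>
      (\<Sum>\<sigma>\<in>\<Sigma>1. \<Sum>\<theta>\<in>\<Sigma>2. 1 + (\<Sum>s\<in>D - {s0}. f \<sigma> s * g \<theta> s))"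
    by (intro sum_mono bound)
  also have "\<dots> = real (card \<Sigma>1) * real (card \<Sigma>2) + (\<Sum>\<sigma>\<in>\<Sigma>1. \<Sum>\<theta>\<in>\<Sigma>2. \<Sum>s\<in>D - {s0}. f \<sigma> s * g \<theta> s)"
    by (simp add: sum.distrib)
  also have "(\<Sum>\<sigma>\<in>\<Sigma>1. \<Sum>\<theta>\<in>\<Sigma>2. \<Sum>s\<in>D - {s0}. f \<sigma> s * g \<theta> s) =
      (\<Sum>s\<in>D - {s0}. \<Sum>\<sigma>\<in>\<Sigma>1. \<Sum>\<theta>\<in>\<Sigma>2. f \<sigma> s * g \<theta> s)"
    by (simp only: sum.swap[of _ "D - {s0}"])
  \<comment> \<open>The two orders vary independently, so each symbol contributes a product of a row
    count and a column count.\<close>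
  also have "\<dots> = (\<Sum>s\<in>D - {s0}. (\<Sum>\<sigma>\<in>\<Sigma>1. f \<sigma> s) * (\<Sum>\<theta>\<in>\<Sigma>2. g \<theta> s))"
    by (simp add: sum_product)
  also have "\<dots> = (\<Sum>s\<in>D - {s0}. (real (n - a) * fact (n - 2)) * (real (n - b) * fact (n - 2)))"
    by (intro sum.cong refl) (simp add: sum_f sum_g)
  also have "\<dots> = (real d - 1) * (real (n - a) * real (n - b) * (fact (n - 2))\<^sup>2)"
    by (simp add: card_D power2_eq_square mult_ac)
  also have "(fact (n - 2) :: real)\<^sup>2 = (fact (n - 1))\<^sup>2 / (real (n - 1))\<^sup>2"
  proof -
    have "n - 1 = Suc (n - 2)" using n by simp
    hence "(fact (n - 1) :: real) = real (n - 1) * fact (n - 2)" by (metis fact_Suc)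
    thus ?thesis using n by (simp add: power_mult_distrib)
  qed
  finally have "(\<Sum>\<sigma>\<in>\<Sigma>1. \<Sum>\<theta>\<in>\<Sigma>2. real (card (choices n P L \<sigma> \<theta> a b))) \<le>
      (fact (n - 1))\<^sup>2 * (1 + (real d - 1) * (real (n - a) * real (n - b) / (real (n - 1))\<^sup>2))"
    by (simp only: card\<Sigma> of_nat_fact) (simp add: power2_eq_square algebra_simps)
  thus ?thesis by (simp only: \<Sigma>1_def \<Sigma>2_def)
qed

section \<open>Moments of the number of remaining triangles\<close>

definition falling :: "nat \<Rightarrow> nat \<Rightarrow> nat" where
  "falling a m = (\<Prod>j<m. a - j)"

lemma falling_0 [simp]: "falling a 0 = 1"
  by (simp add: falling_def)

lemma falling_Suc: "falling a (Suc m) = falling a m * (a - m)"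
  by (simp add: falling_def)

lemma falling_Suc_left: "falling a (Suc m) = a * falling (a - 1) m"
  unfolding falling_def prod.lessThan_Suc_shift by simp

lemma falling_add: "falling a (m + k) = falling a m * falling (a - m) k"
  by (induction m arbitrary: a) (simp_all add: falling_Suc_left)

lemma falling_pos: "m \<le> a \<Longrightarrow> falling a m > 0"
  by (auto simp: falling_def)

lemma card_ordered_subsets_Suc:
  assumes "finite A"
  shows "card {xs \<in> ordered_subsets (Suc m) A. Q xs} =
    (\<Sum>x\<in>A. card {ys \<in> ordered_subsets m (A - {x}). Q (x # ys)})"
proof -
  have "{xs \<in> ordered_subsets (Suc m) A. Q xs} =
      (\<Union>x\<in>A. Cons x ` {ys \<in> ordered_subsets m (A - {x}). Q (x # ys)})"
    by (auto simp: ordered_subsets_def length_Suc_conv image_iff)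
  also have "card \<dots> = (\<Sum>x\<in>A. card (Cons x ` {ys \<in> ordered_subsets m (A - {x}). Q (x # ys)}))"
    using assms by (intro card_UN_disjoint) (auto simp: finite_ordered_subsets)
  also have "\<dots> = (\<Sum>x\<in>A. card {ys \<in> ordered_subsets m (A - {x}). Q (x # ys)})"
    by (intro sum.cong refl card_image) (simp add: inj_on_def)
  finally show ?thesis .
qed

text \<open>This includes \<open>m > card A\<close>, where truncated subtraction makes
  \<open>falling\<close> zero.\<close>

lemma card_ordered_subsets:
  "finite A \<Longrightarrow> card (ordered_subsets m A) = falling (card A) m"
proof (induction m arbitrary: A)
  case 0
  have "ordered_subsets 0 A = {[]}" by (auto simp: ordered_subsets_def)
  thus ?case by simp
next
  case (Suc m)
  have "card (ordered_subsets (Suc m) A) = (\<Sum>x\<in>A. card (ordered_subsets m (A - {x})))"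
    using card_ordered_subsets_Suc[OF Suc.prems, of m "\<lambda>_. True"] by simp
  also have "\<dots> = (\<Sum>x\<in>A. falling (card A - 1) m)"
    using Suc by (intro sum.cong refl) simp
  finally show ?case by (simp add: falling_Suc_left)
qed

text \<open>The first \<open>i\<close> entries are drawn from \<open>A - S\<close>, the other
  \<open>m - i\<close> from everything not yet used.\<close>

lemma card_ordered_subsets_avoiding:
  assumes "finite A" "S \<subseteq> A" "i \<le> m"
  shows "card {xs \<in> ordered_subsets m A. S \<inter> set (take i xs) = {}} =
    falling (card A - card S) i * falling (card A - i) (m - i)"
  using assms
proof (induction i arbitrary: m A)
  case 0
  thus ?case by (simp add: card_ordered_subsets)
next
  case (Suc i)
  then obtain k where k: "m = Suc k" "i \<le> k" by (cases m) auto
  have finS: "finite S" using Suc.prems finite_subset by blast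
  have "card {xs \<in> ordered_subsets m A. S \<inter> set (take (Suc i) xs) = {}} =
      (\<Sum>x\<in>A. card {ys \<in> ordered_subsets k (A - {x}). S \<inter> set (take (Suc i) (x # ys)) = {}})"
    unfolding k by (rule card_ordered_subsets_Suc) fact
  also have "\<dots> = (\<Sum>x\<in>A - S. card {ys \<in> ordered_subsets k (A - {x}). S \<inter> set (take (Suc i) (x # ys)) = {}})"
    using Suc.prems by (intro sum.mono_neutral_right) auto
  also have "\<dots> = (\<Sum>x\<in>A - S. falling (card A - 1 - card S) i * falling (card A - 1 - i) (k - i))"
  proof (intro sum.cong refl)
    fix x assume x: "x \<in> A - S"
    hence "{ys \<in> ordered_subsets k (A - {x}). S \<inter> set (take (Suc i) (x # ys)) = {}} =
        {ys \<in> ordered_subsets k (A - {x}). S \<inter> set (take i ys) = {}}" by auto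
    also have "card \<dots> = falling (card (A - {x}) - card S) i * falling (card (A - {x}) - i) (k - i)"
      using Suc.prems k x by (intro Suc.IH) auto
    finally show "card {ys \<in> ordered_subsets k (A - {x}). S \<inter> set (take (Suc i) (x # ys)) = {}} =
        falling (card A - 1 - card S) i * falling (card A - 1 - i) (k - i)"
      using x by simp
  qed
  also have "\<dots> = (card A - card S) * (falling (card A - 1 - card S) i * falling (card A - 1 - i) (k - i))"
    using Suc.prems finS by (simp add: card_Diff_subset)
  also have "\<dots> = falling (card A - card S) (Suc i) * falling (card A - Suc i) (m - Suc i)"
  proof -
    have "card A - 1 - card S = card A - card S - 1" "card A - 1 - i = card A - Suc i" "k - i = m - Suc i"
      using k by simp_all
    thus ?thesis unfolding falling_Suc_left by (simp only: mult.assoc)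
  qed
  finally show ?case .
qed

text \<open>The probability that the first \<open>i\<close> of \<open>N\<close> randomly ordered elements avoid a given set of
  size \<open>k\<close>.\<close>

definition avoid_prob :: "nat \<Rightarrow> nat \<Rightarrow> nat \<Rightarrow> real" where
  "avoid_prob N i k = real (falling (N - k) i) / real (falling N i)"

lemma avoid_prob_nonneg: "avoid_prob N i k \<ge> 0"
  by (simp add: avoid_prob_def)

lemma avoid_prob_0: "i \<le> N \<Longrightarrow> avoid_prob N i 0 = 1"
  using falling_pos[of i N] by (simp add: avoid_prob_def)

text \<open>The elements that must be avoided are placed one by one: the next one has to take one of
  the \<open>N - k - i\<close> late positions among the \<open>N - k\<close> free ones. Since this
  ratio decreases in \<open>k\<close>, both submultiplicativity and the power bound follow.\<close>

lemma avoid_prob_Suc: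
  assumes "k < N"
  shows "avoid_prob N i (Suc k) = avoid_prob N i k * (real (N - k - i) / real (N - k))"
proof -
  have "(N - k) * falling (N - Suc k) i = falling (N - k) i * (N - k - i)"
    using falling_Suc_left[of "N - k" i] falling_Suc[of "N - k" i] by simp
  hence "real (N - k) * real (falling (N - Suc k) i) = real (falling (N - k) i) * real (N - k - i)"
    by (metis of_nat_mult)
  moreover have "real (N - k) \<noteq> 0" using assms by simp
  ultimately have "real (falling (N - Suc k) i) = real (falling (N - k) i) * real (N - k - i) / real (N - k)"
    by (simp add: eq_divide_eq mult.commute)
  thus ?thesis by (simp add: avoid_prob_def)
qed

lemma avoid_ratio_antimono:
  fixes N i k l :: nat
  assumes "k \<le> l" "l < N"
  shows "real (N - l - i) / real (N - l) \<le> real (N - k - i) / real (N - k)"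
proof (cases "l + i \<le> N")
  case True
  have "real i / real (N - k) \<le> real i / real (N - l)"
    using assms by (intro divide_left_mono) auto
  moreover have "real (N - l - i) / real (N - l) = 1 - real i / real (N - l)"
    "real (N - k - i) / real (N - k) = 1 - real i / real (N - k)"
    using True assms by (simp_all add: of_nat_diff field_simps)
  ultimately show ?thesis by simp
next
  case False
  hence "N - l - i = 0" by simp
  thus ?thesis by simp
qed

lemma avoid_prob_submult:
  assumes "i \<le> N" "j + k \<le> N"
  shows "avoid_prob N i (j + k) \<le> avoid_prob N i j * avoid_prob N i k"
  using assms(2)
proof (induction j)
  case 0
  show ?case using assms(1) by (simp add: avoid_prob_0)
next
  case (Suc j)
  have "avoid_prob N i (Suc j + k) = avoid_prob N i (j + k) * (real (N - (j + k) - i) / real (N - (j + k)))"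
    using avoid_prob_Suc[of "j + k" N i] Suc.prems by simp
  also have "\<dots> \<le> (avoid_prob N i j * avoid_prob N i k) * (real (N - j - i) / real (N - j))"
    using Suc by (intro mult_mono avoid_ratio_antimono mult_nonneg_nonneg avoid_prob_nonneg) auto
  also have "\<dots> = avoid_prob N i (Suc j) * avoid_prob N i k"
    using avoid_prob_Suc[of j N i] Suc.prems by simp
  finally show ?case .
qed

lemma avoid_prob_le_power:
  assumes "i \<le> N" "k \<le> N"
  shows "avoid_prob N i k \<le> (real (N - i) / real N) ^ k"
  using assms(2)
proof (induction k)
  case 0
  show ?case using assms(1) by (simp add: avoid_prob_0)
next
  case (Suc k)
  have "avoid_prob N i (Suc k) = avoid_prob N i k * (real (N - k - i) / real (N - k))"
    using Suc.prems by (intro avoid_prob_Suc) simp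
  also have "\<dots> \<le> (real (N - i) / real N) ^ k * (real (N - i) / real N)"
    using Suc avoid_ratio_antimono[of 0 k N i]
    by (intro mult_mono avoid_prob_nonneg zero_le_power) auto
  finally show ?case by (simp add: mult.commute)
qed

lemma avoid_prob_le_1:
  assumes "i \<le> N" "k \<le> N"
  shows "avoid_prob N i k \<le> 1"
proof -
  have "real (N - i) / real N \<le> 1" by (simp add: divide_le_eq)
  hence "(real (N - i) / real N) ^ k \<le> 1" by (intro power_le_one) auto
  thus ?thesis using avoid_prob_le_power[OF assms] by linarith
qed

lemma card_avoiding_eq_prob:
  assumes "finite L" "S \<subseteq> L" "i \<le> m" "m \<le> card L"
  shows "real (card {xs \<in> ordered_subsets m L. S \<inter> set (take i xs) = {}}) =
    real (card (ordered_subsets m L)) * avoid_prob (card L) i (card S)"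
proof -
  have "falling (card L) m = falling (card L) i * falling (card L - i) (m - i)"
    using falling_add[of "card L" i "m - i"] assms by simp
  moreover have "falling (card L) i > 0" using assms by (intro falling_pos) simp
  ultimately show ?thesis
    using assms by (simp add: card_ordered_subsets_avoiding card_ordered_subsets avoid_prob_def)
qed

lemma sum_card_avoiding:
  assumes L: "finite L" and X: "finite X" "\<And>x. x \<in> X \<Longrightarrow> S x \<subseteq> L" and m: "i \<le> m" "m \<le> card L"
  shows "(\<Sum>xs\<in>ordered_subsets m L. real (card {x\<in>X. S x \<inter> set (take i xs) = {}})) =
    real (card (ordered_subsets m L)) * (\<Sum>x\<in>X. avoid_prob (card L) i (card (S x)))"
proof -
  have fin: "finite (ordered_subsets m L)" using L by (rule finite_ordered_subsets)
  have "(\<Sum>xs\<in>ordered_subsets m L. real (card {x\<in>X. S x \<inter> set (take i xs) = {}})) =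
      (\<Sum>xs\<in>ordered_subsets m L. \<Sum>x\<in>X. of_bool (S x \<inter> set (take i xs) = {}))"
    using X(1) by (simp add: Int_def)
  also have "\<dots> = (\<Sum>x\<in>X. \<Sum>xs\<in>ordered_subsets m L. of_bool (S x \<inter> set (take i xs) = {}))"
    by (rule sum.swap)
  also have "\<dots> = (\<Sum>x\<in>X. real (card {xs \<in> ordered_subsets m L. S x \<inter> set (take i xs) = {}}))"
    using fin by (simp add: Int_def)
  also have "\<dots> = (\<Sum>x\<in>X. real (card (ordered_subsets m L)) * avoid_prob (card L) i (card (S x)))"
    using X m by (intro sum.cong refl card_avoiding_eq_prob L) auto
  finally show ?thesis by (simp add: sum_distrib_left)
qed

text \<open>By \<open>avoid_prob_submult\<close>, the avoidance events of disjoint sets are negatively correlated, so only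
  intersecting pairs contribute to the variance.\<close>

lemma second_moment_card_avoiding:
  assumes L: "finite L" and X: "finite X" "\<And>x. x \<in> X \<Longrightarrow> S x \<subseteq> L" and m: "i \<le> m" "m \<le> card L"
  defines "T xs \<equiv> real (card {x\<in>X. S x \<inter> set (take i xs) = {}})"
  defines "\<mu> \<equiv> \<Sum>x\<in>X. avoid_prob (card L) i (card (S x))"
  shows "(\<Sum>xs\<in>ordered_subsets m L. (T xs - \<mu>)\<^sup>2) \<le>
    real (card (ordered_subsets m L)) * real (card {(x, y) \<in> X \<times> X. S x \<inter> S y \<noteq> {}})"
proof -
  define M where "M = real (card (ordered_subsets m L))"
  define p where "p k = avoid_prob (card L) i k" for k
  define D where "D = {(x, y) \<in> X \<times> X. S x \<inter> S y \<noteq> {}}"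
  \<comment> \<open>A squared count is a count of pairs, so the second moment is a first moment for
    the unions \<open>S x \<union> S y\<close>.\<close>
  have T2: "(T xs)\<^sup>2 = real (card {z\<in>X \<times> X. (case z of (x, y) \<Rightarrow> S x \<union> S y) \<inter> set (take i xs) = {}})" for xs
  proof -
    have "{z\<in>X \<times> X. (case z of (x, y) \<Rightarrow> S x \<union> S y) \<inter> set (take i xs) = {}} =
        {x\<in>X. S x \<inter> set (take i xs) = {}} \<times> {x\<in>X. S x \<inter> set (take i xs) = {}}"
      by auto
    thus ?thesis by (simp add: T_def power2_eq_square card_cartesian_product)
  qed
  have "(\<Sum>xs\<in>ordered_subsets m L. (T xs)\<^sup>2) = M * (\<Sum>z\<in>X \<times> X. p (card (case z of (x, y) \<Rightarrow> S x \<union> S y)))"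
    unfolding T2 M_def p_def using X by (intro sum_card_avoiding L m) auto
  also have "(\<Sum>z\<in>X \<times> X. p (card (case z of (x, y) \<Rightarrow> S x \<union> S y))) \<le>
      (\<Sum>z\<in>X \<times> X. p (card (S (fst z))) * p (card (S (snd z))) + of_bool (z \<in> D))"
  proof (intro sum_mono, clarify)
    fix x y assume xy: "x \<in> X" "y \<in> X"
    have sub: "S x \<subseteq> L" "S y \<subseteq> L" using X xy by auto
    have fin: "finite (S x)" "finite (S y)" using sub L finite_subset by blast+
    have le: "card (S x \<union> S y) \<le> card L" using sub L by (intro card_mono) auto
    show "p (card (S x \<union> S y)) \<le> p (card (S (fst (x, y)))) * p (card (S (snd (x, y)))) + of_bool ((x, y) \<in> D)"
    proof (cases "S x \<inter> S y = {}")
      case True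
      hence "card (S x \<union> S y) = card (S x) + card (S y)" using fin by (intro card_Un_disjoint)
      thus ?thesis using avoid_prob_submult[of i "card L" "card (S x)" "card (S y)"] m le
        by (simp add: p_def)
    next
      case False
      have "p (card (S x \<union> S y)) \<le> 1" unfolding p_def using m le by (intro avoid_prob_le_1) auto
      moreover have "p (card (S x)) * p (card (S y)) \<ge> 0" by (simp add: p_def avoid_prob_nonneg)
      ultimately show ?thesis using False xy by (simp add: D_def)
    qed
  qed
  also have "\<dots> = \<mu>\<^sup>2 + real (card D)"
  proof -
    have "D \<subseteq> X \<times> X" by (auto simp: D_def)
    hence "(\<Sum>z\<in>X \<times> X. of_bool (z \<in> D)) = real (card D)"
      using X(1) by (simp add: Int_absorb1)
    moreover have "(\<Sum>z\<in>X \<times> X. p (card (S (fst z))) * p (card (S (snd z)))) = \<mu>\<^sup>2"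
      by (simp add: \<mu>_def p_def power2_eq_square sum_product sum.cartesian_product case_prod_unfold)
    ultimately show ?thesis by (simp add: sum.distrib)
  qed
  finally have "(\<Sum>xs\<in>ordered_subsets m L. (T xs)\<^sup>2) \<le> M * (\<mu>\<^sup>2 + real (card D))"
    by (simp add: M_def mult_left_mono)
  moreover have "(\<Sum>xs\<in>ordered_subsets m L. T xs) = M * \<mu>"
    unfolding T_def M_def \<mu>_def by (intro sum_card_avoiding L X m)
  moreover have "(\<Sum>xs\<in>ordered_subsets m L. (T xs - \<mu>)\<^sup>2) =
      (\<Sum>xs\<in>ordered_subsets m L. (T xs)\<^sup>2) - 2 * \<mu> * (\<Sum>xs\<in>ordered_subsets m L. T xs) + M * \<mu>\<^sup>2"
    by (simp add: power2_diff sum.distrib sum_subtractf sum_distrib_left M_def algebra_simps)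
  ultimately show ?thesis
    by (simp add: M_def D_def algebra_simps power2_eq_square)
qed

text \<open>A substitute for Cauchy-Schwarz: \<open>2 * \<bar>y\<bar> * c \<le> y^2 + c^2\<close>
  for each deviation \<open>y\<close>, with \<open>c\<close> bounding the standard
  deviation.\<close>

lemma abs_deviation_le:
  fixes f :: "'a \<Rightarrow> real"
  assumes "(\<Sum>x\<in>A. (f x - \<mu>)\<^sup>2) \<le> real (card A) * c\<^sup>2" and "c > 0"
  shows "(\<Sum>x\<in>A. \<bar>f x - \<mu>\<bar>) \<le> real (card A) * c"
proof -
  have "(\<Sum>x\<in>A. \<bar>f x - \<mu>\<bar>) \<le> (\<Sum>x\<in>A. ((f x - \<mu>)\<^sup>2 / c + c) / 2)"
  proof (intro sum_mono)
    fix x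
    have "0 \<le> (\<bar>f x - \<mu>\<bar> - c)\<^sup>2" by simp
    hence "2 * \<bar>f x - \<mu>\<bar> * c \<le> (f x - \<mu>)\<^sup>2 + c\<^sup>2" by (simp add: power2_diff)
    thus "\<bar>f x - \<mu>\<bar> \<le> ((f x - \<mu>)\<^sup>2 / c + c) / 2"
      using \<open>c > 0\<close> by (simp add: field_simps power2_eq_square)
  qed
  also have "\<dots> = ((\<Sum>x\<in>A. (f x - \<mu>)\<^sup>2) / c + real (card A) * c) / 2"
    by (simp add: sum.distrib sum_divide_distrib[symmetric])
  also have "\<dots> \<le> (real (card A) * c\<^sup>2 / c + real (card A) * c) / 2"
    using assms by (intro divide_right_mono add_right_mono) auto
  also have "\<dots> = real (card A) * c" using \<open>c > 0\<close> by (simp add: power2_eq_square)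
  finally show ?thesis .
qed

text \<open>For \<open>H \<subseteq> L\<close>, a triple \<open>t\<close> survives the removal of
  \<open>H\<close> exactly when \<open>H\<close> misses this set; thus the number of open triples
  counts avoidance events.\<close>

definition touching :: "hyperedge set \<Rightarrow> hyperedge \<Rightarrow> hyperedge set" where
  "touching L t = {e \<in> L. pairs e \<inter> pairs t \<noteq> {}}"

lemma pairs_Int_iff:
  "pairs (r, c, s) \<inter> pairs (r', c', s') \<noteq> {} \<longleftrightarrow>
     r = r' \<and> c = c' \<or> r = r' \<and> s = s' \<or> c = c' \<and> s = s'"
  by (auto simp: doubleton_eq_iff)

lemma touching_latin:
  assumes L: "L \<in> latin_squares n" and "r \<in> {1..n}" "c \<in> {1..n}" "s \<in> {1..n}"
  obtains x y z where "(r, c, x) \<in> L" "(r, y, s) \<in> L" "(z, c, s) \<in> L"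
    "touching L (r, c, s) = {(r, c, x), (r, y, s), (z, c, s)}"
proof -
  obtain x where x: "(r, c, x) \<in> L" "\<And>x'. (r, c, x') \<in> L \<Longrightarrow> x' = x"
    using latin_square_ex1(1)[OF L assms(2,3)] by blast
  obtain y where y: "(r, y, s) \<in> L" "\<And>y'. (r, y', s) \<in> L \<Longrightarrow> y' = y"
    using latin_square_ex1(2)[OF L assms(2,4)] by blast
  obtain z where z: "(z, c, s) \<in> L" "\<And>z'. (z', c, s) \<in> L \<Longrightarrow> z' = z"
    using latin_square_ex1(3)[OF L assms(3,4)] by blast
  have "e \<in> touching L (r, c, s) \<longleftrightarrow> e \<in> {(r, c, x), (r, y, s), (z, c, s)}" for e
  proof
    assume "e \<in> touching L (r, c, s)"
    moreover obtain r' c' s' where e: "e = (r', c', s')" by (cases e)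
    ultimately have "(r', c', s') \<in> L" "r' = r \<and> c' = c \<or> r' = r \<and> s' = s \<or> c' = c \<and> s' = s"
      by (simp_all add: touching_def pairs_Int_iff del: pairs.simps)
    thus "e \<in> {(r, c, x), (r, y, s), (z, c, s)}"
      unfolding e using x(2)[of s'] y(2)[of c'] z(2)[of r'] by blast
  next
    assume "e \<in> {(r, c, x), (r, y, s), (z, c, s)}"
    thus "e \<in> touching L (r, c, s)"
      using x(1) y(1) z(1) pairs_Int_iff[of r c x r c s] pairs_Int_iff[of r y s r c s]
        pairs_Int_iff[of z c s r c s]
      unfolding touching_def by blast
  qed
  thus thesis using that[OF x(1) y(1) z(1)] by blast
qed

text \<open>Each of the three pairs of \<open>t\<close> lies in exactly one triple of
  \<open>L\<close>. These coincide with \<open>t\<close> if \<open>t\<close> is in \<open>L\<close>;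
  otherwise they are distinct, since a triple sharing two pairs with \<open>t\<close> equals
  \<open>t\<close>.\<close>

lemma card_touching:
  assumes L: "L \<in> latin_squares n" and t: "t \<in> all_triples n"
  shows "card (touching L t) = (if t \<in> L then 1 else 3)"
proof -
  obtain r c s where t': "t = (r, c, s)" "r \<in> {1..n}" "c \<in> {1..n}" "s \<in> {1..n}"
    using t by (auto simp: all_triples_def)
  obtain x y z where xyz: "(r, c, x) \<in> L" "(r, y, s) \<in> L" "(z, c, s) \<in> L"
    "touching L (r, c, s) = {(r, c, x), (r, y, s), (z, c, s)}"
    using touching_latin[OF L t'(2-4)] by blast
  show ?thesis
  proof (cases "t \<in> L")
    case True
    have "x = s" "y = c" "z = r"
      using True[unfolded t'(1)] xyz(1-3) latin_square_ex1(1)[OF L t'(2,3)]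
        latin_square_ex1(2)[OF L t'(2,4)] latin_square_ex1(3)[OF L t'(3,4)] by blast+
    thus ?thesis using True xyz(4) t'(1) by simp
  next
    case False
    hence "x \<noteq> s" "y \<noteq> c" "z \<noteq> r" using xyz t'(1) by auto
    thus ?thesis using False xyz(4) t'(1) by simp
  qed
qed

lemma open_triples_eq_avoiding:
  assumes "H \<subseteq> L"
  shows "open_triples n H = {t \<in> all_triples n. touching L t \<inter> H = {}}"
  using assms unfolding open_triples_def touching_def by blast

lemma card_touched_by_le: "card {t \<in> all_triples n. e \<in> touching L t} \<le> 3 * n"
proof -
  obtain r c s where e: "e = (r, c, s)" by (cases e)
  have "{t \<in> all_triples n. e \<in> touching L t} \<subseteq>
      (\<lambda>x. (r, c, x)) ` {1..n} \<union> (\<lambda>x. (r, x, s)) ` {1..n} \<union> (\<lambda>x. (x, c, s)) ` {1..n}"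
  proof
    fix t assume t: "t \<in> {t \<in> all_triples n. e \<in> touching L t}"
    obtain r' c' s' where t': "t = (r', c', s')" by (cases t)
    have "r = r' \<and> c = c' \<or> r = r' \<and> s = s' \<or> c = c' \<and> s = s'"
      using t by (simp add: t' e touching_def pairs_Int_iff del: pairs.simps)
    moreover have "r' \<in> {1..n}" "c' \<in> {1..n}" "s' \<in> {1..n}" using t t' by (auto simp: all_triples_def)
    ultimately show "t \<in> (\<lambda>x. (r, c, x)) ` {1..n} \<union> (\<lambda>x. (r, x, s)) ` {1..n} \<union> (\<lambda>x. (x, c, s)) ` {1..n}"
      unfolding t' by blast
  qed
  hence "card {t \<in> all_triples n. e \<in> touching L t} \<le>
      card ((\<lambda>x. (r, c, x)) ` {1..n} \<union> (\<lambda>x. (r, x, s)) ` {1..n} \<union> (\<lambda>x. (x, c, s)) ` {1..n})"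
    by (intro card_mono) auto
  also have "\<dots> \<le> card ((\<lambda>x. (r, c, x)) ` {1..n}) + card ((\<lambda>x. (r, x, s)) ` {1..n}) + card ((\<lambda>x. (x, c, s)) ` {1..n})"
    by (meson add_right_mono card_Un_le order_trans)
  also have "\<dots> \<le> n + n + n"
    by (intro add_mono order_trans[OF card_image_le]) auto
  finally show ?thesis by simp
qed

lemma card_all_triples: "card (all_triples n) = n ^ 3"
  by (simp add: all_triples_def card_cartesian_product power3_eq_cube)

text \<open>There are \<open>n^3\<close> choices of \<open>t\<close>, at most 3 triples of
  \<open>L\<close> touching it, and at most \<open>3 * n\<close> triples \<open>t'\<close> touched
  by each of those.\<close>

lemma card_intersecting_touching_le:
  assumes L: "L \<in> latin_squares n"
  shows "card {(t, t') \<in> all_triples n \<times> all_triples n. touching L t \<inter> touching L t' \<noteq> {}} \<le> 9 * n ^ 4"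
proof -
  let ?X = "all_triples n"
  have fin: "finite (touching L t)" for t
    using finite_latin_square[OF L] by (simp add: touching_def)
  have "{(t, t') \<in> ?X \<times> ?X. touching L t \<inter> touching L t' \<noteq> {}} =
      (\<Union>t\<in>?X. Pair t ` (\<Union>e\<in>touching L t. {t' \<in> ?X. e \<in> touching L t'}))"
    by auto
  also have "card \<dots> \<le> (\<Sum>t\<in>?X. card (Pair t ` (\<Union>e\<in>touching L t. {t' \<in> ?X. e \<in> touching L t'})))"
    by (rule card_UN_le[OF finite_all_triples])
  also have "\<dots> \<le> (\<Sum>t\<in>?X. 9 * n)"
  proof (rule sum_mono)
    fix t assume t: "t \<in> ?X"
    have "card (Pair t ` (\<Union>e\<in>touching L t. {t' \<in> ?X. e \<in> touching L t'})) \<le>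
        card (\<Union>e\<in>touching L t. {t' \<in> ?X. e \<in> touching L t'})"
      by (rule card_image_le) (use fin finite_all_triples in auto)
    also have "\<dots> \<le> (\<Sum>e\<in>touching L t. card {t' \<in> ?X. e \<in> touching L t'})"
      by (rule card_UN_le[OF fin])
    also have "\<dots> \<le> (\<Sum>e\<in>touching L t. 3 * n)" by (intro sum_mono card_touched_by_le)
    also have "\<dots> \<le> 9 * n" using card_touching[OF L t] by simp
    finally show "card (Pair t ` (\<Union>e\<in>touching L t. {t' \<in> ?X. e \<in> touching L t'})) \<le> 9 * n" .
  qed
  also have "\<dots> = 9 * n ^ 4" by (simp add: card_all_triples power3_eq_cube power4_eq_xxxx algebra_simps)
  finally show ?thesis .
qed

definition remaining_frac :: "nat \<Rightarrow> nat \<Rightarrow> real" where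
  "remaining_frac n i = real (n\<^sup>2 - i) / real (n\<^sup>2)"

text \<open>An upper bound for the expected number of triangles left after \<open>i\<close> random triples of a Latin
  square: the second summand comes from the triples of the square itself.\<close>

definition open_bound :: "nat \<Rightarrow> nat \<Rightarrow> real" where
  "open_bound n i = real n ^ 3 * remaining_frac n i ^ 3 + real n ^ 2 * remaining_frac n i"

text \<open>Absolute deviations from the mean are nonnegative, so their sum over \<open>V\<close> is
  at most the sum over all ordered subsets; this is how conditioning on \<open>U\<close> is handled.
  The value \<open>3 * n^2\<close> is the square root of the variance bound
  \<open>9 * n^4\<close>.\<close>

lemma sum_open_triples_excess:
  assumes L: "L \<in> latin_squares n" and m: "i \<le> m" "m \<le> n\<^sup>2" and V: "V \<subseteq> ordered_subsets m L" and "n > 0"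
  shows "(\<Sum>P\<in>V. real (card (open_triples n (set (take i P)))) - open_bound n i) \<le>
    real (card (ordered_subsets m L)) * (3 * real n ^ 2)"
proof -
  define X where "X = all_triples n"
  define q where "q t = avoid_prob (n\<^sup>2) i (card (touching L t))" for t
  define \<mu> where "\<mu> = (\<Sum>t\<in>X. q t)"
  define T where "T P = real (card {t\<in>X. touching L t \<inter> set (take i P) = {}})" for P
  have finL: "finite L" "card L = n\<^sup>2" using L by (simp_all add: finite_latin_square card_latin_square)
  have finX: "finite X" "card X = n ^ 3" by (simp_all add: X_def finite_all_triples card_all_triples)
  have LX: "L \<subseteq> X" using L latin_square_subset by (simp add: X_def)
  have x: "remaining_frac n i \<ge> 0" by (simp add: remaining_frac_def)
  have "\<mu> \<le> open_bound n i"
  proof -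
    have n3: "k \<le> n\<^sup>2" if "k = 1 \<or> n \<ge> 2 \<and> k = 3" for k
    proof (cases "k = 1")
      case True
      thus ?thesis using \<open>n > 0\<close> by (simp add: Suc_le_eq power2_eq_square)
    next
      case False
      have "2 * 2 \<le> n * n" by (intro mult_le_mono) (use False that in auto)
      thus ?thesis using that False by (simp add: power2_eq_square)
    qed
    have card_le: "card (touching L t) \<le> n\<^sup>2" for t
      using card_mono[of L "touching L t"] finL by (simp add: touching_def)
    have q_le: "q t \<le> (if t \<in> L then remaining_frac n i else remaining_frac n i ^ 3)" if "t \<in> X" for t
      using avoid_prob_le_power[of i "n\<^sup>2" "card (touching L t)"] card_le[of t] m that
        card_touching[OF L, of t] by (auto simp: q_def remaining_frac_def X_def)
    have "\<mu> \<le> (\<Sum>t\<in>X. if t \<in> L then remaining_frac n i else remaining_frac n i ^ 3)"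
      unfolding \<mu>_def by (intro sum_mono q_le)
    \<comment> \<open>Triples of \<open>L\<close> are given both summands, which makes the total
      exactly \<open>open_bound\<close>.\<close>
    also have "\<dots> \<le> (\<Sum>t\<in>X. remaining_frac n i * of_bool (t \<in> L) + remaining_frac n i ^ 3)"
      using x by (intro sum_mono) auto
    also have "\<dots> = open_bound n i"
      using finX finL LX by (simp add: sum.distrib Int_absorb1 open_bound_def flip: sum_distrib_left)
    finally show ?thesis .
  qed
  have "(\<Sum>P\<in>V. real (card (open_triples n (set (take i P)))) - open_bound n i) = (\<Sum>P\<in>V. T P - open_bound n i)"
  proof (rule sum.cong[OF refl])
    fix P assume "P \<in> V"
    hence "set (take i P) \<subseteq> L" using V set_take_subset[of i P] by (auto simp: ordered_subsets_def)
    from open_triples_eq_avoiding[OF this]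
    show "real (card (open_triples n (set (take i P)))) - open_bound n i = T P - open_bound n i"
      by (simp add: T_def X_def)
  qed
  also have "\<dots> \<le> (\<Sum>P\<in>V. \<bar>T P - \<mu>\<bar>)"
    using \<open>\<mu> \<le> open_bound n i\<close> by (intro sum_mono) auto
  also have "\<dots> \<le> (\<Sum>P\<in>ordered_subsets m L. \<bar>T P - \<mu>\<bar>)"
    using V finL by (intro sum_mono2 finite_ordered_subsets) auto
  also have "\<dots> \<le> real (card (ordered_subsets m L)) * (3 * real n ^ 2)"
  proof (rule abs_deviation_le)
    have "(\<Sum>P\<in>ordered_subsets m L. (T P - \<mu>)\<^sup>2) \<le> real (card (ordered_subsets m L)) *
        real (card {(t, t') \<in> X \<times> X. touching L t \<inter> touching L t' \<noteq> {}})"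
      unfolding T_def \<mu>_def q_def finL(2)[symmetric]
      by (rule second_moment_card_avoiding) (use finL finX m in \<open>auto simp: touching_def\<close>)
    also have "\<dots> \<le> real (card (ordered_subsets m L)) * real (9 * n ^ 4)"
      unfolding X_def by (intro mult_left_mono of_nat_mono card_intersecting_touching_le[OF L]) auto
    also have "real (9 * n ^ 4) = (3 * real n ^ 2)\<^sup>2" by (simp add: power2_eq_square eval_nat_numeral)
    finally show "(\<Sum>P\<in>ordered_subsets m L. (T P - \<mu>)\<^sup>2) \<le>
        real (card (ordered_subsets m L)) * (3 * real n ^ 2)\<^sup>2" .
  qed (use \<open>n > 0\<close> in simp)
  finally show ?thesis .
qed

text \<open>Choosing a set and then an order is uniform on \<open>ordered_subsets\<close>: every
  list comes from one set, and every set has \<open>fact m\<close> orders.\<close>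

lemma prob_random_ordered_subset:
  assumes "finite L" "m \<le> card L"
  shows "measure_pmf.prob (random_ordered_subset m L) U =
    real (card (U \<inter> ordered_subsets m L)) / real (card (ordered_subsets m L))"
proof -
  define C where "C = {S. S \<subseteq> L \<and> card S = m}"
  have finC: "finite C" using assms by (auto simp: C_def)
  have cardC: "card C = card L choose m" unfolding C_def using assms by (rule_tac n_subsets) auto
  hence C0: "C \<noteq> {}" using assms by (metis card.empty zero_less_binomial less_irrefl)
  have perm: "finite (permutations_of_set S)" "card (permutations_of_set S) = fact m"
    "permutations_of_set S \<noteq> {}" if "S \<in> C" for S
  proof -
    have "finite S" "card S = m" using that assms finite_subset by (auto simp: C_def)
    thus "finite (permutations_of_set S)" "card (permutations_of_set S) = fact m"
      "permutations_of_set S \<noteq> {}" by (auto simp: card_permutations_of_set)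
  qed
  have fact_choose: "card (ordered_subsets m L) = card C * fact m"
  proof -
    have "ordered_subsets m L = (\<Union>S\<in>C. permutations_of_set S)"
      by (auto simp: ordered_subsets_def C_def permutations_of_set_def distinct_card)
    also have "card \<dots> = (\<Sum>S\<in>C. card (permutations_of_set S))"
      by (intro card_UN_disjoint finC ballI impI perm) (auto simp: permutations_of_set_def)
    finally show ?thesis using perm by simp
  qed
  have eq: "random_ordered_subset m L = pmf_of_set (ordered_subsets m L)"
  proof (rule pmf_eqI)
    fix xs
    have "pmf (random_ordered_subset m L) xs = (\<Sum>S\<in>C. pmf (pmf_of_set (permutations_of_set S)) xs) / real (card C)"
      unfolding random_ordered_subset_def C_def[symmetric] by (rule pmf_bind_pmf_of_set[OF C0 finC])
    also have "(\<Sum>S\<in>C. pmf (pmf_of_set (permutations_of_set S)) xs) =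
        (\<Sum>S\<in>C. if S = set xs then of_bool (distinct xs) / fact m else 0)"
      using perm by (intro sum.cong refl) (auto simp: permutations_of_set_def indicator_def)
    also have "\<dots> = of_bool (set xs \<in> C \<and> distinct xs) / fact m"
      using finC by (simp add: sum.delta)
    also have "set xs \<in> C \<and> distinct xs \<longleftrightarrow> xs \<in> ordered_subsets m L"
      by (auto simp: C_def ordered_subsets_def distinct_card)
    finally show "pmf (random_ordered_subset m L) xs = pmf (pmf_of_set (ordered_subsets m L)) xs"
      using fact_choose C0 finC finite_ordered_subsets[OF assms(1), of m]
      by (subst pmf_of_set) (auto simp: indicator_def card_gt_0_iff field_simps)
  qed
  have "card (ordered_subsets m L) > 0"
    unfolding fact_choose using C0 finC by (simp add: card_gt_0_iff)
  thus ?thesis unfolding eq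
    by (subst measure_pmf_of_set) (auto simp: card_gt_0_iff Int_commute)
qed

text \<open>The graph of \<open>ln\<close> lies below its tangent at \<open>l\<close>; so a
  reciprocal count is bounded below by an exponential whose exponent is linear in the count.\<close>

lemma exp_neg_tangent_le:
  fixes t l :: real
  assumes "t > 0" "l > 0"
  shows "exp (- (ln l + (t / l - 1))) \<le> 1 / t"
proof -
  have "ln (t / l) \<le> t / l - 1" using assms by (intro ln_le_minus_one) simp
  hence "ln t \<le> ln l + (t / l - 1)" using assms by (simp add: ln_div)
  hence "exp (- (ln l + (t / l - 1))) \<le> exp (- ln t)" by simp
  also have "\<dots> = 1 / t" using assms by (simp add: exp_minus inverse_eq_divide)
  finally show ?thesis .
qed

text \<open>Jensen's inequality, obtained from the tangent of \<open>exp\<close> at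
  \<open>-B\<close>. An empty \<open>A\<close> is covered.\<close>

lemma sum_exp_neg_ge:
  fixes f :: "'a \<Rightarrow> real"
  assumes "(\<Sum>x\<in>A. f x) \<le> real (card A) * B"
  shows "real (card A) * exp (- B) \<le> (\<Sum>x\<in>A. exp (- f x))"
proof -
  have "real (card A) * exp (- B) \<le> exp (- B) * (real (card A) * (1 + B) - (\<Sum>x\<in>A. f x))"
    using assms by (simp add: algebra_simps mult_left_mono)
  also have "\<dots> = (\<Sum>x\<in>A. exp (- B) * (1 + (B - f x)))"
    by (simp only: sum_distrib_left[symmetric] sum.distrib sum_subtractf) (simp add: algebra_simps)
  also have "\<dots> \<le> (\<Sum>x\<in>A. exp (- B) * exp (B - f x))"
    by (intro sum_mono mult_left_mono exp_ge_add_one_self) auto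
  also have "\<dots> = (\<Sum>x\<in>A. exp (- f x))" by (simp flip: exp_add)
  finally show ?thesis .
qed

section \<open>Comparison of random Latin squares and the removal process\<close>

lemma sum_permutes_by_value:
  fixes f :: "(nat \<Rightarrow> nat) \<Rightarrow> real"
  assumes "a \<in> {1..n}"
  shows "(\<Sum>p | p permutes {1..n}. f p) = (\<Sum>r\<in>{1..n}. \<Sum>p | p permutes {1..n} \<and> p a = r. f p)"
proof -
  have "(\<Sum>r\<in>{1..n}. \<Sum>p | p \<in> {p. p permutes {1..n}} \<and> p a = r. f p) = (\<Sum>p | p permutes {1..n}. f p)"
  proof (rule sum.group)
    show "finite {p. p permutes {1..n}}" by (rule finite_permutations) simp
    show "(\<lambda>p. p a) ` {p. p permutes {1..n}} \<subseteq> {1..n}"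
    proof (intro image_subsetI)
      fix p assume "p \<in> {p. p permutes {1..n}}"
      hence "p permutes {1..n}" by simp
      from permutes_in_image[OF this] show "p a \<in> {1..n}" using assms by blast
    qed
  qed simp
  thus ?thesis by simp
qed

lemma card_unfilled:
  assumes L: "L \<in> latin_squares n" and P: "P \<subseteq> L" "card P = m"
  shows "card {rc \<in> {1..n} \<times> {1..n}. \<not> filled P (fst rc) (snd rc)} = n\<^sup>2 - m"
proof -
  define h :: "hyperedge \<Rightarrow> nat \<times> nat" where "h = (\<lambda>(r, c, s). (r, c))"
  have "inj_on h P"
  proof (rule inj_onI)
    fix e e' assume e: "e \<in> P" "e' \<in> P" "h e = h e'"
    obtain r c s s' where rcs: "e = (r, c, s)" "e' = (r, c, s')"
      using e(3) by (cases e, cases e') (simp add: h_def)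
    have "r \<in> {1..n}" "c \<in> {1..n}" using latin_square_mem_range[OF L, of r c s] e P rcs by auto
    hence "s = s'" using latin_square_ex1(1)[OF L] e(1,2) P(1) rcs by blast
    thus "e = e'" by (simp add: rcs)
  qed
  hence card: "card (h ` P) = m" using P(2) by (simp add: card_image)
  have "h ` P \<subseteq> {1..n} \<times> {1..n}"
    using P(1) latin_square_mem_range[OF L] by (fastforce simp: h_def)
  moreover have "{rc \<in> {1..n} \<times> {1..n}. \<not> filled P (fst rc) (snd rc)} = {1..n} \<times> {1..n} - h ` P"
    by (force simp: filled_def h_def)
  ultimately show ?thesis
    using card finite_subset[OF \<open>h ` P \<subseteq> _\<close>] by (simp add: card_Diff_subset power2_eq_square)
qed

text \<open>Filled cells can be left out because their row-column pair is already used.\<close>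

lemma sum_card_open_cells:
  "(\<Sum>rc\<in>{rc \<in> {1..n} \<times> {1..n}. \<not> filled P (fst rc) (snd rc)}.
      card {s. (fst rc, snd rc, s) \<in> open_triples n P}) = card (open_triples n P)"
proof -
  let ?Z = "{rc \<in> {1..n} \<times> {1..n}. \<not> filled P (fst rc) (snd rc)}"
  define D where "D rc = {s. (fst rc, snd rc, s) \<in> open_triples n P}" for rc
  have finD: "finite (D rc)" for rc
    by (rule finite_subset[of _ "{1..n}"]) (auto simp: D_def dest: open_triples_range)
  have "bij_betw (\<lambda>(rc, s). (fst rc, snd rc, s)) (Sigma ?Z D) (open_triples n P)"
  proof (rule bij_betwI[where g="\<lambda>(r, c, s). ((r, c), s)"])
    show "(\<lambda>(r, c, s). ((r, c), s)) \<in> open_triples n P \<rightarrow> Sigma ?Z D"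
    proof (rule Pi_I)
      fix t assume t': "t \<in> open_triples n P"
      obtain r c s where rcs: "t = (r, c, s)" by (cases t)
      have t: "(r, c, s) \<in> open_triples n P" using t' rcs by simp
      have "\<not> filled P r c"
      proof
        assume "filled P r c"
        then obtain s' where "(r, c, s') \<in> P" by (auto simp: filled_def)
        hence "pairs (r, c, s) \<inter> pairs (r, c, s') = {}" using t unfolding open_triples_def by blast
        thus False using pairs_Int_iff[of r c s r c s'] by simp
      qed
      moreover have "r \<in> {1..n}" "c \<in> {1..n}" using open_triples_range[OF t] by blast+
      ultimately show "(\<lambda>(r, c, s). ((r, c), s)) t \<in> Sigma ?Z D"
        using t by (simp add: rcs D_def)
    qed
  qed (auto simp: D_def)
  hence "card (open_triples n P) = card (Sigma ?Z D)" by (simp add: bij_betw_same_card)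
  also have "\<dots> = (\<Sum>rc\<in>?Z. card (D rc))" by (rule card_SigmaI) (use finD in auto)
  finally show ?thesis by (simp add: D_def)
qed

text \<open>The probability that a given other row and a given other column come after the positions
  \<open>a\<close> and \<open>b\<close> in independent random orders; see
  \<open>card_permutes_later\<close>.\<close>

definition later_frac :: "nat \<Rightarrow> nat \<Rightarrow> nat \<Rightarrow> real" where
  "later_frac n a b = real (n - a) * real (n - b) / (real (n - 1))\<^sup>2"

lemma later_frac_bounds:
  assumes "n \<ge> 2" "a \<in> {1..n}" "b \<in> {1..n}"
  shows "0 \<le> later_frac n a b" "later_frac n a b \<le> 1"
proof -
  show "0 \<le> later_frac n a b" by (simp add: later_frac_def)
  have "real (n - a) * real (n - b) \<le> real (n - 1) * real (n - 1)"
    using assms by (intro mult_mono) auto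
  thus "later_frac n a b \<le> 1" using assms by (simp add: later_frac_def power2_eq_square divide_le_eq)
qed

text \<open>Each cell is at position \<open>(a, b)\<close> for \<open>((n - 1)!)^2\<close> pairs of
  orders, and the open symbols of all unfilled cells add up to the open triples of \<open>P\<close>.
  So the bound involves only their total number. The constant \<open>y\<close> will be the part of
  the tangent that is independent of the count.\<close>

lemma sum_unfilled_cell_le:
  assumes L: "L \<in> latin_squares n" and P: "P \<subseteq> L" "card P = m" and n: "n \<ge> 2" and m: "m \<le> n\<^sup>2"
    and ab: "a \<in> {1..n}" "b \<in> {1..n}" and "\<Lambda> > 0"
  defines "M \<equiv> real (n\<^sup>2 - m)"
  shows "(\<Sum>\<sigma> | \<sigma> permutes {1..n}. \<Sum>\<theta> | \<theta> permutes {1..n}.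
      if filled P (\<sigma> a) (\<theta> b) then 0 else y + real (card (choices n P L \<sigma> \<theta> a b)) / \<Lambda>) \<le>
    (fact (n - 1))\<^sup>2 * (M * y + (M + (real (card (open_triples n P)) - M) * later_frac n a b) / \<Lambda>)"
proof -
  define \<Sigma>1 where "\<Sigma>1 r = {\<sigma>. \<sigma> permutes {1..n} \<and> \<sigma> a = r}" for r
  define \<Sigma>2 where "\<Sigma>2 c = {\<theta>. \<theta> permutes {1..n} \<and> \<theta> b = c}" for c
  define N where "N \<sigma> \<theta> = real (card (choices n P L \<sigma> \<theta> a b))" for \<sigma> \<theta>
  define Z where "Z = {rc \<in> {1..n} \<times> {1..n}. \<not> filled P (fst rc) (snd rc)}"
  define d where "d rc = real (card {s. (fst rc, snd rc, s) \<in> open_triples n P})" for rc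
  define F where "F = (fact (n - 1) :: real)\<^sup>2"
  have card\<Sigma>: "card (\<Sigma>1 r) = fact (n - 1)" "card (\<Sigma>2 r) = fact (n - 1)" if "r \<in> {1..n}" for r
    using card_permutes_value[of "{1..n}"] ab that by (simp_all add: \<Sigma>1_def \<Sigma>2_def)
  have "(\<Sum>\<sigma> | \<sigma> permutes {1..n}. \<Sum>\<theta> | \<theta> permutes {1..n}. if filled P (\<sigma> a) (\<theta> b) then 0 else y + N \<sigma> \<theta> / \<Lambda>) =
      (\<Sum>r\<in>{1..n}. \<Sum>\<sigma>\<in>\<Sigma>1 r. \<Sum>c\<in>{1..n}. \<Sum>\<theta>\<in>\<Sigma>2 c. if filled P (\<sigma> a) (\<theta> b) then 0 else y + N \<sigma> \<theta> / \<Lambda>)"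
    unfolding \<Sigma>1_def \<Sigma>2_def
    by (subst sum_permutes_by_value[OF ab(1)]) (intro sum.cong refl sum_permutes_by_value ab(2))
  also have "\<dots> = (\<Sum>r\<in>{1..n}. \<Sum>c\<in>{1..n}. \<Sum>\<sigma>\<in>\<Sigma>1 r. \<Sum>\<theta>\<in>\<Sigma>2 c. if filled P (\<sigma> a) (\<theta> b) then 0 else y + N \<sigma> \<theta> / \<Lambda>)"
    by (intro sum.cong refl sum.swap)
  also have "\<dots> = (\<Sum>r\<in>{1..n}. \<Sum>c\<in>{1..n}. \<Sum>\<sigma>\<in>\<Sigma>1 r. \<Sum>\<theta>\<in>\<Sigma>2 c. if filled P r c then 0 else y + N \<sigma> \<theta> / \<Lambda>)"
    by (intro sum.cong refl) (simp add: \<Sigma>1_def \<Sigma>2_def)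
  also have "\<dots> = (\<Sum>rc\<in>{1..n} \<times> {1..n}. if filled P (fst rc) (snd rc) then 0 else
      \<Sum>\<sigma>\<in>\<Sigma>1 (fst rc). \<Sum>\<theta>\<in>\<Sigma>2 (snd rc). y + N \<sigma> \<theta> / \<Lambda>)"
    unfolding sum.cartesian_product by (intro sum.cong refl) auto
  also have "\<dots> = (\<Sum>rc\<in>Z. \<Sum>\<sigma>\<in>\<Sigma>1 (fst rc). \<Sum>\<theta>\<in>\<Sigma>2 (snd rc). y + N \<sigma> \<theta> / \<Lambda>)"
    unfolding Z_def by (subst sum.inter_filter) (auto intro: sum.cong)
  also have "\<dots> \<le> (\<Sum>rc\<in>Z. F * y + F * (1 + (d rc - 1) * later_frac n a b) / \<Lambda>)"
  proof (rule sum_mono)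
    fix rc assume rc: "rc \<in> Z"
    hence rc': "fst rc \<in> {1..n}" "snd rc \<in> {1..n}" "\<not> filled P (fst rc) (snd rc)" by (auto simp: Z_def)
    have "(\<Sum>\<sigma>\<in>\<Sigma>1 (fst rc). \<Sum>\<theta>\<in>\<Sigma>2 (snd rc). N \<sigma> \<theta>) \<le> F * (1 + (d rc - 1) * later_frac n a b)"
      unfolding \<Sigma>1_def \<Sigma>2_def N_def F_def d_def later_frac_def
      by (rule sum_card_choices_le[OF L P(1) n ab rc'])
    hence "(\<Sum>\<sigma>\<in>\<Sigma>1 (fst rc). \<Sum>\<theta>\<in>\<Sigma>2 (snd rc). N \<sigma> \<theta>) / \<Lambda> \<le> F * (1 + (d rc - 1) * later_frac n a b) / \<Lambda>"
      using \<open>\<Lambda> > 0\<close> by (intro divide_right_mono) auto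
    moreover have "(\<Sum>\<sigma>\<in>\<Sigma>1 (fst rc). \<Sum>\<theta>\<in>\<Sigma>2 (snd rc). y + N \<sigma> \<theta> / \<Lambda>) =
        F * y + (\<Sum>\<sigma>\<in>\<Sigma>1 (fst rc). \<Sum>\<theta>\<in>\<Sigma>2 (snd rc). N \<sigma> \<theta>) / \<Lambda>"
      using card\<Sigma>[OF rc'(1)] card\<Sigma>[OF rc'(2)]
      by (simp add: sum.distrib sum_divide_distrib F_def power2_eq_square)
    ultimately show "(\<Sum>\<sigma>\<in>\<Sigma>1 (fst rc). \<Sum>\<theta>\<in>\<Sigma>2 (snd rc). y + N \<sigma> \<theta> / \<Lambda>)
        \<le> F * y + F * (1 + (d rc - 1) * later_frac n a b) / \<Lambda>" by linarith
  qed
  also have "\<dots> = F * (real (card Z) * y + (real (card Z) + ((\<Sum>rc\<in>Z. d rc) - real (card Z)) * later_frac n a b) / \<Lambda>)"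
    using \<open>\<Lambda> > 0\<close>
    by (simp add: sum.distrib sum_subtractf field_simps flip: sum_distrib_left sum_distrib_right sum_divide_distrib)
  also have "card Z = n\<^sup>2 - m" unfolding Z_def by (rule card_unfilled[OF L P])
  also have "(\<Sum>rc\<in>Z. d rc) = real (card (open_triples n P))"
    unfolding Z_def d_def using sum_card_open_cells[of n P] by (simp flip: of_nat_sum)
  finally show ?thesis by (simp only: M_def N_def F_def)
qed

text \<open>The typical number of choices. If \<open>P\<close> leaves \<open>open_bound n m\<close>
  open triples, an unfilled cell has \<open>1 + n * x^2\<close> open symbols on average, where
  \<open>x = remaining_frac n m\<close>; one is the entry of \<open>L\<close>, and the others remain
  available with probability \<open>later_frac\<close>.\<close>

definition cell_bound :: "nat \<Rightarrow> nat \<Rightarrow> nat \<Rightarrow> nat \<Rightarrow> real" where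
  "cell_bound n m a b = 1 + real n * remaining_frac n m ^ 2 * later_frac n a b"

definition log_bound :: "nat \<Rightarrow> nat \<Rightarrow> real" where
  "log_bound n m = (\<Sum>i<m. ln (open_bound n i)) +
     remaining_frac n m * (\<Sum>a\<in>{1..n}. \<Sum>b\<in>{1..n}. ln (cell_bound n m a b))"

text \<open>The deviation \<open>3 * n^2\<close> of the number of open triples times bounds for the
  slopes of the tangents. Only this part of the estimate is multiplied by
  \<open>1 / \<rho>\<close>.\<close>

definition log_error :: "nat \<Rightarrow> nat \<Rightarrow> real" where
  "log_error n m = (\<Sum>i<m. 3 * real n ^ 2 / open_bound n i) +
     3 * real n ^ 2 / (1 + real n * remaining_frac n m ^ 2)"

text \<open>The logarithms of the numbers of choices are replaced by their tangents \<open>ln y \<le> ln l + (y / l - 1)\<close> at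
  the typical values, so that expectations can be taken term by term.\<close>

definition weight_exponent ::
    "nat \<Rightarrow> nat \<Rightarrow> hyperedge set \<Rightarrow> hyperedge list \<Rightarrow> (nat \<Rightarrow> nat) \<Rightarrow> (nat \<Rightarrow> nat) \<Rightarrow> real" where
  "weight_exponent n m L P \<sigma> \<theta> =
     (\<Sum>i<m. ln (open_bound n i) + (real (card (open_triples n (set (take i P)))) / open_bound n i - 1)) +
     (\<Sum>a\<in>{1..n}. \<Sum>b\<in>{1..n}. if filled (set P) (\<sigma> a) (\<theta> b) then 0 else
        (ln (cell_bound n m a b) - 1) + real (card (choices n (set P) L \<sigma> \<theta> a b)) / cell_bound n m a b)"

lemma remaining_frac_pos: "i < n\<^sup>2 \<Longrightarrow> remaining_frac n i > 0"
  unfolding remaining_frac_def by (cases n) (auto intro!: divide_pos_pos simp del: of_nat_power)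

lemma open_bound_pos: "i < n\<^sup>2 \<Longrightarrow> open_bound n i > 0"
  unfolding open_bound_def using remaining_frac_pos[of i n]
  by (intro add_pos_pos mult_pos_pos zero_less_power) (auto intro!: Nat.gr0I)

lemma cell_bound_pos: "cell_bound n m a b > 0"
  by (simp add: cell_bound_def later_frac_def add_pos_nonneg)

text \<open>\<open>cell_bound\<close> is chosen so that
  \<open>M * \<Lambda> = M + (open_bound n m - M) * k\<close>. Therefore the linear parts of the
  tangents cancel up to a multiple of the excess of open triples, which
  \<open>sum_open_triples_excess\<close> controls.\<close>

lemma sum_unfilled_cell_deviation_le:
  assumes L: "L \<in> latin_squares n" and n: "n \<ge> 2" and m: "m < n\<^sup>2"
    and V: "V \<subseteq> ordered_subsets m L" and ab: "a \<in> {1..n}" "b \<in> {1..n}"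
  defines "Perms \<equiv> {p. p permutes {1..n}}"
  shows "(\<Sum>P\<in>V. \<Sum>\<sigma>\<in>Perms. \<Sum>\<theta>\<in>Perms. if filled (set P) (\<sigma> a) (\<theta> b) then 0 else
        (ln (cell_bound n m a b) - 1) + real (card (choices n (set P) L \<sigma> \<theta> a b)) / cell_bound n m a b) \<le>
    (fact (n - 1))\<^sup>2 * (real (card V) * real (n\<^sup>2 - m) * ln (cell_bound n m a b) +
      real (card (ordered_subsets m L)) * (3 * real n ^ 2 / (1 + real n * remaining_frac n m ^ 2)))"
proof -
  define M where "M = real (n\<^sup>2 - m)"
  define \<Lambda> where "\<Lambda> = cell_bound n m a b"
  define k where "k = later_frac n a b"
  define x where "x = remaining_frac n m"
  define F where "F = (fact (n - 1) :: real)\<^sup>2"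
  define E where "E = real (card (ordered_subsets m L)) * (3 * real n ^ 2)"
  define T where "T P = real (card (open_triples n (set P)))" for P
  have \<Lambda>: "\<Lambda> > 0" by (simp add: \<Lambda>_def cell_bound_pos)
  have k: "0 \<le> k" "k \<le> 1" using later_frac_bounds[OF n ab] by (simp_all add: k_def)
  have "(\<Sum>P\<in>V. \<Sum>\<sigma>\<in>Perms. \<Sum>\<theta>\<in>Perms. if filled (set P) (\<sigma> a) (\<theta> b) then 0 else
        (ln \<Lambda> - 1) + real (card (choices n (set P) L \<sigma> \<theta> a b)) / \<Lambda>) \<le>
      (\<Sum>P\<in>V. F * (M * (ln \<Lambda> - 1) + (M + (T P - M) * k) / \<Lambda>))"
  proof (rule sum_mono)
    fix P assume P: "P \<in> V"
    hence "set P \<subseteq> L" "card (set P) = m" using V by (auto simp: ordered_subsets_def distinct_card)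
    thus "(\<Sum>\<sigma>\<in>Perms. \<Sum>\<theta>\<in>Perms. if filled (set P) (\<sigma> a) (\<theta> b) then 0 else
        (ln \<Lambda> - 1) + real (card (choices n (set P) L \<sigma> \<theta> a b)) / \<Lambda>) \<le>
        F * (M * (ln \<Lambda> - 1) + (M + (T P - M) * k) / \<Lambda>)"
      unfolding Perms_def F_def M_def T_def k_def
      using m by (intro sum_unfilled_cell_le L n ab \<Lambda>) auto
  qed
  also have "\<dots> = (\<Sum>P\<in>V. F * (M * ln \<Lambda>) + F * (k / \<Lambda>) * (T P - open_bound n m))"
  proof (rule sum.cong[OF refl])
    fix P
    have M: "M = real n ^ 2 * x" using n by (simp add: M_def x_def remaining_frac_def)
    have "M * \<Lambda> = M + M * real n * x ^ 2 * k"
      by (simp add: \<Lambda>_def cell_bound_def x_def k_def algebra_simps)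
    moreover have "open_bound n m = M * real n * x ^ 2 + M"
      unfolding open_bound_def M x_def by (simp add: power2_eq_square power3_eq_cube)
    ultimately have "M + (T P - M) * k = M * \<Lambda> + (T P - open_bound n m) * k"
      by (simp add: algebra_simps)
    hence "(M + (T P - M) * k) / \<Lambda> = M + (T P - open_bound n m) * k / \<Lambda>"
      using \<Lambda> by (simp add: add_divide_distrib)
    thus "F * (M * (ln \<Lambda> - 1) + (M + (T P - M) * k) / \<Lambda>) =
        F * (M * ln \<Lambda>) + F * (k / \<Lambda>) * (T P - open_bound n m)"
      by (simp only:) (simp add: algebra_simps diff_divide_distrib)
  qed
  also have "\<dots> = F * (real (card V) * M * ln \<Lambda>) + F * (k / \<Lambda>) * (\<Sum>P\<in>V. T P - open_bound n m)"
    by (simp add: sum.distrib sum_distrib_left)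
  also have "\<dots> \<le> F * (real (card V) * M * ln \<Lambda>) + F * (k / \<Lambda>) * E"
  proof -
    have "(\<Sum>P\<in>V. T P - open_bound n m) = (\<Sum>P\<in>V. real (card (open_triples n (set (take m P)))) - open_bound n m)"
      by (rule sum.cong[OF refl]) (use V in \<open>auto simp: T_def ordered_subsets_def\<close>)
    also have "\<dots> \<le> E" unfolding E_def by (rule sum_open_triples_excess[OF L _ _ V]) (use m n in auto)
    finally show ?thesis using k \<Lambda> by (intro add_left_mono mult_left_mono) (auto simp: F_def)
  qed
  \<comment> \<open>\<open>k / (1 + n * x^2 * k)\<close> increases in \<open>k\<close>, so
    \<open>k = 1\<close> gives a bound that is uniform in the position.\<close>
  also have "\<dots> \<le> F * (real (card V) * M * ln \<Lambda>) + F * (1 / (1 + real n * x ^ 2)) * E"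
  proof (intro add_left_mono mult_right_mono mult_left_mono)
    have "k * (1 + real n * x ^ 2) \<le> \<Lambda>"
      using k by (simp add: \<Lambda>_def cell_bound_def x_def k_def algebra_simps)
    moreover have "1 + real n * x ^ 2 > 0" by (simp add: add_pos_nonneg)
    ultimately show "k / \<Lambda> \<le> 1 / (1 + real n * x ^ 2)" using \<Lambda> by (simp add: field_simps)
  qed (auto simp: F_def E_def)
  also have "\<dots> = (fact (n - 1))\<^sup>2 * (real (card V) * real (n\<^sup>2 - m) * ln \<Lambda> +
      real (card (ordered_subsets m L)) * (3 * real n ^ 2 / (1 + real n * remaining_frac n m ^ 2)))"
    by (simp add: F_def M_def E_def x_def algebra_simps)
  finally show ?thesis by (simp only: \<Lambda>_def)
qed

text \<open>The deviations over \<open>V\<close> were bounded in terms of all ordered subsets, whose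
  number is at most \<open>card V / \<rho>\<close>; hence the factor \<open>1 / \<rho>\<close> on
  the error alone.\<close>

lemma sum_weight_exponent_le:
  assumes L: "L \<in> latin_squares n" and n: "n \<ge> 2" and m: "m < n\<^sup>2"
    and V: "V \<subseteq> ordered_subsets m L" and "\<rho> > 0"
    and \<rho>: "\<rho> * real (card (ordered_subsets m L)) \<le> real (card V)"
  defines "Perms \<equiv> {p. p permutes {1..n}}"
  shows "(\<Sum>P\<in>V. \<Sum>\<sigma>\<in>Perms. \<Sum>\<theta>\<in>Perms. weight_exponent n m L P \<sigma> \<theta>) \<le>
    real (card V) * (fact n)\<^sup>2 * (log_bound n m + log_error n m / \<rho>)"
proof -
  define \<Omega> where "\<Omega> = real (card (ordered_subsets m L))"
  define v where "v = real (card V)"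
  have \<Omega>: "\<Omega> \<le> v / \<rho>" using \<rho> \<open>\<rho> > 0\<close> by (simp add: \<Omega>_def v_def field_simps)
  have cardPerms: "real (card Perms) = fact n" using card_permutations[of "{1..n}" n] by (simp add: Perms_def)
  define t1 where "t1 P = (\<Sum>i<m. ln (open_bound n i) +
      (real (card (open_triples n (set (take i P)))) / open_bound n i - 1))" for P
  define t2 where "t2 P \<sigma> \<theta> a b = (if filled (set P) (\<sigma> a) (\<theta> b) then 0 else
        (ln (cell_bound n m a b) - 1) + real (card (choices n (set P) L \<sigma> \<theta> a b)) / cell_bound n m a b)"
    for P \<sigma> \<theta> a b
  have we: "weight_exponent n m L P \<sigma> \<theta> = t1 P + (\<Sum>a\<in>{1..n}. \<Sum>b\<in>{1..n}. t2 P \<sigma> \<theta> a b)" for P \<sigma> \<theta>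
    by (simp add: weight_exponent_def t1_def t2_def)
  have "(\<Sum>P\<in>V. t1 P) \<le> v * (\<Sum>i<m. ln (open_bound n i)) + \<Omega> * (\<Sum>i<m. 3 * real n ^ 2 / open_bound n i)"
  proof -
    have "(\<Sum>P\<in>V. t1 P) = (\<Sum>i<m. \<Sum>P\<in>V. ln (open_bound n i) +
        (real (card (open_triples n (set (take i P)))) / open_bound n i - 1))"
      unfolding t1_def by (rule sum.swap)
    also have "\<dots> \<le> (\<Sum>i<m. v * ln (open_bound n i) + \<Omega> * (3 * real n ^ 2 / open_bound n i))"
    proof (rule sum_mono)
      fix i assume i: "i \<in> {..<m}"
      have pos: "open_bound n i > 0" using i m by (intro open_bound_pos) auto
      have "(\<Sum>P\<in>V. ln (open_bound n i) + (real (card (open_triples n (set (take i P)))) / open_bound n i - 1)) =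
          v * ln (open_bound n i) + (\<Sum>P\<in>V. real (card (open_triples n (set (take i P)))) - open_bound n i) / open_bound n i"
        using pos by (simp add: v_def sum.distrib sum_subtractf sum_divide_distrib diff_divide_distrib)
      also have "\<dots> \<le> v * ln (open_bound n i) + (\<Omega> * (3 * real n ^ 2)) / open_bound n i"
        unfolding \<Omega>_def using pos i m n
        by (intro add_left_mono divide_right_mono sum_open_triples_excess[OF L _ _ V]) auto
      finally show "(\<Sum>P\<in>V. ln (open_bound n i) + (real (card (open_triples n (set (take i P)))) / open_bound n i - 1))
          \<le> v * ln (open_bound n i) + \<Omega> * (3 * real n ^ 2 / open_bound n i)" by simp
    qed
    finally show ?thesis by (simp add: sum.distrib sum_distrib_left)
  qed
  moreover have "(\<Sum>i<m. 3 * real n ^ 2 / open_bound n i) \<ge> 0"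
    by (intro sum_nonneg divide_nonneg_nonneg) (use m in \<open>auto intro!: less_imp_le open_bound_pos\<close>)
  ultimately have b1: "(\<Sum>P\<in>V. t1 P) \<le> v * (\<Sum>i<m. ln (open_bound n i)) + v / \<rho> * (\<Sum>i<m. 3 * real n ^ 2 / open_bound n i)"
    using mult_right_mono[OF \<Omega>] by (meson add_left_mono order_trans)
  define D where "D = 3 * real n ^ 2 / (1 + real n * remaining_frac n m ^ 2)"
  have "D \<ge> 0" by (simp add: D_def)
  define S where "S = (\<Sum>a\<in>{1..n}. \<Sum>b\<in>{1..n}. ln (cell_bound n m a b))"
  have fact: "(fact n :: real)\<^sup>2 = real n ^ 2 * (fact (n - 1))\<^sup>2"
    using n fact_reduce[of n, where 'a=real] by (simp add: power_mult_distrib)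
  have "(\<Sum>P\<in>V. \<Sum>\<sigma>\<in>Perms. \<Sum>\<theta>\<in>Perms. \<Sum>a\<in>{1..n}. \<Sum>b\<in>{1..n}. t2 P \<sigma> \<theta> a b) =
      (\<Sum>a\<in>{1..n}. \<Sum>b\<in>{1..n}. \<Sum>P\<in>V. \<Sum>\<sigma>\<in>Perms. \<Sum>\<theta>\<in>Perms. t2 P \<sigma> \<theta> a b)"
    by (simp only: sum.swap[where A=Perms and B="{1..n}"] sum.swap[where A=V and B="{1..n}"])
  also have "\<dots> \<le> (\<Sum>a\<in>{1..n}. \<Sum>b\<in>{1..n}. (fact (n - 1))\<^sup>2 * (v * real (n\<^sup>2 - m) * ln (cell_bound n m a b) + \<Omega> * D))"
    unfolding t2_def Perms_def v_def \<Omega>_def D_def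
    by (intro sum_mono sum_unfilled_cell_deviation_le[OF L n m V])
  also have "\<dots> = (fact (n - 1))\<^sup>2 * (v * real (n\<^sup>2 - m) * S + real n ^ 2 * (\<Omega> * D))"
    by (simp add: S_def sum.distrib sum_distrib_left power2_eq_square algebra_simps)
  also have "\<dots> \<le> (fact (n - 1))\<^sup>2 * (v * real (n\<^sup>2 - m) * S + real n ^ 2 * (v / \<rho> * D))"
    using \<Omega> \<open>D \<ge> 0\<close> by (intro mult_left_mono add_left_mono mult_right_mono) auto
  \<comment> \<open>Here \<open>n^2 * ((n - 1)!)^2 = (n!)^2\<close>, and \<open>n^2 - m\<close> is
    \<open>n^2\<close> times the remaining fraction.\<close>
  also have "\<dots> = (fact n)\<^sup>2 * (v * (remaining_frac n m * S) + v / \<rho> * D)"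
    using n unfolding fact by (simp add: remaining_frac_def algebra_simps)
  finally have b2: "(\<Sum>P\<in>V. \<Sum>\<sigma>\<in>Perms. \<Sum>\<theta>\<in>Perms. \<Sum>a\<in>{1..n}. \<Sum>b\<in>{1..n}. t2 P \<sigma> \<theta> a b) \<le>
      (fact n)\<^sup>2 * (v * (remaining_frac n m * S) + v / \<rho> * D)" .
  have "(\<Sum>P\<in>V. \<Sum>\<sigma>\<in>Perms. \<Sum>\<theta>\<in>Perms. weight_exponent n m L P \<sigma> \<theta>) =
      (fact n)\<^sup>2 * (\<Sum>P\<in>V. t1 P) + (\<Sum>P\<in>V. \<Sum>\<sigma>\<in>Perms. \<Sum>\<theta>\<in>Perms. \<Sum>a\<in>{1..n}. \<Sum>b\<in>{1..n}. t2 P \<sigma> \<theta> a b)"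
    unfolding we by (simp only: sum.distrib sum_constant cardPerms sum_distrib_left) (simp add: power2_eq_square mult.assoc)
  also have "\<dots> \<le> (fact n)\<^sup>2 * (v * (\<Sum>i<m. ln (open_bound n i)) + v / \<rho> * (\<Sum>i<m. 3 * real n ^ 2 / open_bound n i)) +
      (fact n)\<^sup>2 * (v * (remaining_frac n m * S) + v / \<rho> * D)"
    by (intro add_mono b2 mult_left_mono b1) auto
  also have "\<dots> = v * (fact n)\<^sup>2 * (log_bound n m + log_error n m / \<rho>)"
    by (simp add: log_bound_def log_error_def S_def D_def algebra_simps add_divide_distrib)
  finally show ?thesis by (simp add: v_def)
qed

lemma open_triples_along_pos:
  assumes "L \<in> latin_squares n" "P \<in> ordered_subsets m L" "i < m"
  shows "card (open_triples n (set (take i P))) > 0"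
  using nth_in_open_triples[OF assms] finite_open_triples card_gt_0_iff by blast

text \<open>The tangent bound is applied factor by factor. It needs positive counts: the next triple
  of \<open>P\<close> is always open, and the entry of \<open>L\<close> is always among the choices
  at an unfilled cell.\<close>

lemma exp_weight_exponent_le:
  assumes L: "L \<in> latin_squares n" and m: "m < n\<^sup>2" and P: "P \<in> ordered_subsets m L"
    and \<sigma>: "\<sigma> permutes {1..n}" and \<theta>: "\<theta> permutes {1..n}"
  shows "exp (- weight_exponent n m L P \<sigma> \<theta>) \<le>
    (\<Prod>i<m. 1 / real (card (open_triples n (set (take i P))))) *
    (\<Prod>(a, b)\<in>{1..n} \<times> {1..n}. if filled (set P) (\<sigma> a) (\<theta> b) then 1
       else 1 / real (card (choices n (set P) L \<sigma> \<theta> a b)))"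
proof -
  define s where "s i = ln (open_bound n i) + (real (card (open_triples n (set (take i P)))) / open_bound n i - 1)" for i
  define t where "t = (\<lambda>(a, b). if filled (set P) (\<sigma> a) (\<theta> b) then 0 else
        (ln (cell_bound n m a b) - 1) + real (card (choices n (set P) L \<sigma> \<theta> a b)) / cell_bound n m a b)"
  have "weight_exponent n m L P \<sigma> \<theta> = (\<Sum>i<m. s i) + (\<Sum>z\<in>{1..n} \<times> {1..n}. t z)"
    by (simp add: weight_exponent_def s_def t_def sum.cartesian_product)
  hence "exp (- weight_exponent n m L P \<sigma> \<theta>) = exp (\<Sum>i<m. - s i) * exp (\<Sum>z\<in>{1..n} \<times> {1..n}. - t z)"
    by (simp add: sum_negf flip: exp_add)
  also have "\<dots> = (\<Prod>i<m. exp (- s i)) * (\<Prod>z\<in>{1..n} \<times> {1..n}. exp (- t z))"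
    by (simp only: exp_sum finite_lessThan finite_cartesian_product finite_atLeastAtMost)
  also have "\<dots> \<le> (\<Prod>i<m. 1 / real (card (open_triples n (set (take i P))))) *
    (\<Prod>(a, b)\<in>{1..n} \<times> {1..n}. if filled (set P) (\<sigma> a) (\<theta> b) then 1
       else 1 / real (card (choices n (set P) L \<sigma> \<theta> a b)))"
  proof (intro mult_mono prod_mono conjI)
    show "exp (- s i) \<le> 1 / real (card (open_triples n (set (take i P))))" if "i \<in> {..<m}" for i
      unfolding s_def using that m open_triples_along_pos[OF L P, of i]
      by (intro exp_neg_tangent_le open_bound_pos) auto
    fix z assume z: "z \<in> {1..n} \<times> {1..n}"
    then obtain a b where ab: "z = (a, b)" "a \<in> {1..n}" "b \<in> {1..n}" by blast
    show "exp (- t z) \<le> (case z of (a, b) \<Rightarrow> if filled (set P) (\<sigma> a) (\<theta> b) then 1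
       else 1 / real (card (choices n (set P) L \<sigma> \<theta> a b)))"
    proof (cases "filled (set P) (\<sigma> a) (\<theta> b)")
      case True
      thus ?thesis by (simp add: ab t_def)
    next
      case False
      have in1: "\<sigma> a \<in> {1..n}" "\<theta> b \<in> {1..n}"
        using ab permutes_in_image[OF \<sigma>] permutes_in_image[OF \<theta>] by blast+
      then obtain x where "(\<sigma> a, \<theta> b, x) \<in> L" using latin_square_ex1(1)[OF L] by blast
      hence "x \<in> choices n (set P) L \<sigma> \<theta> a b"
        using P by (intro latin_entry_in_choices[OF L _ \<sigma> \<theta> ab(2,3) False]) (auto simp: ordered_subsets_def)
      hence "card (choices n (set P) L \<sigma> \<theta> a b) > 0"
        using finite_choices card_gt_0_iff by blast
      thus ?thesis using exp_neg_tangent_le[OF _ cell_bound_pos, of "real (card (choices n (set P) L \<sigma> \<theta> a b))" n m a b] False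
        by (simp add: ab t_def algebra_simps)
    qed
  qed (auto intro!: prod_nonneg)
  finally show ?thesis .
qed

lemma trp_probability_ge:
  assumes n: "n \<ge> 2" and m: "m < n\<^sup>2" and T: "T \<subseteq> latin_squares n"
    and inh: "inherited \<rho> m U T" and \<rho>: "\<rho> > 0"
  shows "real (card T) * \<rho> * real (falling (n\<^sup>2) m) * exp (- (log_bound n m + log_error n m / \<rho>))
    \<le> measure_pmf.prob (TRP n m) (Some ` U)"
proof -
  define Perms where "Perms = {p. p permutes {1..n}}"
  define V where "V L = U \<inter> ordered_subsets m L" for L
  define W where "W = (\<Union>L\<in>T. V L)"
  define B where "B = log_bound n m + log_error n m / \<rho>"
  define w where "w P = (\<Prod>i<m. 1 / real (card (open_triples n (set (take i P)))))" for P
  define v where "v P L \<sigma> \<theta> = (\<Prod>(a, b)\<in>{1..n} \<times> {1..n}. if filled (set P) (\<sigma> a) (\<theta> b) then 1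
       else 1 / real (card (choices n (set P) L \<sigma> \<theta> a b)))" for P L \<sigma> \<theta>
  have w0: "w P \<ge> 0" for P unfolding w_def by (intro prod_nonneg) auto
  have finT: "finite T" using T finite_latin_squares finite_subset by blast
  have finV: "finite (V L)" if "L \<in> T" for L
    using that T finite_latin_square by (auto simp: V_def intro!: finite_ordered_subsets finite_Int)
  have finW: "finite W" using finT finV by (simp add: W_def)
  have finP: "finite Perms" "card Perms = fact n"
    using finite_permutations[of "{1..n}"] card_permutations[of "{1..n}" n] by (simp_all add: Perms_def)
  have lower: "\<rho> * real (falling (n\<^sup>2) m) * (fact n)\<^sup>2 * exp (- B) \<le>
      (\<Sum>P\<in>V L. \<Sum>\<sigma>\<in>Perms. \<Sum>\<theta>\<in>Perms. w P * v P L \<sigma> \<theta>)" if LT: "L \<in> T" for L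
  proof -
    have L: "L \<in> latin_squares n" using T LT by blast
    have cardL: "finite L" "card L = n\<^sup>2" using L by (simp_all add: finite_latin_square card_latin_square)
    have \<Omega>: "card (ordered_subsets m L) = falling (n\<^sup>2) m" using card_ordered_subsets[OF cardL(1)] cardL by simp
    have \<Omega>0: "falling (n\<^sup>2) m > 0" using m by (intro falling_pos) simp
    have "\<rho> \<le> real (card (V L)) / real (falling (n\<^sup>2) m)"
    proof -
      have "\<rho> \<le> measure_pmf.prob (random_ordered_subset m L) U"
        using inh LT by (simp add: inherited_def)
      also have "\<dots> = real (card (V L)) / real (falling (n\<^sup>2) m)"
        using prob_random_ordered_subset[OF cardL(1), of m U] m cardL by (simp add: V_def \<Omega>)
      finally show ?thesis .
    qed
    hence V\<rho>: "\<rho> * real (falling (n\<^sup>2) m) \<le> real (card (V L))" using \<Omega>0 by (simp add: field_simps)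
    \<comment> \<open>Jensen's inequality is applied once, to \<open>P\<close> and both orders
      jointly.\<close>
    define A where "A = V L \<times> Perms \<times> Perms"
    define f where "f = (\<lambda>(P, \<sigma>, \<theta>). weight_exponent n m L P \<sigma> \<theta>)"
    have cardA: "real (card A) = real (card (V L)) * (fact n)\<^sup>2"
      by (simp add: A_def card_cartesian_product finP power2_eq_square)
    have "(\<Sum>z\<in>A. f z) \<le> real (card A) * B"
    proof -
      have "(\<Sum>z\<in>A. f z) = (\<Sum>P\<in>V L. \<Sum>\<sigma>\<in>Perms. \<Sum>\<theta>\<in>Perms. weight_exponent n m L P \<sigma> \<theta>)"
        by (simp add: A_def f_def sum.cartesian_product case_prod_unfold)
      also have "\<dots> \<le> real (card (V L)) * (fact n)\<^sup>2 * (log_bound n m + log_error n m / \<rho>)"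
        unfolding Perms_def
        by (rule sum_weight_exponent_le[OF L n m _ \<rho>]) (use V\<rho> in \<open>auto simp: \<Omega> V_def\<close>)
      finally show ?thesis by (simp only: cardA B_def)
    qed
    hence "real (card A) * exp (- B) \<le> (\<Sum>z\<in>A. exp (- f z))" by (rule sum_exp_neg_ge)
    also have "\<dots> = (\<Sum>P\<in>V L. \<Sum>\<sigma>\<in>Perms. \<Sum>\<theta>\<in>Perms. exp (- weight_exponent n m L P \<sigma> \<theta>))"
      by (simp add: A_def f_def sum.cartesian_product case_prod_unfold)
    also have "\<dots> \<le> (\<Sum>P\<in>V L. \<Sum>\<sigma>\<in>Perms. \<Sum>\<theta>\<in>Perms. w P * v P L \<sigma> \<theta>)"
      unfolding w_def v_def
      by (intro sum_mono exp_weight_exponent_le[OF L m]) (auto simp: V_def Perms_def)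
    finally have "real (card (V L)) * (fact n)\<^sup>2 * exp (- B) \<le>
        (\<Sum>P\<in>V L. \<Sum>\<sigma>\<in>Perms. \<Sum>\<theta>\<in>Perms. w P * v P L \<sigma> \<theta>)" by (simp only: cardA)
    moreover have "\<rho> * real (falling (n\<^sup>2) m) * (fact n)\<^sup>2 * exp (- B) \<le> real (card (V L)) * (fact n)\<^sup>2 * exp (- B)"
      using V\<rho> by (intro mult_right_mono) auto
    ultimately show ?thesis by linarith
  qed
  have "real (card T) * (\<rho> * real (falling (n\<^sup>2) m) * (fact n)\<^sup>2 * exp (- B)) \<le>
      (\<Sum>L\<in>T. \<Sum>P\<in>V L. \<Sum>\<sigma>\<in>Perms. \<Sum>\<theta>\<in>Perms. w P * v P L \<sigma> \<theta>)"
    using sum_mono[of T "\<lambda>_. \<rho> * real (falling (n\<^sup>2) m) * (fact n)\<^sup>2 * exp (- B)", OF lower] by simp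
  also have "\<dots> = (\<Sum>L\<in>T. \<Sum>P | P \<in> W \<and> P \<in> V L. \<Sum>\<sigma>\<in>Perms. \<Sum>\<theta>\<in>Perms. w P * v P L \<sigma> \<theta>)"
    by (intro sum.cong refl) (auto simp: W_def)
  \<comment> \<open>Regrouping by \<open>P\<close> makes Kraft's inequality applicable:
    \<open>w P\<close> does not depend on \<open>L\<close>, and what remains is a sum over squares
    containing \<open>P\<close>.\<close>
  also have "\<dots> = (\<Sum>P\<in>W. \<Sum>L | L \<in> T \<and> P \<in> V L. \<Sum>\<sigma>\<in>Perms. \<Sum>\<theta>\<in>Perms. w P * v P L \<sigma> \<theta>)"
    by (rule sum.swap_restrict[OF finT finW])
  also have "\<dots> = (\<Sum>P\<in>W. \<Sum>\<sigma>\<in>Perms. \<Sum>\<theta>\<in>Perms. w P * (\<Sum>L | L \<in> T \<and> P \<in> V L. v P L \<sigma> \<theta>))"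
  proof (rule sum.cong[OF refl])
    fix P
    have "(\<Sum>L | L \<in> T \<and> P \<in> V L. \<Sum>\<sigma>\<in>Perms. \<Sum>\<theta>\<in>Perms. w P * v P L \<sigma> \<theta>) =
        (\<Sum>\<sigma>\<in>Perms. \<Sum>L | L \<in> T \<and> P \<in> V L. \<Sum>\<theta>\<in>Perms. w P * v P L \<sigma> \<theta>)"
      by (rule sum.swap)
    also have "\<dots> = (\<Sum>\<sigma>\<in>Perms. \<Sum>\<theta>\<in>Perms. \<Sum>L | L \<in> T \<and> P \<in> V L. w P * v P L \<sigma> \<theta>)"
      by (rule sum.cong[OF refl], rule sum.swap)
    finally show "(\<Sum>L | L \<in> T \<and> P \<in> V L. \<Sum>\<sigma>\<in>Perms. \<Sum>\<theta>\<in>Perms. w P * v P L \<sigma> \<theta>) =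
        (\<Sum>\<sigma>\<in>Perms. \<Sum>\<theta>\<in>Perms. w P * (\<Sum>L | L \<in> T \<and> P \<in> V L. v P L \<sigma> \<theta>))"
      by (simp only: sum_distrib_left)
  qed
  also have "\<dots> \<le> (\<Sum>P\<in>W. \<Sum>\<sigma>\<in>Perms. \<Sum>\<theta>\<in>Perms. w P * 1)"
  proof (intro sum_mono mult_left_mono w0)
    fix P \<sigma> \<theta> assume "\<sigma> \<in> Perms" "\<theta> \<in> Perms"
    moreover have "{L \<in> T. P \<in> V L} \<subseteq> {L \<in> latin_squares n. set P \<subseteq> L}"
      using T by (auto simp: V_def ordered_subsets_def)
    ultimately show "(\<Sum>L | L \<in> T \<and> P \<in> V L. v P L \<sigma> \<theta>) \<le> 1"
      unfolding v_def Perms_def by (intro completion_kraft) auto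
  qed
  also have "\<dots> = (fact n)\<^sup>2 * (\<Sum>P\<in>W. w P)"
    by (simp add: finP sum_distrib_left power2_eq_square mult.assoc)
  also have "(\<Sum>P\<in>W. w P) = (\<Sum>P\<in>W. pmf (TRP n m) (Some P))"
  proof (rule sum.cong[OF refl])
    fix P assume "P \<in> W"
    then obtain L where "L \<in> latin_squares n" "P \<in> ordered_subsets m L" using T by (auto simp: W_def V_def)
    from pmf_TRP_latin[OF this] show "w P = pmf (TRP n m) (Some P)" by (simp only: w_def)
  qed
  also have "\<dots> = measure_pmf.prob (TRP n m) (Some ` W)"
    using finW by (simp add: measure_measure_pmf_finite sum.reindex)
  also have "\<dots> \<le> measure_pmf.prob (TRP n m) (Some ` U)"
    by (intro measure_pmf.finite_measure_mono) (auto simp: W_def V_def)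
  finally have "(fact n)\<^sup>2 * (real (card T) * \<rho> * real (falling (n\<^sup>2) m) * exp (- B)) \<le>
      (fact n)\<^sup>2 * measure_pmf.prob (TRP n m) (Some ` U)"
    by (simp add: mult_ac)
  thus ?thesis by (simp add: B_def)
qed

section \<open>Asymptotics\<close>

lemma ln_fact_le:
  assumes "k \<ge> 1"
  shows "ln (fact k) \<le> real k * ln (real k) - real k + ln (real k) + 1"
  using assms
proof (induction k rule: nat_induct_at_least)
  case (Suc k)
  have k: "real k > 0" using Suc by simp
  have "ln (real k / (real k + 1)) \<le> real k / (real k + 1) - 1"
    using k by (intro ln_le_minus_one) simp
  hence "1 / (real k + 1) \<le> ln (real k + 1) - ln (real k)" using k by (simp add: ln_div field_simps)
  hence "(real k + 1) * ln (real k) + 1 \<le> (real k + 1) * ln (real k + 1)"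
    using k by (simp add: field_simps)
  moreover have "ln (fact (Suc k) :: real) = ln (real k + 1) + ln (fact k)"
    by (simp add: ln_mult add.commute)
  ultimately show ?case using Suc.IH by (simp add: algebra_simps)
qed simp

lemma ln_fact_ge: "real k * ln (real k) - real k \<le> ln (fact k)"
proof (induction k)
  case (Suc k)
  have "real k * (ln (real k + 1) - ln (real k)) \<le> 1"
  proof (cases "k = 0")
    case False
    hence k: "real k > 0" by simp
    have "ln ((real k + 1) / real k) \<le> (real k + 1) / real k - 1"
      using k by (intro ln_le_minus_one) simp
    thus ?thesis using k by (simp add: ln_div field_simps)
  qed simp
  moreover have "ln (fact (Suc k) :: real) = ln (real k + 1) + ln (fact k)"
    by (simp add: ln_mult add.commute)
  ultimately show ?case using Suc.IH by (simp add: algebra_simps)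
qed simp

lemma falling_mult_fact:
  assumes "m \<le> a"
  shows "falling a m * fact (a - m) = fact a"
proof -
  have self: "falling k k = fact k" for k
    by (simp add: falling_def fact_prod_rev atLeast0LessThan)
  have "falling a a = falling a m * falling (a - m) (a - m)"
    using falling_add[of a m "a - m"] assms by simp
  thus ?thesis by (simp add: self)
qed

lemma sum_inverse_le_ln: "n \<ge> 1 \<Longrightarrow> (\<Sum>k=1..n. 1 / real k) \<le> 1 + ln (real n)"
proof (induction n rule: nat_induct_at_least)
  case (Suc n)
  have n: "real n > 0" using Suc by simp
  have "ln (real n / (real n + 1)) \<le> real n / (real n + 1) - 1"
    using n by (intro ln_le_minus_one) simp
  hence "1 / (real n + 1) \<le> ln (real n + 1) - ln (real n)" using n by (simp add: ln_div field_simps)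
  thus ?case using Suc.IH by (simp add: add.commute)
qed simp

text \<open>From \<open>ln (1 + z) = ln z + ln (1 + 1 / z) \<le> ln z + 1 / z\<close>. The sum of
  \<open>1 / (a * b)\<close> is the square of a harmonic sum, the origin of the squared
  logarithm.\<close>

lemma sum_ln_one_plus_product_le:
  fixes K :: real
  assumes "K > 0" "p \<ge> 1"
  shows "(\<Sum>a=1..p. \<Sum>b=1..p. ln (1 + K * (real a * real b))) \<le>
    real p ^ 2 * ln K + 2 * real p * ln (fact p) + (1 + ln (real p)) ^ 2 / K"
proof -
  define H where "H = (\<Sum>k=1..p. 1 / real k)"
  have ln_fact: "(\<Sum>k=1..p. ln (real k)) = ln (fact p)"
    unfolding fact_prod of_nat_prod by (rule ln_prod[symmetric]) auto
  have "(\<Sum>a=1..p. \<Sum>b=1..p. ln (1 + K * (real a * real b))) \<le>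
      (\<Sum>a=1..p. \<Sum>b=1..p. ln K + ln (real a) + ln (real b) + 1 / K * (1 / real a) * (1 / real b))"
  proof (intro sum_mono)
    fix a b assume "a \<in> {1..p}" "b \<in> {1..p}"
    hence ab: "real a > 0" "real b > 0" by auto
    define z where "z = K * (real a * real b)"
    have z: "z > 0" using ab \<open>K > 0\<close> by (simp add: z_def)
    have "ln (1 + z) = ln z + ln (1 + 1 / z)"
    proof -
      have "1 + z = z * (1 + 1 / z)" using z by (simp add: field_simps)
      thus ?thesis using z by (metis add_pos_pos ln_mult_pos zero_less_divide_1_iff zero_less_one)
    qed
    also have "ln (1 + 1 / z) \<le> 1 / z" using z by (intro ln_add_one_self_le_self) auto
    also have "ln z = ln K + ln (real a) + ln (real b)" using ab \<open>K > 0\<close> by (simp add: z_def ln_mult)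
    finally show "ln (1 + K * (real a * real b)) \<le> ln K + ln (real a) + ln (real b) + 1 / K * (1 / real a) * (1 / real b)"
      by (simp add: z_def)
  qed
  also have "\<dots> = real p ^ 2 * ln K + 2 * real p * ln (fact p) + 1 / K * (H * H)"
    by (simp only: sum.distrib sum_distrib_left[symmetric] sum_distrib_right[symmetric] sum_constant ln_fact H_def[symmetric] card_atLeastAtMost)
      (simp add: power2_eq_square algebra_simps)
  also have "1 / K * (H * H) \<le> (1 + ln (real p)) ^ 2 / K"
  proof -
    have "0 \<le> H" unfolding H_def by (intro sum_nonneg) auto
    hence "H * H \<le> (1 + ln (real p)) ^ 2"
      using sum_inverse_le_ln[OF assms(2)] unfolding power2_eq_square H_def by (intro mult_mono) auto
    thus ?thesis using \<open>K > 0\<close> by (simp add: divide_right_mono)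
  qed
  finally show ?thesis by simp
qed

section \<open>Estimates for a remaining fraction bounded below by \<open>c\<close>, later
  \<open>1 - \<alpha>\<close>\<close>

context
  fixes n m :: nat and c x :: real
  assumes n: "n \<ge> 3" and m: "m < n\<^sup>2" and c: "c > 0"
    and x_def: "x = remaining_frac n m" and cx: "c \<le> x"
begin

lemma remaining_frac_le_1: "x \<le> 1"
  by (simp add: x_def remaining_frac_def divide_le_eq)

lemma remaining_frac_mult: "real n ^ 2 * x = real (n\<^sup>2 - m)"
  using n by (simp add: x_def remaining_frac_def)

lemma le_remaining_frac: "i \<le> m \<Longrightarrow> c \<le> remaining_frac n i"
  using cx unfolding x_def remaining_frac_def
  by (erule_tac order_trans) (intro divide_right_mono, auto)

lemma ln_n_ge_1: "ln (real n) \<ge> 1"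
proof -
  have "exp 1 \<le> (3::real)" by (rule exp_le)
  also have "\<dots> \<le> real n" using n by simp
  finally have "ln (exp 1) \<le> ln (real n)" using n by (subst ln_le_cancel_iff) auto
  thus ?thesis by simp
qed

text \<open>As \<open>open_bound\<close> is at least \<open>(n * c)^3\<close>, each of the fewer
  than \<open>n^2\<close> removal steps contributes \<open>O(1 / n)\<close>.\<close>

lemma log_error_le: "log_error n m \<le> real n * (3 / c ^ 3 + 3 / c ^ 2)"
proof -
  have n0: "real n > 0" using n by simp
  have "(\<Sum>i<m. 3 * real n ^ 2 / open_bound n i) \<le> (\<Sum>i<m. 3 / (real n * c ^ 3))"
  proof (rule sum_mono)
    fix i assume i: "i \<in> {..<m}"
    have "c ^ 3 \<le> remaining_frac n i ^ 3" using le_remaining_frac[of i] i c by (intro power_mono) auto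
    hence "real n ^ 3 * c ^ 3 \<le> real n ^ 3 * remaining_frac n i ^ 3" by (intro mult_left_mono) auto
    also have "\<dots> \<le> open_bound n i" by (simp add: open_bound_def remaining_frac_def)
    finally have "3 * real n ^ 2 / open_bound n i \<le> 3 * real n ^ 2 / (real n ^ 3 * c ^ 3)"
      using n0 c i m open_bound_pos[of i n] by (intro divide_left_mono mult_pos_pos) auto
    also have "\<dots> = 3 / (real n * c ^ 3)" using n0 by (simp add: power2_eq_square power3_eq_cube)
    finally show "3 * real n ^ 2 / open_bound n i \<le> 3 / (real n * c ^ 3)" .
  qed
  also have "\<dots> = real m * (3 / (real n * c ^ 3))" by simp
  also have "\<dots> \<le> real n ^ 2 * (3 / (real n * c ^ 3))"
    using m c n0 by (intro mult_right_mono) (auto simp flip: of_nat_power)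
  also have "\<dots> = real n * (3 / c ^ 3)" using n0 by (simp add: power2_eq_square)
  finally have 1: "(\<Sum>i<m. 3 * real n ^ 2 / open_bound n i) \<le> real n * (3 / c ^ 3)" .
  have "c ^ 2 \<le> x ^ 2" using cx c by (intro power_mono) auto
  hence "real n * c ^ 2 \<le> 1 + real n * x ^ 2"
    using mult_left_mono[of "c ^ 2" "x ^ 2" "real n"] by simp
  hence "3 * real n ^ 2 / (1 + real n * x ^ 2) \<le> 3 * real n ^ 2 / (real n * c ^ 2)"
    using n0 c by (intro divide_left_mono mult_pos_pos) (auto intro: add_pos_nonneg)
  also have "\<dots> = real n * (3 / c ^ 2)" using n0 by (simp add: power2_eq_square)
  finally show ?thesis using 1 by (simp add: log_error_def x_def distrib_left)
qed

lemma ln_falling_le: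
  "ln (real (falling (n\<^sup>2) m)) \<le>
     2 * real m * ln (real n) - real m - real (n\<^sup>2 - m) * ln x + 2 * ln (real n) + 1"
proof -
  define M where "M = real (n\<^sup>2 - m)"
  have n0: "real n > 0" using n by simp
  have M: "real (n\<^sup>2) = real m + M" using m by (simp add: M_def of_nat_diff)
  have lnM: "ln M = 2 * ln (real n) + ln x"
  proof -
    have "M = real n ^ 2 * x" by (simp add: M_def remaining_frac_mult)
    thus ?thesis using n0 cx c by (simp add: ln_mult ln_realpow)
  qed
  have lnN: "ln (real (n\<^sup>2)) = 2 * ln (real n)" using n0 by (simp add: ln_realpow)
  have "real (falling (n\<^sup>2) m) * fact (n\<^sup>2 - m) = fact (n\<^sup>2)"
    using arg_cong[OF falling_mult_fact[of m "n\<^sup>2"], of real] m by simp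
  hence "ln (real (falling (n\<^sup>2) m)) + ln (fact (n\<^sup>2 - m)) = ln (fact (n\<^sup>2) :: real)"
    using falling_pos[of m "n\<^sup>2"] m by (metis fact_gt_zero less_imp_le_nat ln_mult_pos of_nat_0_less_iff)
  moreover have "ln (fact (n\<^sup>2) :: real) \<le> real (n\<^sup>2) * ln (real (n\<^sup>2)) - real (n\<^sup>2) + ln (real (n\<^sup>2)) + 1"
    using n by (intro ln_fact_le) (simp add: Suc_le_eq)
  moreover have "M * ln M - M \<le> ln (fact (n\<^sup>2 - m))" unfolding M_def by (rule ln_fact_ge)
  ultimately have "ln (real (falling (n\<^sup>2) m)) \<le>
      (real m + M) * (2 * ln (real n)) - (real m + M) + 2 * ln (real n) + 1 - (M * (2 * ln (real n) + ln x) - M)"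
    unfolding lnN lnM unfolding M by linarith
  thus ?thesis by (simp add: M_def algebra_simps)
qed

text \<open>Up to the factor \<open>1 + 1 / (n * y^2)\<close>, \<open>open_bound n i\<close> is
  \<open>((n^2 - i) / n)^3\<close>, whose product over \<open>i\<close> is a cubed falling factorial
  over a power of \<open>n\<close>. It is left unevaluated because one of the three copies cancels
  in \<open>total_exponent_le\<close>.\<close>

lemma sum_ln_open_bound_le:
  "(\<Sum>i<m. ln (open_bound n i)) \<le>
     3 * ln (real (falling (n\<^sup>2) m)) - 3 * real m * ln (real n) + real n / c ^ 2"
proof -
  have n0: "real n > 0" using n by simp
  have "(\<Sum>i<m. ln (open_bound n i)) \<le> (\<Sum>i<m. 3 * ln (real (n\<^sup>2 - i)) - 3 * ln (real n) + 1 / (real n * c ^ 2))"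
  proof (rule sum_mono)
    fix i assume i: "i \<in> {..<m}"
    define y where "y = remaining_frac n i"
    have y: "c \<le> y" "y > 0" using le_remaining_frac[of i] i c by (auto simp: y_def)
    have ny: "real (n\<^sup>2 - i) = real n ^ 2 * y" using n by (simp add: y_def remaining_frac_def)
    have "open_bound n i = (real n * y) ^ 3 * (1 + 1 / (real n * y ^ 2))"
      using n0 y by (simp add: open_bound_def y_def[symmetric] distrib_left power2_eq_square power3_eq_cube)
    hence "ln (open_bound n i) = ln ((real n * y) ^ 3 * (1 + 1 / (real n * y ^ 2)))" by simp
    also have "\<dots> = 3 * ln (real n * y) + ln (1 + 1 / (real n * y ^ 2))"
    proof -
      have "1 + 1 / (real n * y ^ 2) > 0" using n0 y by (intro add_pos_pos) auto
      moreover have "real n * y > 0" using n0 y by simp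
      ultimately show ?thesis by (subst ln_mult_pos) (auto simp: ln_realpow)
    qed
    also have "ln (1 + 1 / (real n * y ^ 2)) \<le> 1 / (real n * y ^ 2)"
      using n0 y by (intro ln_add_one_self_le_self) auto
    also have "1 / (real n * y ^ 2) \<le> 1 / (real n * c ^ 2)"
      using n0 c y by (intro divide_left_mono mult_left_mono power_mono) auto
    also have "3 * ln (real n * y) = 3 * ln (real (n\<^sup>2 - i)) - 3 * ln (real n)"
      unfolding ny using n0 y by (simp add: ln_mult ln_realpow)
    finally show "ln (open_bound n i) \<le> 3 * ln (real (n\<^sup>2 - i)) - 3 * ln (real n) + 1 / (real n * c ^ 2)" by simp
  qed
  also have "\<dots> = 3 * (\<Sum>i<m. ln (real (n\<^sup>2 - i))) - 3 * real m * ln (real n) + real m * (1 / (real n * c ^ 2))"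
    by (simp add: sum.distrib sum_subtractf sum_distrib_left)
  also have "(\<Sum>i<m. ln (real (n\<^sup>2 - i))) = ln (real (falling (n\<^sup>2) m))"
    unfolding falling_def of_nat_prod by (rule ln_prod[symmetric]) (use m in auto)
  also have "real m * (1 / (real n * c ^ 2)) \<le> real n ^ 2 * (1 / (real n * c ^ 2))"
    using m c n0 by (intro mult_right_mono) (auto simp flip: of_nat_power)
  also have "real n ^ 2 * (1 / (real n * c ^ 2)) = real n / c ^ 2" using n0 by (simp add: power2_eq_square)
  finally show ?thesis by simp
qed

lemma sum_ln_cell_bound_le:
  "x * (\<Sum>a\<in>{1..n}. \<Sum>b\<in>{1..n}. ln (cell_bound n m a b)) \<le>
     real (n\<^sup>2 - m) * (ln (real n) + 2 * ln x - 2) + 2 * real n * (2 - 2 * ln c) +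
     2 * real n * ln (real n) + 2 * real n + real n * (1 + ln (real n)) ^ 2 / c"
proof -
  define p where "p = n - 1"
  define K where "K = real n * x ^ 2 / real p ^ 2"
  define Y where "Y = ln (real n) + 2 * ln x - 2"
  define S where "S = (\<Sum>a\<in>{1..n}. \<Sum>b\<in>{1..n}. ln (cell_bound n m a b))"
  have n0: "real n > 0" and p: "p \<ge> 1" "real p > 0" "real n = real p + 1" and x: "x > 0"
    using n cx c by (auto simp: p_def)
  have K: "K > 0" using n0 p x by (simp add: K_def)
  \<comment> \<open>Positions are counted from the end; those with index 0 contribute
    \<open>ln 1 = 0\<close>.\<close>
  have reindex: "(\<Sum>a\<in>{1..n}. g (n - a)) = g 0 + (\<Sum>a=1..p. g a)" for g :: "nat \<Rightarrow> real"
  proof -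
    have "(\<Sum>a\<in>{1..n}. g (n - a)) = (\<Sum>a\<in>{0..p}. g a)"
      by (rule sum.reindex_bij_witness[of _ "\<lambda>a. n - a" "\<lambda>a. n - a"]) (use n in \<open>auto simp: p_def\<close>)
    also have "{0..p} = insert 0 {1..p}" by auto
    finally show ?thesis by simp
  qed
  have "S = (\<Sum>a\<in>{1..n}. \<Sum>b\<in>{1..n}. ln (1 + K * (real (n - a) * real (n - b))))"
    unfolding S_def cell_bound_def later_frac_def K_def x_def[symmetric] p_def by simp
  also have "\<dots> = (\<Sum>a=1..p. \<Sum>b=1..p. ln (1 + K * (real a * real b)))"
    by (simp only: reindex[of "\<lambda>b. ln (1 + K * (real a * real b))" for a]
      reindex[of "\<lambda>a. ln (1 + K * (real a * real 0)) + (\<Sum>b=1..p. ln (1 + K * (real a * real b)))"]) simp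
  also have "\<dots> \<le> real p ^ 2 * ln K + 2 * real p * ln (fact p) + (1 + ln (real p)) ^ 2 / K"
    by (rule sum_ln_one_plus_product_le[OF K p(1)])
  also have "2 * real p * ln (fact p) \<le> 2 * real p * (real p * ln (real p) - real p + ln (real p) + 1)"
    using p ln_fact_le[of p] by (intro mult_left_mono) auto
  also have "ln K = ln (real n) + 2 * ln x - 2 * ln (real p)"
    using n0 x p by (simp add: K_def ln_mult ln_div ln_realpow)
  also have "real p ^ 2 * (ln (real n) + 2 * ln x - 2 * ln (real p)) +
      2 * real p * (real p * ln (real p) - real p + ln (real p) + 1) + (1 + ln (real p)) ^ 2 / K =
      real p ^ 2 * Y + 2 * real p * (ln (real p) + 1) + (1 + ln (real p)) ^ 2 / K"
    by (simp add: Y_def power2_eq_square algebra_simps)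
  also have "\<dots> \<le> (real n ^ 2 * Y + 2 * real n * (2 - 2 * ln c)) + 2 * real n * (ln (real n) + 1)
      + (1 + ln (real n)) ^ 2 / K"
  proof (intro add_mono)
    \<comment> \<open>Replacing \<open>(n - 1)^2\<close> by \<open>n^2\<close> costs
      \<open>(2 * n - 1) * (- Y)\<close>, and \<open>- Y\<close> is bounded above because
      \<open>x \<ge> c\<close>.\<close>
    have "ln c \<le> ln x" using cx c by simp
    hence "- Y \<le> 2 - 2 * ln c"
      using ln_n_ge_1 by (simp add: Y_def)
    moreover have "ln c \<le> 0" using c cx remaining_frac_le_1 by simp
    ultimately have "(2 * real n - 1) * (- Y) \<le> 2 * real n * (2 - 2 * ln c)"
      using n0 n by (intro order_trans[OF mult_left_mono mult_right_mono]) auto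
    moreover have "real p ^ 2 = real n ^ 2 - (2 * real n - 1)"
      by (simp add: p(3) power2_eq_square algebra_simps)
    hence "real p ^ 2 * Y = real n ^ 2 * Y + (2 * real n - 1) * (- Y)"
      by (simp only:) (simp add: algebra_simps)
    ultimately show "real p ^ 2 * Y \<le> real n ^ 2 * Y + 2 * real n * (2 - 2 * ln c)" by linarith
    have lnp: "0 \<le> ln (real p)" "ln (real p) \<le> ln (real n)" using p by auto
    show "2 * real p * (ln (real p) + 1) \<le> 2 * real n * (ln (real n) + 1)"
      using p lnp by (intro mult_mono) auto
    show "(1 + ln (real p)) ^ 2 / K \<le> (1 + ln (real n)) ^ 2 / K"
      using K lnp by (intro divide_right_mono power_mono) auto
  qed
  finally have "x * S \<le> x * ((real n ^ 2 * Y + 2 * real n * (2 - 2 * ln c)) + 2 * real n * (ln (real n) + 1)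
      + (1 + ln (real n)) ^ 2 / K)"
    using x by (intro mult_left_mono) auto
  also have "\<dots> = real (n\<^sup>2 - m) * Y + x * (2 * real n * (2 - 2 * ln c) + 2 * real n * (ln (real n) + 1))
      + x / K * (1 + ln (real n)) ^ 2"
    using remaining_frac_mult by (simp add: algebra_simps)
  also have "\<dots> \<le> real (n\<^sup>2 - m) * Y + 1 * (2 * real n * (2 - 2 * ln c) + 2 * real n * (ln (real n) + 1))
      + real n / c * (1 + ln (real n)) ^ 2"
  proof (intro add_mono order_refl mult_right_mono)
    have "ln c \<le> 0" using c cx remaining_frac_le_1 by simp
    thus "0 \<le> 2 * real n * (2 - 2 * ln c) + 2 * real n * (ln (real n) + 1)"
      using ln_n_ge_1 n0 by (intro add_nonneg_nonneg mult_nonneg_nonneg) auto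
    \<comment> \<open>The fraction \<open>x\<close> of unfilled cells cancels one of the two factors
      \<open>x\<close> in \<open>K\<close>; this is why the main error contains only the first power
      of \<open>1 / c\<close>.\<close>
    have "x / K = real p ^ 2 / (real n * x)" using x n0 p by (simp add: K_def power2_eq_square)
    also have "\<dots> \<le> real n ^ 2 / (real n * c)"
      using n0 c cx p by (intro frac_le power_mono mult_left_mono) auto
    also have "\<dots> = real n / c" using n0 by (simp add: power2_eq_square)
    finally show "x / K \<le> real n / c" .
  qed (use remaining_frac_le_1 in auto)
  finally show ?thesis by (simp add: S_def Y_def algebra_simps)
qed

lemma ln_card_latin_squares_ge: "real n ^ 2 * ln (real n) - 2 * real n ^ 2 \<le> ln (real (card (latin_squares n)))"
proof -
  have "real n ^ 2 * ln (real n) - 2 * real n ^ 2 = real n * ((real n * ln (real n) - real n) - real n)"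
    by (simp add: power2_eq_square algebra_simps)
  also have "\<dots> \<le> real n * (ln (fact n) - real n)"
    using ln_fact_ge[of n] by (intro mult_left_mono) auto
  also have "\<dots> = ln ((fact n / exp 1 ^ n) ^ n)"
    by (simp add: ln_realpow ln_div)
  also have "\<dots> \<le> ln (real (card (latin_squares n)))"
    using card_latin_squares_ge[of n] by (intro ln_mono) auto
  finally show ?thesis .
qed

text \<open>All terms of order \<open>n^2 * ln n\<close> and \<open>n^2\<close>, including those
  with \<open>ln x\<close>, cancel in \<open>main\<close>. The constant 14 collects 6 from
  \<open>main\<close>, 4 from the terms \<open>2 * n * l\<close> and \<open>2 * n\<close> of the
  cell sum, and 4 from \<open>e3\<close>.\<close>

lemma total_exponent_le:
  assumes "0 < \<rho>" "\<rho> \<le> 1"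
  shows "log_bound n m + log_error n m / \<rho> - ln \<rho> - ln (real (falling (n\<^sup>2) m)) -
      ln (real (card (latin_squares n))) \<le>
    real n * (ln (real n))\<^sup>2 / c +
    (14 - 4 * ln c + 3 / c + 1 / c ^ 2 + (3 / c ^ 3 + 3 / c ^ 2) / \<rho> - ln \<rho>) * (real n * ln (real n))"
proof -
  define l where "l = ln (real n)"
  define F where "F = ln (real (falling (n\<^sup>2) m))"
  define M where "M = real (n\<^sup>2 - m)"
  define E where "E = 3 / c ^ 3 + 3 / c ^ 2"
  have l: "l \<ge> 1" using ln_n_ge_1 by (simp add: l_def)
  have n1: "real n \<ge> 1" using n by simp
  have nl: "real n \<le> real n * l" using l by (simp add: mult_le_cancel_left1)
  have nl1: "1 \<le> real n * l" using nl n1 by linarith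
  have lnl: "l \<le> real n * l" using n1 l by (simp add: mult_le_cancel_right1)
  have M: "real n ^ 2 = real m + M" using m by (simp add: M_def of_nat_diff)
  have lnc: "ln c \<le> 0" using c cx remaining_frac_le_1 by simp
  have ln\<rho>: "ln \<rho> \<le> 0" using assms by simp
  have E: "E \<ge> 0" using c by (simp add: E_def)
  have "log_error n m / \<rho> \<le> real n * E / \<rho>"
    using log_error_le assms unfolding E_def by (intro divide_right_mono) auto
  also have "\<dots> = (E / \<rho>) * real n" by simp
  also have "\<dots> \<le> (E / \<rho>) * (real n * l)" using nl E assms by (intro mult_left_mono) auto
  finally have 1: "log_error n m / \<rho> \<le> (E / \<rho>) * (real n * l)" .
  have 2: "log_bound n m \<le> (3 * F - 3 * real m * l + real n / c ^ 2) +
      (M * (l + 2 * ln x - 2) + 2 * real n * (2 - 2 * ln c) + 2 * real n * l + 2 * real n + real n * (1 + l) ^ 2 / c)"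
    unfolding log_bound_def F_def l_def M_def x_def[symmetric]
    by (intro add_mono sum_ln_open_bound_le sum_ln_cell_bound_le)
  have 3: "F \<le> 2 * real m * l - real m - M * ln x + 2 * l + 1"
    unfolding F_def l_def M_def by (rule ln_falling_le)
  have 4: "(real m + M) * l - 2 * (real m + M) \<le> ln (real (card (latin_squares n)))"
    using ln_card_latin_squares_ge unfolding M l_def by simp
  have main: "3 * F - 3 * real m * l + M * (l + 2 * ln x - 2) - F - ((real m + M) * l - 2 * (real m + M)) \<le> 4 * l + 2"
    using 3 by (simp add: algebra_simps)
  have sq: "real n * (1 + l) ^ 2 / c = real n * l\<^sup>2 / c + 2 / c * (real n * l) + 1 / c * real n"
    by (simp add: power2_eq_square algebra_simps add_divide_distrib)
  have e1: "1 / c * real n \<le> 1 / c * (real n * l)" using nl c by (intro mult_left_mono) auto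
  have e2: "real n / c ^ 2 \<le> 1 / c ^ 2 * (real n * l)" using nl c by (simp add: divide_right_mono)
  have e3: "2 * real n * (2 - 2 * ln c) \<le> (4 - 4 * ln c) * (real n * l)"
    using mult_left_mono[OF nl, of "4 - 4 * ln c"] lnc by (simp add: algebra_simps)
  have e4: "- ln \<rho> \<le> (- ln \<rho>) * (real n * l)"
    using mult_left_mono[OF nl1, of "- ln \<rho>"] ln\<rho> by simp
  have "log_bound n m + log_error n m / \<rho> - ln \<rho> - F - ln (real (card (latin_squares n))) \<le>
      real n * l\<^sup>2 / c + (14 * (real n * l) + (- 4 * ln c) * (real n * l) + 3 / c * (real n * l)
        + 1 / c ^ 2 * (real n * l) + (E / \<rho>) * (real n * l) + (- ln \<rho>) * (real n * l))"
  proof -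
    have "3 / c * (real n * l) = 2 / c * (real n * l) + 1 / c * (real n * l)"
      by (simp add: field_simps)
    moreover have "(4 - 4 * ln c) * (real n * l) = 4 * (real n * l) + (- 4 * ln c) * (real n * l)"
      by (simp add: algebra_simps)
    moreover have "2 * real n * l = 2 * (real n * l)" by simp
    moreover define P where "P = real n * l"
    moreover define G where "G = M * (l + 2 * ln x - 2)"
    moreover define Q where "Q = (real m + M) * l - 2 * (real m + M)"
    moreover define H where "H = 3 * real m * l"
    ultimately show ?thesis
      using 1 2 4 main sq e1 e2 e3 e4 nl nl1 lnl
      unfolding P_def[symmetric] G_def[symmetric] Q_def[symmetric] H_def[symmetric] by linarith
  qed
  also have "\<dots> = real n * l\<^sup>2 / c +
      (14 - 4 * ln c + 3 / c + 1 / c ^ 2 + E / \<rho> - ln \<rho>) * (real n * l)"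
    by (simp add: algebra_simps)
  finally show ?thesis by (simp only: l_def F_def E_def)
qed

end

theorem lemma4p7:
  fixes \<alpha> \<rho> :: real
  assumes "0 < \<alpha>" and "\<alpha> < 1" and "0 < \<rho>" and "\<rho> \<le> 1"
  shows "\<exists>\<delta> :: nat \<Rightarrow> real. \<delta> \<longlonglongrightarrow> 0 \<and>
    (\<forall>\<^sub>F n in sequentially. \<forall>m U T.
       m = nat \<lfloor>\<alpha> * (real n)\<^sup>2\<rfloor> \<longrightarrow>
       U \<subseteq> ordered_pls n m \<longrightarrow> T \<subseteq> latin_squares n \<longrightarrow> inherited \<rho> m U T \<longrightarrow>
       measure_pmf.prob (pmf_of_set (latin_squares n)) T
         \<le> exp (real n * (ln (real n))\<^sup>2 / (1 - \<alpha> - \<delta> n)) * measure_pmf.prob (TRP n m) (Some ` U))"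
proof -
  define c where "c = 1 - \<alpha>"
  have c: "c > 0" "c < 1" using assms by (simp_all add: c_def)
  define C where "C = 14 - 4 * ln c + 3 / c + 1 / c ^ 2 + (3 / c ^ 3 + 3 / c ^ 2) / \<rho> - ln \<rho>"
  have C: "C > 0"
  proof -
    have "ln c \<le> 0" "ln \<rho> \<le> 0" using c assms by simp_all
    moreover have "3 / c + 1 / c ^ 2 + (3 / c ^ 3 + 3 / c ^ 2) / \<rho> \<ge> 0" using c assms by simp
    ultimately show ?thesis by (simp add: C_def)
  qed
  \<comment> \<open>Chosen so that \<open>C * n * ln n\<close> equals
    \<open>n * (ln n)^2 * \<delta> n / c^2\<close>: the lower-order error is the first-order effect
    of replacing \<open>1 / c\<close> by \<open>1 / (c - \<delta> n)\<close>.\<close>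
  define \<delta> where "\<delta> n = c ^ 2 * C / ln (real n)" for n :: nat
  have lim: "\<delta> \<longlonglongrightarrow> 0"
    unfolding \<delta>_def
    by (intro real_tendsto_divide_at_top[OF tendsto_const] filterlim_compose[OF ln_at_top filterlim_real_sequentially])
  have "\<forall>\<^sub>F n in sequentially. \<delta> n < c" using order_tendstoD(2)[OF lim, of c] c by simp
  moreover have "\<forall>\<^sub>F n :: nat in sequentially. n \<ge> 3" by (rule eventually_ge_at_top)
  ultimately have "\<forall>\<^sub>F n in sequentially. \<forall>m U T.
       m = nat \<lfloor>\<alpha> * (real n)\<^sup>2\<rfloor> \<longrightarrow>
       U \<subseteq> ordered_pls n m \<longrightarrow> T \<subseteq> latin_squares n \<longrightarrow> inherited \<rho> m U T \<longrightarrow>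
       measure_pmf.prob (pmf_of_set (latin_squares n)) T
         \<le> exp (real n * (ln (real n))\<^sup>2 / (1 - \<alpha> - \<delta> n)) * measure_pmf.prob (TRP n m) (Some ` U)"
  proof eventually_elim
    case (elim n)
    show ?case
    proof (intro allI impI)
      fix m U T
      assume m_def: "m = nat \<lfloor>\<alpha> * (real n)\<^sup>2\<rfloor>" and T: "T \<subseteq> latin_squares n" and inh: "inherited \<rho> m U T"
      define N where "N = real (card (latin_squares n))"
      define F where "F = real (falling (n\<^sup>2) m)"
      define B where "B = log_bound n m + log_error n m / \<rho>"
      define l where "l = ln (real n)"
      have n0: "real n > 0" using elim by simp
      have m_le: "real m \<le> \<alpha> * (real n)\<^sup>2" unfolding m_def using assms by simp
      also have "\<dots> < real (n\<^sup>2)" using assms n0 by simp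
      finally have m: "m < n\<^sup>2" by (simp only: of_nat_less_iff)
      \<comment> \<open>Rounding down can only increase the remaining fraction, so
        \<open>1 - \<alpha>\<close> is a valid lower bound.\<close>
      have cx: "c \<le> remaining_frac n m"
        using m_le m n0 by (simp add: remaining_frac_def c_def of_nat_diff le_divide_eq algebra_simps)
      have l: "l \<ge> 1" unfolding l_def by (rule ln_n_ge_1[OF elim(2) m c(1) refl cx])
      have N: "N > 0" using finite_latin_squares latin_squares_nonempty by (simp add: N_def card_gt_0_iff)
      have F: "F > 0" using falling_pos[of m "n\<^sup>2"] m by (simp add: F_def)
      have \<delta>: "\<delta> n < c" "\<delta> n > 0" using elim l C c by (simp_all add: \<delta>_def l_def)
      have "B - ln \<rho> - ln F - ln N \<le> real n * l\<^sup>2 / c + C * (real n * l)"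
        unfolding B_def F_def N_def l_def C_def
        by (rule total_exponent_le[OF elim(2) m c(1) refl cx assms(3,4)])
      also have "\<dots> = real n * l\<^sup>2 * (1 / c + \<delta> n / c ^ 2)"
        using l c by (simp add: \<delta>_def l_def[symmetric] power2_eq_square field_simps)
      also have "\<dots> \<le> real n * l\<^sup>2 * (1 / (c - \<delta> n))"
      proof (intro mult_left_mono)
        have "(1 / c + \<delta> n / c ^ 2) * (c - \<delta> n) = 1 - (\<delta> n / c) ^ 2"
          using c by (simp add: power2_eq_square field_simps)
        also have "\<dots> \<le> 1" by simp
        finally show "1 / c + \<delta> n / c ^ 2 \<le> 1 / (c - \<delta> n)" using \<delta> by (simp add: le_divide_eq)
      qed simp
      finally have ex: "B - ln \<rho> - ln F - ln N \<le> real n * l\<^sup>2 / (1 - \<alpha> - \<delta> n)"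
        by (simp add: c_def)
      have "measure_pmf.prob (pmf_of_set (latin_squares n)) T = real (card T) / N"
        using T finite_latin_squares latin_squares_nonempty
        by (simp add: measure_pmf_of_set N_def Int_absorb1)
      also have "\<dots> = (real (card T) * \<rho> * F * exp (- B)) * exp (B - ln \<rho> - ln F - ln N)"
      proof -
        have "exp (B - ln \<rho> - ln F - ln N) = exp B / (\<rho> * F * N)"
          using N F assms(3) by (simp add: exp_diff)
        thus ?thesis using N F assms(3) by (simp add: exp_minus field_simps)
      qed
      also have "\<dots> \<le> measure_pmf.prob (TRP n m) (Some ` U) * exp (real n * l\<^sup>2 / (1 - \<alpha> - \<delta> n))"
      proof (rule mult_mono)
        show "real (card T) * \<rho> * F * exp (- B) \<le> measure_pmf.prob (TRP n m) (Some ` U)"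
          unfolding F_def B_def by (rule trp_probability_ge[OF _ m T inh assms(3)]) (use elim in simp)
      qed (use ex in auto)
      finally show "measure_pmf.prob (pmf_of_set (latin_squares n)) T
         \<le> exp (real n * (ln (real n))\<^sup>2 / (1 - \<alpha> - \<delta> n)) * measure_pmf.prob (TRP n m) (Some ` U)"
        by (simp add: l_def mult.commute)
    qed
  qed
  thus ?thesis using lim by blast
qed

end
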